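(* Let $p$ be a prime, $c>1$ a constant, $\alpha_n=\frac{c\log n}{n}$, and for each $n$ with $\alpha_n\le1/2$ let $\beta_n\in[\alpha_n,1-\alpha_n]$ and let $\Gamma(n)\in G(n,\beta_n)$ be an Erdős–Rényi random graph. Then for every finite abelian $p$-group $G$, $\lim_{n\to\infty}\mathbb{E}(\#\mathrm{Sur}(S_{\Gamma(n),p},G))=|\wedge^2 G|$.
   Context: $G(n,q)$ is the Erdős–Rényi random graph on $n$ vertices with independent edge probability $q$. $S_\Gamma$ is the sandpile group of $\Gamma$ (cokernel of the reduced Laplacian) and $S_{\Gamma,p}$ its Sylow $p$-subgroup (subgroup of elements of $p$-power order). $\mathrm{Sur}(A,B)$ is the set of surjective homomorphisms $A\to B$, and $\wedge^2G$ is the quotient of $G\otimes G$ by the subgroup generated by elements $g\otimes g$. *)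

theory Defs
  imports
    "HOL-Probability.Probability"
    "HOL-Algebra.Free_Abelian_Groups"
    "HOL-Algebra.Multiplicative_Group"
    "Jordan_Normal_Form.Determinant"
begin

text \<open>A simple graph with vertex set \<open>{..<n}\<close> is given by its set of edges, each edge being a
  two-element subset of \<open>{..<n}\<close>.\<close>

definition possible_edges :: "nat \<Rightarrow> nat set set" where
  "possible_edges n = {e. e \<subseteq> {..<n} \<and> card e = 2}"

definition erdos_renyi :: "nat \<Rightarrow> real \<Rightarrow> nat set set pmf" where
  "erdos_renyi n q =
     map_pmf (\<lambda>b. {e \<in> possible_edges n. b e})
       (Pi_pmf (possible_edges n) False (\<lambda>_. bernoulli_pmf q))"

definition laplacian :: "nat \<Rightarrow> nat set set \<Rightarrow> int mat" where
  "laplacian n E = mat n n (\<lambda>(i, j).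
     if i = j then int (card {e \<in> E. i \<in> e}) else if {i, j} \<in> E then - 1 else 0)"

text \<open>The deleted vertex is the last one; up to isomorphism the cokernel does not depend on
  this choice.\<close>

definition reduced_laplacian :: "nat \<Rightarrow> nat set set \<Rightarrow> int mat" where
  "reduced_laplacian n E = mat_delete (laplacian n E) (n - 1) (n - 1)"

definition cokernel :: "int mat \<Rightarrow> int vec set monoid" where
  "cokernel A =
     monoid_vec TYPE(int) (dim_row A) Mod ((\<lambda>v. A *\<^sub>v v) ` carrier_vec (dim_col A))"

definition sandpile_group :: "nat \<Rightarrow> nat set set \<Rightarrow> int vec set monoid" where
  "sandpile_group n E = cokernel (reduced_laplacian n E)"

text \<open>The sandpile group of a disconnected graph is infinite. Elements of infinite order have
  \<open>ord\<close> equal to \<open>0\<close>, which is not a power of a prime, so they are excluded here.\<close>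

definition sylow_part :: "nat \<Rightarrow> ('a, 'b) monoid_scheme \<Rightarrow> ('a, 'b) monoid_scheme" where
  "sylow_part p S = S\<lparr>carrier := {x \<in> carrier S. \<exists>k. group.ord S x = p ^ k}\<rparr>"

text \<open>Extensionality gives one function per homomorphism, so that the cardinality is the right one.\<close>

definition Sur :: "('a, 'c) monoid_scheme \<Rightarrow> ('b, 'd) monoid_scheme \<Rightarrow> ('a \<Rightarrow> 'b) set" where
  "Sur A B = epi A B \<inter> extensional (carrier A)"

definition tensor_relations ::
    "('a, 'c) monoid_scheme \<Rightarrow> ('b, 'd) monoid_scheme \<Rightarrow> ('a \<times> 'b \<Rightarrow>\<^sub>0 int) set" where
  "tensor_relations A B = generate (free_Abelian_group (carrier A \<times> carrier B))
     ({frag_of (x \<otimes>\<^bsub>A\<^esub> x', y) - frag_of (x, y) - frag_of (x', y) | x x' y.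
         x \<in> carrier A \<and> x' \<in> carrier A \<and> y \<in> carrier B} \<union>
      {frag_of (x, y \<otimes>\<^bsub>B\<^esub> y') - frag_of (x, y) - frag_of (x, y') | x y y'.
         x \<in> carrier A \<and> y \<in> carrier B \<and> y' \<in> carrier B})"

definition tensor_group ::
    "('a, 'c) monoid_scheme \<Rightarrow> ('b, 'd) monoid_scheme \<Rightarrow> ('a \<times> 'b \<Rightarrow>\<^sub>0 int) set monoid" where
  "tensor_group A B = free_Abelian_group (carrier A \<times> carrier B) Mod tensor_relations A B"

definition pure_tensor ::
    "('a, 'c) monoid_scheme \<Rightarrow> ('b, 'd) monoid_scheme \<Rightarrow> 'a \<Rightarrow> 'b \<Rightarrow> ('a \<times> 'b \<Rightarrow>\<^sub>0 int) set" where
  "pure_tensor A B x y =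
     tensor_relations A B #>\<^bsub>free_Abelian_group (carrier A \<times> carrier B)\<^esub> frag_of (x, y)"

definition exterior_square ::
    "('a, 'c) monoid_scheme \<Rightarrow> ('a \<times> 'a \<Rightarrow>\<^sub>0 int) set set monoid" where
  "exterior_square A = tensor_group A A Mod
     generate (tensor_group A A) {pure_tensor A A g g | g. g \<in> carrier A}"

end

theory Submission
  imports
    Defs
    "HOL-Real_Asymp.Real_Asymp"
    "HOL-Number_Theory.Cong"
begin

text \<open>
  Surjections from the cokernel of the reduced Laplacian to \<open>G\<close> are the generating tuples
  \<open>f\<^sub>0, \<dots>, f\<^sub>n\<^sub>-\<^sub>2\<close> of \<open>G\<close>, completed by \<open>f\<^sub>n\<^sub>-\<^sub>1 = 1\<close>, that are killed by all columns. Detecting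
  this by characters \<open>C\<^sub>j\<close> turns the expected number of surjections into the sum over all maps
  \<open>w = (f, C)\<close> from the vertices to the phase space \<open>V = G \<times> G^\<close>, rooted at the last vertex, of the
  product over all pairs of vertices of \<open>1 - q + q K(w\<^sub>i, w\<^sub>j)\<close>, divided by \<open>|G|^(n - 1)\<close>. Here
  \<open>K\<close> is a symmetric kernel with values on the unit circle.

  By character orthogonality, a subset of \<open>V\<close> on which \<open>K\<close> is identically \<open>1\<close> has at most \<open>|G|\<close>
  elements, and if it has exactly \<open>|G|\<close> elements then \<open>K(v, \<cdot>)\<close> sums to \<open>0\<close> over it for every other
  \<open>v\<close>. Maps into such a maximal null set have weight \<open>1\<close>; those with \<open>f\<close> generating are, up to
  negligible terms, pairs of a surjective \<open>f\<close> and an alternating bicharacter of \<open>G\<close>, and this gives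
  the main term \<open>|\<and>\<^sup>2 G|\<close>. For all other maps the weight is at most
  \<open>exp (- q (1 - q) \<Sum> (1 - Re K))\<close>. A map with \<open>k\<close> values outside a maximal null set, \<open>k\<close> small,
  loses a factor of about \<open>n^(-c)\<close> for each of them, which beats the \<open>n^k\<close> choices of their positions
  since \<open>c > 1\<close>; the remaining maps are controlled by entropy.

  The Sylow part and the full cokernel admit equally many surjections to a \<open>p\<close>-group when the reduced
  Laplacian is nonsingular. A singular one has at least \<open>2^k\<close> surjections to \<open>\<int>/2^(k+1)\<close>, whose
  expected number tends to \<open>1\<close>, so singularity has probability tending to \<open>0\<close>; its contribution to
  the moment vanishes because all moments of the number of homomorphisms are bounded.
\<close>

section \<open>Characters of finite abelian groups\<close>

text \<open>The condition c > 1 is exactly what the estimate asks for, because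
  \<open>1 - Re K\<close> averages to exactly 1 over a maximal null set, for every label outside it.
  One stray vertex facing about n vertices whose labels run through such a set costs about exp(- q
  (1 - q) n), roughly n^(-c), whatever its label is. A bound pair by pair cannot see this: the
  distance from a stray label to single elements of the null set may be 0.

  The obstacle is entropy: there are about |G|^(2n) labellings, but the normalisation is only |G|^n.
  Hence the exact bound |G| for the size of a null set matters, and labels that occur linearly often
  have to be treated apart from the others.

  The limit of the moments is proved for all finite abelian groups, because it is applied to cyclic
  2-groups to exclude singular matrices, whatever p is; the boundedness is likewise applied to
  powers of groups, to obtain higher moments. Singular matrices have to be excluded since their
  cokernel has a free part, which admits surjections to G that the Sylow part does not see.\<close>

definition circle_group :: "complex monoid" where
  "circle_group = \<lparr>carrier = {z. norm z = 1}, mult = (*), one = 1\<rparr>"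

lemma carrier_circle_group [simp]: "carrier circle_group = {z. norm z = 1}"
  and mult_circle_group [simp]: "x \<otimes>\<^bsub>circle_group\<^esub> y = x * y"
  and one_circle_group [simp]: "\<one>\<^bsub>circle_group\<^esub> = 1"
  by (simp_all add: circle_group_def)

lemma norm_1_mult_cnj: "norm z = 1 \<Longrightarrow> z * cnj z = 1" "norm z = 1 \<Longrightarrow> cnj z * z = 1"
  by (simp_all add: complex_norm_square [symmetric] mult.commute)

lemma comm_group_circle_group: "comm_group circle_group"
proof (rule comm_groupI)
  show "\<exists>y\<in>carrier circle_group. y \<otimes>\<^bsub>circle_group\<^esub> x = \<one>\<^bsub>circle_group\<^esub>"
    if "x \<in> carrier circle_group" for x
    using that by (intro bexI[of _ "cnj x"]) (auto simp: norm_1_mult_cnj)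
qed (auto simp: norm_mult)

lemma pow_circle_group [simp]: "x [^]\<^bsub>circle_group\<^esub> (n::nat) = x ^ n"
proof -
  interpret comm_group circle_group by (rule comm_group_circle_group)
  show ?thesis by (induction n) auto
qed

text \<open>Extensional functions, so that equality is equality on the carrier and a finite group
  has finitely many characters.\<close>

definition characters :: "('a, 'b) monoid_scheme \<Rightarrow> ('a \<Rightarrow> complex) set" where
  "characters G = hom G circle_group \<inter> extensional (carrier G)"

lemma charactersD:
  assumes "\<xi> \<in> characters G"
  shows "x \<in> carrier G \<Longrightarrow> norm (\<xi> x) = 1"
    and "x \<in> carrier G \<Longrightarrow> y \<in> carrier G \<Longrightarrow> \<xi> (x \<otimes>\<^bsub>G\<^esub> y) = \<xi> x * \<xi> y"
    and "x \<notin> carrier G \<Longrightarrow> \<xi> x = undefined"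
  using assms by (auto simp: characters_def hom_def extensional_def)

lemma charactersI:
  assumes "\<And>x. x \<in> carrier G \<Longrightarrow> norm (\<xi> x) = 1"
    and "\<And>x y. x \<in> carrier G \<Longrightarrow> y \<in> carrier G \<Longrightarrow> \<xi> (x \<otimes>\<^bsub>G\<^esub> y) = \<xi> x * \<xi> y"
    and "\<And>x. x \<notin> carrier G \<Longrightarrow> \<xi> x = undefined"
  shows "\<xi> \<in> characters G"
  using assms by (auto simp: characters_def hom_def extensional_def)

lemma characters_cnj_mult:
  assumes "\<xi> \<in> characters G" "x \<in> carrier G"
  shows "\<xi> x * cnj (\<xi> x) = 1" "cnj (\<xi> x) * \<xi> x = 1"
  using charactersD(1)[OF assms] norm_1_mult_cnj by auto

lemma characters_eqI:
  assumes "\<xi> \<in> characters G" "\<psi> \<in> characters G" "\<And>x. x \<in> carrier G \<Longrightarrow> \<xi> x = \<psi> x"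
  shows "\<xi> = \<psi>"
  using assms by (auto simp: characters_def intro: extensionalityI)

definition trivial_character :: "('a, 'b) monoid_scheme \<Rightarrow> 'a \<Rightarrow> complex" where
  "trivial_character G = (\<lambda>x\<in>carrier G. 1)"

context group
begin

lemma character_group_hom: "\<xi> \<in> characters G \<Longrightarrow> group_hom G circle_group \<xi>"
  using comm_group_circle_group
  by (auto simp: characters_def group_hom_def group_hom_axioms_def comm_group_def is_group)

lemma character_one [simp]: "\<xi> \<in> characters G \<Longrightarrow> \<xi> \<one> = 1"
  using group_hom.hom_one[OF character_group_hom] by fastforce

lemma character_pow: "\<xi> \<in> characters G \<Longrightarrow> x \<in> carrier G \<Longrightarrow> \<xi> (x [^] (n::nat)) = \<xi> x ^ n"
  using group_hom.hom_nat_pow[OF character_group_hom] by fastforce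

lemma character_inv: "\<xi> \<in> characters G \<Longrightarrow> x \<in> carrier G \<Longrightarrow> \<xi> (inv x) = cnj (\<xi> x)"
proof -
  assume a: "\<xi> \<in> characters G" "x \<in> carrier G"
  have "\<xi> (inv x) * \<xi> x = 1"
    using a charactersD(2)[OF a(1), of "inv x" x] by simp
  then have "\<xi> (inv x) * \<xi> x * cnj (\<xi> x) = cnj (\<xi> x)" by simp
  then show ?thesis using characters_cnj_mult[OF a] by (simp add: mult.assoc)
qed

lemma trivial_character [simp, intro]: "trivial_character G \<in> characters G"
  by (rule charactersI) (auto simp: trivial_character_def)

lemma characters_mult:
  assumes "\<xi> \<in> characters G" "\<psi> \<in> characters G"
  shows "(\<lambda>x\<in>carrier G. \<xi> x * \<psi> x) \<in> characters G"
  using assms by (intro charactersI) (auto simp: charactersD norm_mult)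

lemma characters_cnj:
  assumes "\<xi> \<in> characters G"
  shows "(\<lambda>x\<in>carrier G. cnj (\<xi> x)) \<in> characters G"
  using assms by (intro charactersI) (auto simp: charactersD)

end

section \<open>Divisibility of the circle and extension of characters\<close>

lemma norm_one_root_exists:
  assumes "norm z = 1" "t > (0::nat)"
  obtains y :: complex where "y ^ t = z" "norm y = 1"
proof -
  have "z \<noteq> 0" using assms by auto
  then have z: "z = cis (Arg z)" using cis_Arg[of z] assms by (simp add: sgn_div_norm)
  show ?thesis
    by (rule that[of "cis (Arg z / t)"]) (use assms z Complex.DeMoivre[of "Arg z / t" t] in auto)
qed

context comm_group
begin

text \<open>The value at h a^i has to be \<xi>(h) z^i. Since a^d lies in \<open>H\<close> exactly
  for the multiples of \<open>t\<close>, two representations of one element differ by a power of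
  a^t, and z^t = \<xi>(a^t) is the only consistency condition. The root \<open>z\<close> is left
  free: an arbitrary one serves to extend a character, one different from 1 to separate
  elements.\<close>

lemma character_extend_step:
  assumes H: "subgroup H G" and a: "a \<in> carrier G" and \<xi>: "\<xi> \<in> characters (G\<lparr>carrier := H\<rparr>)"
    and t: "t > 0" "\<And>d. a [^] (d::nat) \<in> H \<longleftrightarrow> t dvd d"
    and z: "z ^ t = \<xi> (a [^] t)" "norm z = 1"
  defines "H' \<equiv> (\<lambda>(h, i::nat). h \<otimes> a [^] i) ` (H \<times> UNIV)"
  shows "subgroup H' G" "H \<subseteq> H'" "a \<in> H'"
    "\<exists>\<psi> \<in> characters (G\<lparr>carrier := H'\<rparr>). (\<forall>h\<in>H. \<psi> h = \<xi> h) \<and> \<psi> a = z"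
proof -
  interpret H: subgroup H G by (rule H)
  have \<xi>m: "\<xi> (x \<otimes> y) = \<xi> x * \<xi> y" if "x \<in> H" "y \<in> H" for x y
    using charactersD(2)[OF \<xi>] that by simp
  have \<xi>n: "norm (\<xi> x) = 1" if "x \<in> H" for x
    using charactersD(1)[OF \<xi>] that by simp
  have at: "a [^] t \<in> H" using t(2)[of t] by simp
  have \<xi>1: "\<xi> \<one> = 1" using group.character_one[OF H.subgroup_is_group[OF is_group] \<xi>] by simp
  have \<xi>t: "\<xi> (a [^] (t * l)) = z ^ (t * l)" for l
  proof (induction l)
    case (Suc l)
    have "a [^] (t * Suc l) = a [^] t \<otimes> a [^] (t * l)" using a by (simp add: nat_pow_mult)
    then show ?case using Suc at t(2)[of "t*l"] by (simp add: \<xi>m power_add z)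
  qed (simp add: \<xi>1)
  have wd: "\<xi> h * z ^ i = \<xi> h' * z ^ j"
    if "h \<in> H" "h' \<in> H" "h \<otimes> a [^] i = h' \<otimes> a [^] j" "i \<le> j" for h h' and i j :: nat
  proof -
    have "a [^] j = a [^] (j - i) \<otimes> a [^] i" using that a by (simp add: nat_pow_mult)
    then have "h \<otimes> a [^] i = (h' \<otimes> a [^] (j - i)) \<otimes> a [^] i"
      using that a by (simp add: m_assoc)
    then have e: "h = h' \<otimes> a [^] (j - i)" using that a by simp
    then have "a [^] (j - i) = inv h' \<otimes> h" using that a by (simp add: m_assoc[symmetric])
    then have m: "a [^] (j - i) \<in> H" using that by simp
    then obtain l where l: "j - i = t * l" using t(2) by (auto elim: dvdE)
    have "\<xi> h = \<xi> h' * z ^ (j - i)" using e m that \<xi>t[of l] l by (simp add: \<xi>m)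
    then show ?thesis using that by (simp add: mult.assoc power_add[symmetric])
  qed
  have wd2: "\<xi> h * z ^ i = \<xi> h' * z ^ j"
    if "h \<in> H" "h' \<in> H" "h \<otimes> a [^] i = h' \<otimes> a [^] j" for h h' and i j :: nat
    using wd[of h h' i j] wd[of h' h j i] that by (metis nle_le)
  have H': "h \<otimes> a [^] i \<in> H'" if "h \<in> H" for h and i :: nat
    unfolding H'_def by (rule image_eqI[of _ _ "(h, i)"]) (use that in auto)
  have H'E: "\<exists>h\<in>H. \<exists>i::nat. x = h \<otimes> a [^] i" if "x \<in> H'" for x
    using that by (auto simp: H'_def)
  have mult: "(h \<otimes> a [^] i) \<otimes> (h' \<otimes> a [^] j) = (h \<otimes> h') \<otimes> a [^] (i + j)"
    if "h \<in> H" "h' \<in> H" for h h' and i j :: nat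
    using that a by (simp add: nat_pow_mult[symmetric] m_ac)
  show "subgroup H' G"
  proof
    show "H' \<subseteq> carrier G" using a by (auto simp: H'_def)
    show "\<one> \<in> H'" using H'[of \<one> 0] by simp
    show "x \<otimes> y \<in> H'" if "x \<in> H'" "y \<in> H'" for x y
    proof -
      obtain h h' and i j :: nat where "h \<in> H" "h' \<in> H" "x = h \<otimes> a [^] i" "y = h' \<otimes> a [^] j"
        using H'E[of x] H'E[of y] \<open>x \<in> H'\<close> \<open>y \<in> H'\<close> by auto
      then show ?thesis using mult H' by simp
    qed
    show "inv x \<in> H'" if "x \<in> H'" for x
    proof -
      obtain h and i :: nat where hi: "h \<in> H" "x = h \<otimes> a [^] i"
        using H'E[of x] \<open>x \<in> H'\<close> by auto
      \<comment> \<open>Only natural exponents occur in \<open>H'\<close>, so the inverse of a^i is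
        rewritten as a^(t i - i) times the inverse of a^(t i), which lies in
        \<open>H\<close>.\<close>
      have "i \<le> t * i" using t(1) by simp
      then have "a [^] (t * i) = a [^] (t * i - i) \<otimes> a [^] i" using a by (simp add: nat_pow_mult)
      moreover have "a [^] (t * i) \<in> H" using t(2) by simp
      moreover have "(inv h \<otimes> inv (B \<otimes> A) \<otimes> B) \<otimes> (h \<otimes> A) = \<one>"
        if "A \<in> carrier G" "B \<in> carrier G" for A B
      proof -
        have "(u \<otimes> v \<otimes> B) \<otimes> (y \<otimes> A) = (u \<otimes> y) \<otimes> (v \<otimes> (B \<otimes> A))"
          if "u \<in> carrier G" "v \<in> carrier G" "y \<in> carrier G" for u v y
          using that \<open>A \<in> carrier G\<close> \<open>B \<in> carrier G\<close> by (simp add: m_ac)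
        from this[of "inv h" "inv (B \<otimes> A)" h]
        show ?thesis using that hi by (simp del: inv_mult_group)
      qed
      ultimately have "inv x = (inv h \<otimes> inv (a [^] (t * i))) \<otimes> a [^] (t * i - i)"
        using hi a by (intro inv_equality) simp_all
      then show ?thesis using H' hi \<open>a [^] (t * i) \<in> H\<close> by simp
    qed
  qed
  show "H \<subseteq> H'" using H'[of _ 0] by auto
  show "a \<in> H'" using H'[of \<one> 1] a by simp
  define P where "P x hi \<longleftrightarrow> fst hi \<in> H \<and> x = fst hi \<otimes> a [^] (snd hi :: nat)" for x hi
  define \<psi> where "\<psi> = (\<lambda>x\<in>H'. let hi = SOME hi. P x hi in \<xi> (fst hi) * z ^ snd hi)"
  have \<psi>: "\<psi> (h \<otimes> a [^] i) = \<xi> h * z ^ i" if "h \<in> H" for h and i :: nat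
  proof -
    have "P (h \<otimes> a [^] i) (SOME hi. P (h \<otimes> a [^] i) hi)"
      by (rule someI[of _ "(h, i)"]) (use that in \<open>auto simp: P_def\<close>)
    then have "\<xi> (fst (SOME hi. P (h \<otimes> a [^] i) hi)) * z ^ snd (SOME hi. P (h \<otimes> a [^] i) hi) = \<xi> h * z ^ i"
      unfolding P_def by (intro wd2) (use that in simp_all)
    then show ?thesis unfolding \<psi>_def Let_def using H'[OF that, of i] by simp
  qed
  have "\<psi> \<in> characters (G\<lparr>carrier := H'\<rparr>)"
  proof (rule charactersI)
    fix x y assume "x \<in> carrier (G\<lparr>carrier := H'\<rparr>)" "y \<in> carrier (G\<lparr>carrier := H'\<rparr>)"
    then obtain h h' and i j :: nat where "h \<in> H" "h' \<in> H" "x = h \<otimes> a [^] i" "y = h' \<otimes> a [^] j"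
      using H'E[of x] H'E[of y] by auto
    then show "\<psi> (x \<otimes>\<^bsub>G\<lparr>carrier := H'\<rparr>\<^esub> y) = \<psi> x * \<psi> y"
      by (simp add: mult \<psi> \<xi>m power_add)
  next
    fix x assume "x \<in> carrier (G\<lparr>carrier := H'\<rparr>)"
    then obtain h and i :: nat where "h \<in> H" "x = h \<otimes> a [^] i"
      using H'E[of x] by auto
    then show "norm (\<psi> x) = 1" by (simp add: \<psi> norm_mult norm_power \<xi>n z)
  qed (simp add: \<psi>_def)
  moreover have "\<psi> h = \<xi> h" if "h \<in> H" for h using \<psi>[of h 0] that by simp
  moreover have "\<psi> a = z" using \<psi>[of \<one> 1] a by (simp add: \<xi>1)
  ultimately show "\<exists>\<psi> \<in> characters (G\<lparr>carrier := H'\<rparr>). (\<forall>h\<in>H. \<psi> h = \<xi> h) \<and> \<psi> a = z" by blast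
qed

lemma exists_relative_order:
  assumes "finite (carrier G)" "subgroup H G" "a \<in> carrier G"
  obtains t where "t > 0" "\<And>d. a [^] (d::nat) \<in> H \<longleftrightarrow> t dvd d"
proof -
  interpret H: subgroup H G by fact
  define t where "t = (LEAST d. d > 0 \<and> a [^] (d::nat) \<in> H)"
  have "order G > 0 \<and> a [^] order G \<in> H"
    using assms pow_order_eq_1 by (auto simp: order_gt_0_iff_finite)
  then have t: "t > 0" "a [^] t \<in> H"
    unfolding t_def by (metis (mono_tags, lifting) LeastI)+
  have tl: "a [^] (t * l) \<in> H" for l
  proof (induction l)
    case (Suc l)
    have "a [^] (t * Suc l) = a [^] t \<otimes> a [^] (t * l)" using assms by (simp add: nat_pow_mult)
    then show ?case using Suc t by simp
  qed simp
  have "t dvd d" if d: "a [^] d \<in> H" for d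
  proof -
    have "a [^] d = a [^] (t * (d div t)) \<otimes> a [^] (d mod t)" using assms by (simp add: nat_pow_mult)
    then have "a [^] (d mod t) = inv (a [^] (t * (d div t))) \<otimes> a [^] d"
      using assms by (simp add: m_assoc[symmetric])
    then have "a [^] (d mod t) \<in> H" using d tl by simp
    moreover have "d mod t < t" using t by simp
    ultimately have "d mod t = 0"
      using not_less_Least[of "d mod t" "\<lambda>d. d > 0 \<and> a [^] d \<in> H"] unfolding t_def[symmetric] by simp
    then show ?thesis by auto
  qed
  moreover have "a [^] d \<in> H" if "t dvd d" for d using that tl by (auto elim: dvdE)
  ultimately show ?thesis using that t by blast
qed

text \<open>The circle is divisible, so a root as in \<open>character_extend_step\<close> always
  exists; adjoining elements outside \<open>H\<close> one at a time exhausts the group.\<close>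

lemma character_extend:
  assumes fin: "finite (carrier G)" and H: "subgroup H G"
    and \<xi>: "\<xi> \<in> characters (G\<lparr>carrier := H\<rparr>)"
  shows "\<exists>\<psi>\<in>characters G. \<forall>h\<in>H. \<psi> h = \<xi> h"
  using H \<xi>
proof (induction "card (carrier G) - card H" arbitrary: H \<xi> rule: less_induct)
  case less
  show ?case
  proof (cases "H = carrier G")
    case True
    then show ?thesis using less by auto
  next
    case False
    have sub: "H \<subseteq> carrier G" using less(2) subgroup.subset by blast
    with False obtain a where a: "a \<in> carrier G" "a \<notin> H" by blast
    obtain t where t: "t > 0" "\<And>d. a [^] (d::nat) \<in> H \<longleftrightarrow> t dvd d"
      using exists_relative_order[OF fin less(2) a(1)] by blast
    have "norm (\<xi> (a [^] t)) = 1"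
      using charactersD(1)[OF less(3), of "a [^] t"] t(2)[of t] by simp
    then obtain z where z: "z ^ t = \<xi> (a [^] t)" "norm z = 1"
      using norm_one_root_exists t(1) by blast
    define H' where "H' = (\<lambda>(h, i::nat). h \<otimes> a [^] i) ` (H \<times> UNIV)"
    obtain \<psi> where \<psi>: "\<psi> \<in> characters (G\<lparr>carrier := H'\<rparr>)" "\<forall>h\<in>H. \<psi> h = \<xi> h"
      and H': "subgroup H' G" "H \<subseteq> H'" "a \<in> H'"
      using character_extend_step[OF less(2) a(1) less(3) t z] unfolding H'_def by blast
    have "H' \<subseteq> carrier G" using H' subgroup.subset by blast
    then have "card H < card H'" "card H' \<le> card (carrier G)"
      using H' a fin by (auto intro!: psubset_card_mono card_mono dest: finite_subset)
    then obtain \<psi>' where "\<psi>' \<in> characters G" "\<forall>h\<in>H'. \<psi>' h = \<psi> h"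
      using less(1)[of H' \<psi>] H' \<psi> diff_less_mono2 by (metis less_le_trans)
    then show ?thesis using \<psi> H' by (intro bexI[of _ \<psi>']) auto
  qed
qed

lemma characters_separate:
  assumes fin: "finite (carrier G)" and a: "a \<in> carrier G" "a \<noteq> \<one>"
  shows "\<exists>\<xi>\<in>characters G. \<xi> a \<noteq> 1"
proof -
  define H where "H = {\<one>}"
  have H: "subgroup H G" by (simp add: H_def triv_subgroup)
  obtain t where t: "t > 0" "\<And>d. a [^] (d::nat) \<in> H \<longleftrightarrow> t dvd d"
    using exists_relative_order[OF fin H a(1)] by blast
  have "t \<noteq> 1" using t(2)[of 1] a by (auto simp: H_def)
  \<comment> \<open>Over the trivial subgroup \<open>t\<close> is the order of \<open>a\<close>,
    which is not 1; any \<open>t\<close>-th root of unity other than 1 could serve as the value at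
    \<open>a\<close>.\<close>
  define z where "z = cis (2 * pi / t)"
  have "z ^ t = 1" using t(1) Complex.DeMoivre[of "2 * pi / t" t] by (simp add: z_def)
  moreover have "z \<noteq> 1"
  proof
    assume "z = 1"
    then have "cos (2 * pi / t) = 1" by (simp add: z_def complex_eq_iff)
    then obtain k :: int where k: "2 * pi / t = k * 2 * pi" by (auto simp: cos_one_2pi_int)
    then have "real_of_int k * real t = 1" using t(1) by (simp add: field_simps)
    then have "k * int t = 1" by (metis of_int_1 of_int_eq_iff of_int_mult of_int_of_nat_eq)
    then show False using \<open>t \<noteq> 1\<close> by (simp add: zmult_eq_1_iff)
  qed
  moreover have "a [^] t = \<one>" using t(2)[of t] by (simp add: H_def)
  moreover define \<xi> where "\<xi> = trivial_character (G\<lparr>carrier := H\<rparr>)"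
  moreover have \<xi>: "\<xi> \<in> characters (G\<lparr>carrier := H\<rparr>)"
    using group.trivial_character[OF subgroup.subgroup_is_group[OF H is_group]] by (simp add: \<xi>_def)
  ultimately have z: "z ^ t = \<xi> (a [^] t)" "norm z = 1" "z \<noteq> 1"
    by (auto simp: trivial_character_def H_def z_def)
  define H' where "H' = (\<lambda>(h, i::nat). h \<otimes> a [^] i) ` (H \<times> UNIV)"
  obtain \<psi> where \<psi>: "\<psi> \<in> characters (G\<lparr>carrier := H'\<rparr>)" "\<psi> a = z"
    and H': "subgroup H' G" "a \<in> H'"
    using character_extend_step[OF H a(1) \<xi> t z(1,2)] unfolding H'_def by blast
  from character_extend[OF fin H'(1) \<psi>(1)] show ?thesis using \<psi> H' z by metis
qed

lemma finite_characters:
  assumes fin: "finite (carrier G)"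
  shows "finite (characters G)"
proof -
  have "characters G \<subseteq> carrier G \<rightarrow>\<^sub>E {z. z ^ order G = 1}"
  proof
    fix \<xi> assume \<xi>: "\<xi> \<in> characters G"
    have "\<xi> x ^ order G = 1" if "x \<in> carrier G" for x
      using character_pow[OF \<xi> that, of "order G"] pow_order_eq_1[OF that] \<xi> by simp
    then show "\<xi> \<in> carrier G \<rightarrow>\<^sub>E {z. z ^ order G = 1}"
      using \<xi> by (auto simp: characters_def extensional_def)
  qed
  moreover have "finite {z::complex. z ^ order G = 1}"
    using fin by (intro finite_roots_unity) (auto simp: order_gt_0_iff_finite Suc_leI)
  ultimately show ?thesis using fin by (meson finite_PiE finite_subset)
qed

section \<open>Orthogonality relations and duality\<close>

lemma characters_orthogonal:
  assumes fin: "finite (carrier G)" and "\<xi> \<in> characters G" "\<psi> \<in> characters G"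
  shows "(\<Sum>x\<in>carrier G. \<xi> x * cnj (\<psi> x)) = (if \<xi> = \<psi> then of_nat (card (carrier G)) else 0)"
proof (cases "\<xi> = \<psi>")
  case True
  then show ?thesis using assms by (simp add: characters_cnj_mult)
next
  case False
  let ?f = "\<lambda>x. \<xi> x * cnj (\<psi> x)"
  obtain y where y: "y \<in> carrier G" "\<xi> y \<noteq> \<psi> y" using False characters_eqI assms by blast
  have "?f y \<noteq> 1"
  proof
    assume "?f y = 1"
    then have "\<xi> y * (cnj (\<psi> y) * \<psi> y) = \<psi> y" by (metis mult.assoc mult_1)
    then show False using y characters_cnj_mult[OF assms(3) y(1)] by simp
  qed
  have "bij_betw (\<lambda>x. y \<otimes> x) (carrier G) (carrier G)"
    using y by (intro bij_betwI[of _ _ _ "\<lambda>x. inv y \<otimes> x"]) (auto simp: m_assoc[symmetric])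
  then have "sum ?f (carrier G) = (\<Sum>x\<in>carrier G. ?f (y \<otimes> x))"
    by (intro sum.reindex_bij_betw[symmetric])
  also have "\<dots> = (\<Sum>x\<in>carrier G. ?f y * ?f x)"
    using assms y by (intro sum.cong) (auto simp: charactersD)
  also have "\<dots> = ?f y * sum ?f (carrier G)" by (simp add: sum_distrib_left)
  finally have "(1 - ?f y) * sum ?f (carrier G) = 0" by (simp add: algebra_simps)
  with \<open>?f y \<noteq> 1\<close> False show ?thesis by simp
qed

text \<open>The translation argument of \<open>characters_orthogonal\<close> in the dual group, with
  a separating character as the translation. The value at the unit is still the number of
  characters; that this is the group order is \<open>card_characters\<close>.\<close>

lemma sum_characters_at:
  assumes fin: "finite (carrier G)" and "x \<in> carrier G"
  shows "(\<Sum>\<xi>\<in>characters G. \<xi> x) = (if x = \<one> then of_nat (card (characters G)) else 0)"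
proof (cases "x = \<one>")
  case True
  then show ?thesis by simp
next
  case False
  obtain \<psi> where \<psi>: "\<psi> \<in> characters G" "\<psi> x \<noteq> 1"
    using characters_separate[OF fin assms(2) False] by blast
  have "bij_betw (\<lambda>\<xi>. \<lambda>y\<in>carrier G. \<psi> y * \<xi> y) (characters G) (characters G)"
  proof (rule bij_betwI[of _ _ _ "\<lambda>\<xi>. \<lambda>y\<in>carrier G. cnj (\<psi> y) * \<xi> y"])
    show "(\<lambda>\<xi>. \<lambda>y\<in>carrier G. \<psi> y * \<xi> y) \<in> characters G \<rightarrow> characters G"
      using characters_mult[OF \<psi>(1)] by blast
    show "(\<lambda>\<xi>. \<lambda>y\<in>carrier G. cnj (\<psi> y) * \<xi> y) \<in> characters G \<rightarrow> characters G"
      using characters_mult[OF characters_cnj[OF \<psi>(1)]] by (simp cong: restrict_cong)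
  qed (auto simp: fun_eq_iff mult.assoc[symmetric] characters_cnj_mult[OF \<psi>(1)] charactersD(3))
  then have "(\<Sum>\<xi>\<in>characters G. \<xi> x) = (\<Sum>\<xi>\<in>characters G. \<psi> x * \<xi> x)"
    using assms sum.reindex_bij_betw[of "\<lambda>\<xi>. \<lambda>y\<in>carrier G. \<psi> y * \<xi> y" _ _ "\<lambda>\<xi>. \<xi> x"] by simp
  then have "(1 - \<psi> x) * (\<Sum>\<xi>\<in>characters G. \<xi> x) = 0"
    by (simp add: left_diff_distrib flip: sum_distrib_left)
  then show ?thesis using \<psi> False by simp
qed

text \<open>Double counting of the sum of all values \<xi>(x): summed over x first, only the trivial
  character survives, and summed over \<xi> first, only the unit.\<close>

lemma card_characters:
  assumes fin: "finite (carrier G)"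
  shows "card (characters G) = card (carrier G)"
proof -
  have "(\<Sum>\<xi>\<in>characters G. \<Sum>x\<in>carrier G. \<xi> x) = of_nat (card (carrier G))"
  proof -
    have "(\<Sum>x\<in>carrier G. \<xi> x) = (if \<xi> = trivial_character G then of_nat (card (carrier G)) else 0)"
      if "\<xi> \<in> characters G" for \<xi>
      using characters_orthogonal[OF fin that trivial_character]
      by (simp add: trivial_character_def)
    then show ?thesis by (simp add: finite_characters[OF fin])
  qed
  moreover have "(\<Sum>x\<in>carrier G. \<Sum>\<xi>\<in>characters G. \<xi> x) = of_nat (card (characters G))"
    by (simp add: sum_characters_at fin)
  ultimately have "complex_of_nat (card (characters G)) = of_nat (card (carrier G))"
    using sum.swap[of "\<lambda>\<xi> x. \<xi> x" "carrier G" "characters G"] by simp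
  then show ?thesis by simp
qed

lemma sum_characters:
  assumes fin: "finite (carrier G)" and "x \<in> carrier G" "y \<in> carrier G"
  shows "(\<Sum>\<xi>\<in>characters G. \<xi> x * cnj (\<xi> y)) = (if x = y then of_nat (card (carrier G)) else 0)"
proof -
  have "(\<Sum>\<xi>\<in>characters G. \<xi> x * cnj (\<xi> y)) = (\<Sum>\<xi>\<in>characters G. \<xi> (x \<otimes> inv y))"
    using assms by (intro sum.cong) (auto simp: charactersD character_inv)
  also have "\<dots> = (if x \<otimes> inv y = \<one> then of_nat (card (carrier G)) else 0)"
    using sum_characters_at[OF fin, of "x \<otimes> inv y"] assms by (simp add: card_characters)
  also have "x \<otimes> inv y = \<one> \<longleftrightarrow> x = y"
    using assms inv_equality by fastforce
  finally show ?thesis .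
qed

end

section \<open>The phase space of a finite abelian group\<close>

definition phase_space :: "('a, 'b) monoid_scheme \<Rightarrow> ('a \<times> ('a \<Rightarrow> complex)) set" where
  "phase_space G = carrier G \<times> characters G"

text \<open>The factor that an edge between vertices with labels \<open>u = (f, C)\<close> and \<open>v = (g, D)\<close>
  contributes to the character sum, namely \<open>(C - D) (f - g)\<close> in additive notation.\<close>

definition kern :: "'a \<times> ('a \<Rightarrow> complex) \<Rightarrow> 'a \<times> ('a \<Rightarrow> complex) \<Rightarrow> complex" where
  "kern u v = snd u (fst u) * snd v (fst v) * cnj (snd u (fst v)) * cnj (snd v (fst u))"

text \<open>With the hyperbolic quadratic form Q(f, C) = C(f), \<open>kern u v\<close> is Q(u - v).
  So these are the sets with Q-null differences, and those of |G| elements are the cosets of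
  Lagrangian subgroups.\<close>

definition isotropic :: "('a \<times> ('a \<Rightarrow> complex)) set \<Rightarrow> bool" where
  "isotropic U \<longleftrightarrow> (\<forall>u\<in>U. \<forall>v\<in>U. kern u v = 1)"

lemma kern_commute: "kern u v = kern v u"
  by (simp add: kern_def ac_simps)

lemma phase_spaceD:
  assumes "u \<in> phase_space G"
  shows "fst u \<in> carrier G" "snd u \<in> characters G"
  using assms by (auto simp: phase_space_def)

lemma norm_kern: "u \<in> phase_space G \<Longrightarrow> v \<in> phase_space G \<Longrightarrow> norm (kern u v) = 1"
  by (cases u; cases v) (auto simp: kern_def norm_mult charactersD phase_space_def)

lemma kern_refl: "u \<in> phase_space G \<Longrightarrow> kern u u = 1"
proof -
  assume u: "u \<in> phase_space G"
  have "kern u u = (snd u (fst u) * cnj (snd u (fst u))) * (snd u (fst u) * cnj (snd u (fst u)))"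
    by (simp add: kern_def)
  then show ?thesis using characters_cnj_mult[of "snd u" G "fst u"] phase_spaceD[OF u] by simp
qed

text \<open>Multiplicativity in the second argument is contained in the values being characters.
  These functions are the characters of the exterior square in disguise, see
  \<open>card_exterior_square\<close>.\<close>

definition alt_bichars :: "('a, 'b) monoid_scheme \<Rightarrow> ('a \<Rightarrow> 'a \<Rightarrow> complex) set" where
  "alt_bichars G = {b \<in> carrier G \<rightarrow>\<^sub>E characters G.
     (\<forall>x\<in>carrier G. \<forall>y\<in>carrier G. \<forall>z\<in>carrier G. b (x \<otimes>\<^bsub>G\<^esub> y) z = b x z * b y z) \<and>
     (\<forall>x\<in>carrier G. b x x = 1)}"

context comm_group
begin

section \<open>Plancherel for the kernel and maximal null sets\<close>

lemma finite_phase_space: "finite (carrier G) \<Longrightarrow> finite (phase_space G)"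
  by (simp add: phase_space_def finite_characters)

text \<open>Plancherel: at v = (g, D) the row of u is a constant times a character of the phase
  space times the factor D(g), which is common to all rows and of modulus 1. It cancels when a row
  meets a conjugate row, so distinct rows are orthogonal, and each has squared norm |G|^2.\<close>

lemma sum_norm_sum_kern:
  assumes fin: "finite (carrier G)" and U: "U \<subseteq> phase_space G"
  shows "(\<Sum>v\<in>phase_space G. (norm (\<Sum>u\<in>U. kern u v))\<^sup>2) = (card (carrier G))\<^sup>2 * card U"
proof -
  let ?N = "of_nat (card (carrier G)) :: complex"
  have finU: "finite U" using U finite_phase_space[OF fin] finite_subset by blast
  have inner: "(\<Sum>v\<in>phase_space G. kern u v * cnj (kern u' v)) = (if u = u' then ?N\<^sup>2 else 0)"
    if "u \<in> U" "u' \<in> U" for u u'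
  proof -
    obtain f C f' C' where uu: "u = (f, C)" "u' = (f', C')" by force
    have in_G: "f \<in> carrier G" "f' \<in> carrier G" "C \<in> characters G" "C' \<in> characters G"
      using U that uu by (auto simp: phase_space_def)
    have "(\<Sum>v\<in>phase_space G. kern u v * cnj (kern u' v)) =
      (\<Sum>g\<in>carrier G. \<Sum>D\<in>characters G. kern u (g, D) * cnj (kern u' (g, D)))"
      by (simp add: phase_space_def sum.cartesian_product)
    also have "\<dots> = (\<Sum>g\<in>carrier G. \<Sum>D\<in>characters G.
        (C f * cnj (C' f')) * ((C' g * cnj (C g)) * (D f' * cnj (D f))))"
    proof (intro sum.cong refl)
      fix g D assume g: "g \<in> carrier G" and D: "D \<in> characters G"
      have "kern u (g, D) * cnj (kern u' (g, D)) =
        (D g * cnj (D g)) * ((C f * cnj (C' f')) * ((C' g * cnj (C g)) * (D f' * cnj (D f))))"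
        by (simp add: kern_def uu ac_simps)
      then show "kern u (g, D) * cnj (kern u' (g, D)) =
        (C f * cnj (C' f')) * ((C' g * cnj (C g)) * (D f' * cnj (D f)))"
        using characters_cnj_mult[OF D g] by simp
    qed
    also have "\<dots> = (C f * cnj (C' f')) * ((\<Sum>g\<in>carrier G. C' g * cnj (C g)) *
        (\<Sum>D\<in>characters G. D f' * cnj (D f)))"
      by (simp only: sum_distrib_left sum_distrib_right) (rule sum.swap)
    also have "\<dots> = (if u = u' then ?N\<^sup>2 else 0)"
      using in_G by (simp add: characters_orthogonal fin sum_characters uu characters_cnj_mult power2_eq_square)
    finally show ?thesis .
  qed
  have "complex_of_real (\<Sum>v\<in>phase_space G. (norm (\<Sum>u\<in>U. kern u v))\<^sup>2) =
    (\<Sum>v\<in>phase_space G. (\<Sum>u\<in>U. kern u v) * cnj (\<Sum>u\<in>U. kern u v))"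
    by (simp add: complex_norm_square del: of_real_power)
  also have "\<dots> = (\<Sum>v\<in>phase_space G. \<Sum>u\<in>U. \<Sum>u'\<in>U. kern u v * cnj (kern u' v))"
    by (simp add: sum_product)
  also have "\<dots> = (\<Sum>u\<in>U. \<Sum>v\<in>phase_space G. \<Sum>u'\<in>U. kern u v * cnj (kern u' v))"
    by (rule sum.swap)
  also have "\<dots> = (\<Sum>u\<in>U. \<Sum>u'\<in>U. \<Sum>v\<in>phase_space G. kern u v * cnj (kern u' v))"
    by (intro sum.cong refl sum.swap)
  also have "\<dots> = ?N\<^sup>2 * of_nat (card U)"
    by (simp add: inner finU)
  also have "\<dots> = complex_of_real ((card (carrier G))\<^sup>2 * card U)" by simp
  finally show ?thesis unfolding of_real_eq_iff by simp
qed

text \<open>For v in \<open>U\<close> the inner sum of \<open>sum_norm_sum_kern\<close> is |U|, so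
  these v alone contribute |U|^3 to a total of |G|^2 |U|. In the case of equality nothing is left
  for the other v.\<close>

lemma isotropic_bound:
  assumes fin: "finite (carrier G)" and U: "U \<subseteq> phase_space G" "isotropic U"
  shows "card U \<le> card (carrier G)"
    and "card U = card (carrier G) \<Longrightarrow> v \<in> phase_space G - U \<Longrightarrow> (\<Sum>u\<in>U. kern u v) = 0"
proof -
  let ?V = "phase_space G" and ?S = "\<lambda>v. (norm (\<Sum>u\<in>U. kern u v))\<^sup>2"
  have finV: "finite ?V" by (rule finite_phase_space[OF fin])
  have finU: "finite U" using U finV finite_subset by blast
  have inU: "sum ?S U = real (card U) ^ 3"
  proof -
    have "?S v = real (card U) ^ 2" if "v \<in> U" for v
      using U(2) that by (simp add: isotropic_def)
    then show ?thesis by (simp add: power2_eq_square power3_eq_cube)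
  qed
  have tot: "sum ?S U + sum ?S (?V - U) = real (card (carrier G)) ^ 2 * card U"
    using sum_norm_sum_kern[OF fin U(1)] sum.subset_diff[OF U(1) finV, of ?S] by simp
  have nn: "sum ?S (?V - U) \<ge> 0" by (intro sum_nonneg) auto
  show "card U \<le> card (carrier G)"
  proof (cases "U = {}")
    case False
    then have "real (card U) > 0" using finU by (simp add: card_gt_0_iff)
    moreover have "real (card U) ^ 2 * card U \<le> real (card (carrier G)) ^ 2 * card U"
      using tot nn inU by (simp add: power2_eq_square power3_eq_cube)
    ultimately have "real (card U) ^ 2 \<le> real (card (carrier G)) ^ 2" by simp
    then show ?thesis by (simp add: power_mono_iff flip: of_nat_power)
  qed simp
  show "(\<Sum>u\<in>U. kern u v) = 0" if "card U = card (carrier G)" "v \<in> ?V - U"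
  proof -
    have "sum ?S (?V - U) = 0"
      using tot inU that by (simp add: power2_eq_square power3_eq_cube)
    then have "?S v = 0" using that finV by (subst (asm) sum_nonneg_eq_0_iff) auto
    then show ?thesis by simp
  qed
qed

text \<open>Expanding the quadratic form additively gives Q(x - (u - v + w)) = Q(x - u) - Q(x - v) +
  Q(x - w) + Q(u - v) - Q(u - w) + Q(v - w), and all six terms vanish.\<close>

lemma kern_affine:
  assumes "u \<in> phase_space G" "v \<in> phase_space G" "w \<in> phase_space G" "x \<in> phase_space G"
    and k: "kern u v = 1" "kern u w = 1" "kern v w = 1" "kern x u = 1" "kern x v = 1" "kern x w = 1"
  defines "y \<equiv> (fst u \<otimes> inv (fst v) \<otimes> fst w, \<lambda>g\<in>carrier G. snd u g * cnj (snd v g) * snd w g)"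
  shows "y \<in> phase_space G" "kern x y = 1"
proof -
  obtain f C f' C' f'' C'' g D where eq: "u = (f, C)" "v = (f', C')" "w = (f'', C'')" "x = (g, D)"
    by (metis surj_pair)
  have c: "f \<in> carrier G" "f' \<in> carrier G" "f'' \<in> carrier G" "g \<in> carrier G"
    "C \<in> characters G" "C' \<in> characters G" "C'' \<in> characters G" "D \<in> characters G"
    using assms eq by (auto simp: phase_space_def)
  have "snd y \<in> characters G"
    using c characters_mult[OF characters_mult[OF c(5) characters_cnj[OF c(6)]] c(7)]
    by (simp add: y_def eq cong: restrict_cong)
  then show "y \<in> phase_space G" using c by (auto simp: phase_space_def y_def eq)
  have inv: "cnj (E h) = inverse (E h)" "E h \<noteq> 0" if "E \<in> characters G" "h \<in> carrier G" for E h
    using characters_cnj_mult[OF that] by (metis inverse_unique, force)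
  \<comment> \<open>Solving each of the six null relations for a mixed value leaves an identity that
    can be checked by field arithmetic.\<close>
  have rel: "E' h = E h * E' h' / E h'"
    if "E \<in> characters G" "E' \<in> characters G" "h \<in> carrier G" "h' \<in> carrier G"
      "kern (h, E) (h', E') = 1" for E E' h h'
    using that(5) by (simp add: kern_def inv that field_simps)
  note r = rel[OF c(5,6,1,2)] rel[OF c(5,7,1,3)] rel[OF c(6,7,2,3)]
  note s = rel[of C D f g] rel[of C' D f' g] rel[of C'' D f'' g]
  have "kern x y = D g * (C f * inverse (C f') * C f'' * inverse (C' f * inverse (C' f') * C' f'')
      * (C'' f * inverse (C'' f') * C'' f''))
      * inverse (C g * inverse (C' g) * C'' g) * inverse (D f * inverse (D f') * D f'')"
    using c by (simp add: kern_def y_def eq charactersD character_inv inv field_simps)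
  also have "\<dots> = 1"
    using r s k c by (simp add: eq kern_commute[of "(g, D)"] inv field_simps)
  finally show "kern x y = 1" .
qed

text \<open>By \<open>kern_affine\<close> a combination outside \<open>U\<close> would be null
  against all of \<open>U\<close>, so its kernel sum over \<open>U\<close> would be |U|; by
  maximality it is 0.\<close>

lemma isotropic_affine_closed:
  assumes fin: "finite (carrier G)" and U: "U \<subseteq> phase_space G" "isotropic U"
    and card: "card U = card (carrier G)" and uvw: "u \<in> U" "v \<in> U" "w \<in> U"
  shows "(fst u \<otimes> inv (fst v) \<otimes> fst w, \<lambda>g\<in>carrier G. snd u g * cnj (snd v g) * snd w g) \<in> U"
    (is "?y \<in> U")
proof (rule ccontr)
  assume n: "?y \<notin> U"
  have y: "?y \<in> phase_space G"
    by (rule kern_affine(1)[of u v w u]) (use U uvw in \<open>auto simp: isotropic_def\<close>)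
  have "kern x ?y = 1" if "x \<in> U" for x
    by (rule kern_affine(2)) (use U uvw that in \<open>auto simp: isotropic_def\<close>)
  then have "(\<Sum>x\<in>U. kern x ?y) = of_nat (card U)" by simp
  moreover have "(\<Sum>x\<in>U. kern x ?y) = 0" using isotropic_bound(2)[OF fin U card] y n by blast
  ultimately have "card (carrier G) = 0" using card by simp
  then show False using fin by auto
qed

text \<open>Affine closure passes to the projection to G, and an affinely closed set that contains
  the unit is a subgroup. Thus, for a rooted map that fills out a maximal null set, generating
  already means onto.\<close>

lemma isotropic_generating:
  assumes fin: "finite (carrier G)" and U: "U \<subseteq> phase_space G" "isotropic U"
    and card: "card U = card (carrier G)" and one: "\<one> \<in> fst ` U"
    and gen: "generate G (fst ` U) = carrier G"
  shows "fst ` U = carrier G"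
proof -
  have closed: "x \<otimes> inv y \<otimes> z \<in> fst ` U" if xyz: "x \<in> fst ` U" "y \<in> fst ` U" "z \<in> fst ` U" for x y z
  proof -
    from xyz obtain u v w where "u \<in> U" "v \<in> U" "w \<in> U" "x = fst u" "y = fst v" "z = fst w" by blast
    then show ?thesis using isotropic_affine_closed[OF fin U card, of u v w] by force
  qed
  have sub: "fst ` U \<subseteq> carrier G" using U by (auto simp: phase_space_def)
  have "subgroup (fst ` U) G"
  proof (rule subgroupI)
    show "inv x \<in> fst ` U" if "x \<in> fst ` U" for x
    proof -
      have "\<one> \<otimes> inv x \<otimes> \<one> = inv x" using that sub by auto
      then show ?thesis using closed[OF one that one] by simp
    qed
    show "x \<otimes> y \<in> fst ` U" if "x \<in> fst ` U" "y \<in> fst ` U" for x y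
    proof -
      have "x \<otimes> inv \<one> \<otimes> y = x \<otimes> y" using that sub by auto
      then show ?thesis using closed[OF that(1) one that(2)] by simp
    qed
  qed (use sub one in auto)
  then have "generate G (fst ` U) \<subseteq> fst ` U" by (intro generate_subgroup_incl) auto
  then show ?thesis using gen sub by auto
qed

section \<open>Alternating bicharacters and maps into null sets\<close>

lemma alt_bicharsD:
  assumes "b \<in> alt_bichars G"
  shows "x \<in> carrier G \<Longrightarrow> b x \<in> characters G"
    and "x \<in> carrier G \<Longrightarrow> y \<in> carrier G \<Longrightarrow> z \<in> carrier G \<Longrightarrow> b (x \<otimes> y) z = b x z * b y z"
    and "x \<in> carrier G \<Longrightarrow> b x x = 1"
  using assms by (auto simp: alt_bichars_def)

lemma alt_bichars_antisym:
  assumes b: "b \<in> alt_bichars G" and xy: "x \<in> carrier G" "y \<in> carrier G"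
  shows "b x y * b y x = 1"
proof -
  have "1 = b (x \<otimes> y) (x \<otimes> y)" using alt_bicharsD(3)[OF b] xy by simp
  also have "\<dots> = b x y * b y x"
  proof -
    have "b (x \<otimes> y) (x \<otimes> y) = (b x x * b x y) * (b y x * b y y)"
      using xy alt_bicharsD(2)[OF b, of x y "x \<otimes> y"]
      by (simp add: charactersD(2)[OF alt_bicharsD(1)[OF b]])
    then show ?thesis using xy alt_bicharsD(3)[OF b] by simp
  qed
  finally show ?thesis by simp
qed

lemma alt_bichars_one: 
  assumes b: "b \<in> alt_bichars G"
  shows "b \<one> = trivial_character G"
proof (rule characters_eqI)
  fix x assume x: "x \<in> carrier G"
  have "b \<one> x * b \<one> x = b \<one> x" using alt_bicharsD(2)[OF b, of \<one> \<one> x] x by simp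
  moreover have "b \<one> x \<noteq> 0" using charactersD(1)[OF alt_bicharsD(1)[OF b], of \<one> x] x by auto
  ultimately show "b \<one> x = trivial_character G x" using x by (simp add: trivial_character_def)
qed (use alt_bicharsD[OF b] in auto)

text \<open>The vertex \<open>m\<close> is the deleted one. Its neutral label makes all characters
  and relations blind to it, and keeping it turns the weight into a product over all pairs of
  vertices.\<close>

definition rooted_maps :: "nat \<Rightarrow> (nat \<Rightarrow> 'a \<times> ('a \<Rightarrow> complex)) set" where
  "rooted_maps m = {w \<in> {..<Suc m} \<rightarrow>\<^sub>E phase_space G. w m = (\<one>, trivial_character G)}"

definition main_maps :: "nat \<Rightarrow> (nat \<Rightarrow> 'a \<times> ('a \<Rightarrow> complex)) set" where
  "main_maps m = {w \<in> rooted_maps m. fst ` w ` {..<Suc m} = carrier G \<and> isotropic (w ` {..<Suc m})}"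

definition rooted_surjections :: "nat \<Rightarrow> (nat \<Rightarrow> 'a) set" where
  "rooted_surjections m = {f \<in> {..<Suc m} \<rightarrow>\<^sub>E carrier G. f m = \<one> \<and> f ` {..<Suc m} = carrier G}"

text \<open>The null relation with the root gives C_i(f_i) = 1, and then the one between i and j
  gives C_i(f_j) = cnj(C_j(f_i)). As f is onto, C_i depends on f_i alone, and multiplicativity in
  the first argument follows from that in the second.\<close>

lemma card_main_maps: "card (main_maps m) = card (rooted_surjections m) * card (alt_bichars G)"
proof -
  let ?I = "{..<Suc m}"
  define \<Phi> where "\<Phi> = (\<lambda>(f, b). \<lambda>i\<in>?I. (f i :: 'a, b (f i) :: 'a \<Rightarrow> complex))"
  have "bij_betw \<Phi> (rooted_surjections m \<times> alt_bichars G) (main_maps m)"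
    unfolding bij_betw_def
  proof
    show "inj_on \<Phi> (rooted_surjections m \<times> alt_bichars G)"
    proof (rule inj_onI, clarify)
      fix f b f' b'
      assume f: "f \<in> rooted_surjections m" "f' \<in> rooted_surjections m"
        and b: "b \<in> alt_bichars G" "b' \<in> alt_bichars G" and e: "\<Phi> (f, b) = \<Phi> (f', b')"
      have *: "f i = f' i \<and> b (f i) = b' (f' i)" if "i \<in> ?I" for i
        using fun_cong[OF e, of i] that by (simp add: \<Phi>_def) metis
      have ff: "f = f'" using f * by (intro PiE_ext[of f ?I "\<lambda>_. carrier G" f']) (auto simp: rooted_surjections_def)
      have "b x = b' x" if "x \<in> carrier G" for x
      proof -
        have "x \<in> f ` ?I" using that f(1) by (simp add: rooted_surjections_def)
        then obtain i where "i \<in> ?I" "x = f i" by (rule imageE)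
        then show ?thesis using *[of i] by metis
      qed
      then have "b = b'" using b by (intro PiE_ext[of b "carrier G" "\<lambda>_. characters G" b']) (auto simp: alt_bichars_def)
      with ff show "f = f' \<and> b = b'" by simp
    qed
    show "\<Phi> ` (rooted_surjections m \<times> alt_bichars G) = main_maps m"
    proof
      show "\<Phi> ` (rooted_surjections m \<times> alt_bichars G) \<subseteq> main_maps m"
      proof clarify
        fix f b assume f: "f \<in> rooted_surjections m" and b: "b \<in> alt_bichars G"
        have fG: "f i \<in> carrier G" if "i \<in> ?I" for i using f that by (auto simp: rooted_surjections_def)
        have "kern (f i, b (f i)) (f j, b (f j)) = 1" if "i \<in> ?I" "j \<in> ?I" for i j
          using alt_bichars_antisym[OF b fG[OF that(1)] fG[OF that(2)]] alt_bicharsD(3)[OF b] fG that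
          by (simp add: kern_def) (metis complex_cnj_mult complex_cnj_one)
        moreover have "fst ` \<Phi> (f, b) ` ?I = f ` ?I" by (force simp: \<Phi>_def image_image)
        moreover have "\<Phi> (f, b) \<in> rooted_maps m"
          using f fG alt_bicharsD(1)[OF b] alt_bichars_one[OF b]
          by (auto simp: rooted_maps_def \<Phi>_def phase_space_def rooted_surjections_def)
        ultimately show "\<Phi> (f, b) \<in> main_maps m"
          using f by (auto simp: main_maps_def isotropic_def \<Phi>_def rooted_surjections_def)
      qed
      show "main_maps m \<subseteq> \<Phi> ` (rooted_surjections m \<times> alt_bichars G)"
      proof
        fix w assume w: "w \<in> main_maps m"
        define f where "f i = fst (w i)" for i
        define C where "C i = snd (w i)" for i
        have wV: "w i \<in> phase_space G" if "i \<in> ?I" for i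
          using w that by (auto simp: main_maps_def rooted_maps_def)
        have fG: "f i \<in> carrier G" and CG: "C i \<in> characters G" if "i \<in> ?I" for i
          using wV[OF that] by (auto simp: f_def C_def phase_space_def)
        have surj: "\<exists>i\<in>?I. f i = x" if "x \<in> carrier G" for x
          using w that by (force simp: main_maps_def f_def)
        have root: "f m = \<one>" "C m = trivial_character G"
          using w by (auto simp: main_maps_def rooted_maps_def f_def C_def)
        have k: "C i (f i) * C j (f j) * cnj (C i (f j)) * cnj (C j (f i)) = 1" if "i \<in> ?I" "j \<in> ?I" for i j
          using w that by (auto simp: main_maps_def isotropic_def kern_def f_def C_def)
        have diag: "C i (f i) = 1" if "i \<in> ?I" for i
          using k[OF that, of m] root fG[OF that] CG[OF that] by (simp add: trivial_character_def)
        have anti: "C i (f j) = cnj (C j (f i))" if "i \<in> ?I" "j \<in> ?I" for i j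
        proof -
          have "cnj (C i (f j)) * cnj (C j (f i)) = 1" using k[OF that] diag that by simp
          then have "C i (f j) * (cnj (C i (f j)) * cnj (C j (f i))) = C i (f j)" by simp
          then show ?thesis
            using characters_cnj_mult[OF CG[OF that(1)] fG[OF that(2)]] by (simp flip: mult.assoc)
        qed
        define \<sigma> where "\<sigma> x = (SOME i. i \<in> ?I \<and> f i = x)" for x
        have \<sigma>: "\<sigma> x \<in> ?I" "f (\<sigma> x) = x" if "x \<in> carrier G" for x
          using surj[OF that] someI_ex[of "\<lambda>i. i \<in> ?I \<and> f i = x"] unfolding \<sigma>_def by blast+
        \<comment> \<open>The right-hand side depends on \<open>i\<close> only through
          \<open>f i\<close>, so the choice made in \<sigma> is immaterial and \<open>C\<close>
          factors through \<open>f\<close>.\<close>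
        have Ceq: "C i x = cnj (C (\<sigma> x) (f i))" if "i \<in> ?I" "x \<in> carrier G" for i x
          using anti[OF that(1) \<sigma>(1)[OF that(2)]] \<sigma>(2)[OF that(2)] by simp
        define b where "b = (\<lambda>x\<in>carrier G. C (\<sigma> x))"
        have bC: "b (f i) = C i" if "i \<in> ?I" for i
        proof (rule characters_eqI)
          fix x assume x: "x \<in> carrier G"
          show "b (f i) x = C i x"
            using Ceq[OF that x] Ceq[OF \<sigma>(1)[OF fG[OF that]] x] fG[OF that] \<sigma>(2)[OF fG[OF that]] by (simp add: b_def)
        qed (use CG \<sigma> fG that in \<open>auto simp: b_def\<close>)
        have "b \<in> alt_bichars G"
          unfolding alt_bichars_def
        proof (intro CollectI conjI ballI)
          show "b \<in> carrier G \<rightarrow>\<^sub>E characters G" using CG \<sigma> by (auto simp: b_def)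
          show "b (x \<otimes> y) z = b x z * b y z" if "x \<in> carrier G" "y \<in> carrier G" "z \<in> carrier G" for x y z
            using that Ceq[OF \<sigma>(1), of _ z] \<sigma>(2) charactersD(2)[OF CG[OF \<sigma>(1)[of z]]] by (simp add: b_def)
          show "b x x = 1" if "x \<in> carrier G" for x
            using diag[OF \<sigma>(1)[OF that]] \<sigma>(2)[OF that] that by (simp add: b_def)
        qed
        moreover have "restrict f ?I \<in> rooted_surjections m"
          using surj fG root by (auto simp: rooted_surjections_def)
        moreover have "\<Phi> (restrict f ?I, b) = w"
        proof
          fix i show "\<Phi> (restrict f ?I, b) i = w i"
          proof (cases "i \<in> ?I")
            case True
            then show ?thesis using bC[OF True] by (simp add: \<Phi>_def f_def C_def)
          next
            case False
            then show ?thesis using w by (auto simp: \<Phi>_def main_maps_def rooted_maps_def)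
          qed
        qed
        ultimately show "w \<in> \<Phi> ` (rooted_surjections m \<times> alt_bichars G)" by force
      qed
    qed
  qed
  then show ?thesis by (simp add: bij_betw_same_card[symmetric] card_cartesian_product)
qed

end

section \<open>Maps that stray from the maximal null sets\<close>

lemma sum_Pow_power_card:
  fixes y :: "'a :: comm_semiring_1"
  assumes "finite A"
  shows "(\<Sum>S\<in>Pow A. y ^ card S) = (1 + y) ^ card A"
  using prod_add[OF assms, of "\<lambda>_. y" "\<lambda>_. 1"] by (simp add: add.commute)

lemma sum_UN_le:
  fixes f :: "'a \<Rightarrow> real"
  assumes "finite I" "\<And>i. i \<in> I \<Longrightarrow> finite (A i)" "\<And>i x. i \<in> I \<Longrightarrow> x \<in> A i \<Longrightarrow> 0 \<le> f x"
  shows "sum f (\<Union>i\<in>I. A i) \<le> (\<Sum>i\<in>I. sum f (A i))"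
  using assms
proof (induction I rule: finite_induct)
  case (insert i I)
  have "0 \<le> sum f (A i \<inter> (\<Union>i\<in>I. A i))"
    by (rule sum_nonneg) (use insert.prems in auto)
  then have "sum f (\<Union>i\<in>insert i I. A i) \<le> sum f (A i) + sum f (\<Union>i\<in>I. A i)"
    using insert by (simp add: sum_Un)
  then show ?case using insert by fastforce
qed simp

text \<open>An exponential tilt: with weight M / l per element instead of M, the sum over all
  subsets is (1 + M / l)^n, at most sqrt(\<theta>)^n for large l. Undoing the tilt costs l^(card S),
  which is again at most sqrt(\<theta>)^n once \<epsilon> is small.\<close>

lemma small_subsets_entropy:
  fixes M \<theta> :: real
  assumes "M \<ge> 0" "\<theta> > 1"
  obtains \<epsilon> :: real where "\<epsilon> > 0"
    "\<And>n. (\<Sum>S | S \<subseteq> {..<n::nat} \<and> real (card S) \<le> \<epsilon> * n. M ^ card S) \<le> \<theta> ^ n"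
proof -
  define r where "r = sqrt \<theta>"
  have r: "r > 1" "r * r = \<theta>" using assms by (auto simp: r_def)
  define l where "l = max 1 (M / (r - 1))"
  have l: "l \<ge> 1" "1 + M / l \<le> r"
  proof -
    show "l \<ge> 1" by (simp add: l_def)
    then have "M / l \<le> r - 1" using r assms by (auto simp: l_def field_simps max_def split: if_splits)
    then show "1 + M / l \<le> r" by simp
  qed
  \<comment> \<open>Slightly less than \<open>ln r / ln l\<close>; the added 1 covers the case
    \<open>l = 1\<close>.\<close>
  define \<epsilon> where "\<epsilon> = ln r / (ln l + 1)"
  have \<epsilon>: "\<epsilon> > 0" "\<epsilon> * ln l \<le> ln r"
  proof -
    have pos: "ln l \<ge> 0" "ln r > 0" using l r by simp_all
    then show "\<epsilon> > 0" by (simp add: \<epsilon>_def)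
    show "\<epsilon> * ln l \<le> ln r" using pos by (simp add: \<epsilon>_def field_simps)
  qed
  show ?thesis
  proof (rule that[OF \<epsilon>(1)])
    fix n :: nat
    have "(\<Sum>S | S \<subseteq> {..<n} \<and> real (card S) \<le> \<epsilon> * n. M ^ card S) \<le>
        (\<Sum>S | S \<subseteq> {..<n} \<and> real (card S) \<le> \<epsilon> * n. (M / l) ^ card S * r ^ n)"
    proof (intro sum_mono, clarify)
      fix S assume S: "S \<subseteq> {..<n}" "real (card S) \<le> \<epsilon> * n"
      have "l ^ card S = exp (card S * ln l)" using l by (simp add: exp_of_nat_mult)
      also have "card S * ln l \<le> \<epsilon> * n * ln l" using S l by (intro mult_right_mono) auto
      also have "\<epsilon> * n * ln l = n * (\<epsilon> * ln l)" by simp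
      also have "\<dots> \<le> n * ln r" using \<epsilon> by (intro mult_left_mono) auto
      also have "exp (n * ln r) = r ^ n" using r by (simp add: exp_of_nat_mult)
      finally have "l ^ card S \<le> r ^ n" by simp
      moreover have "M ^ card S = (M / l) ^ card S * l ^ card S" using l by (simp add: power_divide)
      ultimately show "M ^ card S \<le> (M / l) ^ card S * r ^ n"
        using assms l by (simp add: mult_left_mono)
    qed
    also have "\<dots> \<le> (\<Sum>S\<in>Pow {..<n}. (M / l) ^ card S * r ^ n)"
      using assms l r by (intro sum_mono2) auto
    also have "\<dots> = (1 + M / l) ^ n * r ^ n"
      by (simp add: sum_Pow_power_card flip: sum_distrib_right)
    also have "\<dots> \<le> r ^ n * r ^ n"
      using l r assms by (intro mult_right_mono power_mono) auto
    also have "\<dots> = \<theta> ^ n" using r by (simp flip: power_mult_distrib)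
    finally show "(\<Sum>S | S \<subseteq> {..<n} \<and> real (card S) \<le> \<epsilon> * n. M ^ card S) \<le> \<theta> ^ n" .
  qed
qed

text \<open>The left-hand side is exp(- x / 2) up to a second order correction, which the factor
  \<gamma> < 1 in the exponent absorbs as long as x is at most 1 - \<gamma>.\<close>

lemma half_one_plus_exp_le:
  fixes x \<gamma> :: real
  assumes "0 \<le> x" "x \<le> 1 - \<gamma>"
  shows "(1 + exp (- x)) / 2 \<le> exp (- \<gamma> * x / 2)"
proof -
  have "exp (- x) \<le> 1 / (1 + x)"
    using exp_ge_add_one_self[of x] assms by (simp add: exp_minus field_simps)
  also have "\<dots> \<le> 1 - x + x * x" using assms by (simp add: field_simps)
  finally have "(1 + exp (- x)) / 2 \<le> (1 + (1 - x + x * x)) / 2" by simp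
  also have "\<dots> = 1 + (- x * (1 - x) / 2)" by (simp add: field_simps)
  also have "\<dots> \<le> exp (- x * (1 - x) / 2)" by (rule exp_ge_add_one_self)
  also have "\<dots> \<le> exp (- \<gamma> * x / 2)"
    using assms mult_left_mono[of \<gamma> "1 - x" x] by (simp add: algebra_simps)
  finally show ?thesis .
qed

lemma exp_minus_chord:
  fixes a x :: real
  assumes "0 \<le> a" "a \<le> x" "x > 0"
  shows "exp (- a) \<le> 1 - a / x * (1 - exp (- x))"
proof -
  have "convex_on UNIV (exp :: real \<Rightarrow> real)" by (rule exp_convex)
  from convex_onD[OF this, of "a / x" 0 "- x"] assms
  show ?thesis by (simp add: algebra_simps)
qed

text \<open>Every unordered pair is counted twice, hence the half; for \<open>kern_dist\<close> the
  diagonal contributes nothing.\<close>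

definition pair_energy :: "('v \<Rightarrow> 'v \<Rightarrow> real) \<Rightarrow> nat \<Rightarrow> (nat \<Rightarrow> 'v) \<Rightarrow> real" where
  "pair_energy D n w = (\<Sum>i<n. \<Sum>j<n. D (w i) (w j)) / 2"

text \<open>The properties of \<open>1 - Re K\<close> that enter the estimate, with N in the role of
  |G|. The last one is the balance relation: the mean distance from an outside element to a maximal
  null set is 1, the middle of the range from 0 to 2.\<close>

locale energy_kernel =
  fixes V :: "'v set" and D :: "'v \<Rightarrow> 'v \<Rightarrow> real" and N :: nat
  assumes finite_V: "finite V" and N_pos: "N > 0"
    and D_nonneg: "u \<in> V \<Longrightarrow> v \<in> V \<Longrightarrow> 0 \<le> D u v"
    and D_le: "u \<in> V \<Longrightarrow> v \<in> V \<Longrightarrow> D u v \<le> 2"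
    and D_sym: "D u v = D v u"
    and null_card: "U \<subseteq> V \<Longrightarrow> (\<forall>u\<in>U. \<forall>v\<in>U. D u v = 0) \<Longrightarrow> card U \<le> N"
    and null_balanced: "U \<subseteq> V \<Longrightarrow> (\<forall>u\<in>U. \<forall>v\<in>U. D u v = 0) \<Longrightarrow> card U = N \<Longrightarrow>
      v \<in> V - U \<Longrightarrow> (\<Sum>u\<in>U. D u v) = N"
begin

definition max_null :: "'v set set" where
  "max_null = {U. U \<subseteq> V \<and> (\<forall>u\<in>U. \<forall>v\<in>U. D u v = 0) \<and> card U = N}"

definition stray_maps :: "nat \<Rightarrow> (nat \<Rightarrow> 'v) set" where
  "stray_maps n = {w \<in> {..<n} \<rightarrow>\<^sub>E V. \<nexists>U. U \<in> max_null \<and> w ` {..<n} \<subseteq> U}"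

section \<open>Weights of maps near a given set of labels\<close>

lemma pair_energy_split:
  assumes "w \<in> {..<n} \<rightarrow>\<^sub>E V" "S \<subseteq> {..<n}"
  shows "(\<Sum>j\<in>{..<n} - S. \<Sum>i\<in>S. D (w j) (w i)) \<le> pair_energy D n w"
proof -
  let ?T = "{..<n} - S"
  have nn: "0 \<le> D (w i) (w j)" if "i < n" "j < n" for i j
    using D_nonneg assms that by (auto simp: PiE_iff)
  have split: "(\<Sum>i<n. f i) = sum f S + sum f ?T" for f :: "nat \<Rightarrow> real"
    using assms sum.subset_diff[of S "{..<n}" f] by simp
  have "(\<Sum>i<n. \<Sum>j<n. D (w i) (w j)) =
    (\<Sum>i\<in>S. \<Sum>j\<in>S. D (w i) (w j)) + (\<Sum>i\<in>S. \<Sum>j\<in>?T. D (w i) (w j)) +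
    ((\<Sum>i\<in>?T. \<Sum>j\<in>S. D (w i) (w j)) + (\<Sum>i\<in>?T. \<Sum>j\<in>?T. D (w i) (w j)))"
    unfolding split by (simp add: sum.distrib)
  moreover have "(\<Sum>i\<in>S. \<Sum>j\<in>?T. D (w i) (w j)) = (\<Sum>i\<in>?T. \<Sum>j\<in>S. D (w i) (w j))"
    by (subst sum.swap) (intro sum.cong refl D_sym)
  moreover have "(\<Sum>i\<in>S. \<Sum>j\<in>S. D (w i) (w j)) \<ge> 0" "(\<Sum>i\<in>?T. \<Sum>j\<in>?T. D (w i) (w j)) \<ge> 0"
    using nn assms by (auto intro!: sum_nonneg)
  ultimately show ?thesis by (simp add: pair_energy_def)
qed

lemma pair_energy_nonneg: "w \<in> {..<n} \<rightarrow>\<^sub>E V \<Longrightarrow> pair_energy D n w \<ge> 0"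
  using D_nonneg by (auto simp: pair_energy_def PiE_iff intro!: sum_nonneg)

text \<open>By balance the exponents have mean s card S over \<open>U\<close>, and they lie between
  0 and 2 s card S. By convexity the sum of exponentials is largest when half of them sit at each
  end of this interval, which is the bound.\<close>

lemma sum_exp_balanced:
  fixes s :: real
  assumes U: "U \<in> max_null" and S: "finite S" "a \<in> S \<rightarrow> V - U" and s: "s \<ge> 0"
  shows "(\<Sum>t\<in>U. exp (- s * (\<Sum>i\<in>S. D t (a i)))) \<le> N * ((1 + exp (- (2 * s * card S))) / 2)"
proof (cases "s * card S = 0")
  case True
  then have "s = 0 \<or> S = {}" using S by auto
  then show ?thesis using U True by (auto simp: max_null_def)
next
  case False
  define x where "x = 2 * s * card S"
  have "s \<noteq> 0" "card S \<noteq> 0" using False by auto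
  then have x: "x > 0" using s by (simp add: x_def)
  define A where "A t = s * (\<Sum>i\<in>S. D t (a i))" for t
  have UV: "U \<subseteq> V" using U by (auto simp: max_null_def)
  have A: "0 \<le> A t" "A t \<le> x" if "t \<in> U" for t
  proof -
    have "D t (a i) \<ge> 0" "D t (a i) \<le> 2" if "i \<in> S" for i
      using D_nonneg D_le UV \<open>t \<in> U\<close> S that by (auto simp: Pi_iff subset_iff)
    then have "(\<Sum>i\<in>S. D t (a i)) \<ge> 0" "(\<Sum>i\<in>S. D t (a i)) \<le> 2 * card S"
      using sum_mono[of S "\<lambda>i. D t (a i)" "\<lambda>_. 2"] by (auto intro!: sum_nonneg)
    then show "0 \<le> A t" "A t \<le> x" using s mult_left_mono[of "(\<Sum>i\<in>S. D t (a i))" "2 * card S" s]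
      by (auto simp: A_def x_def)
  qed
  have "(\<Sum>t\<in>U. A t) = s * (\<Sum>i\<in>S. \<Sum>t\<in>U. D t (a i))"
    unfolding A_def by (subst sum.swap) (simp add: sum_distrib_left)
  also have "(\<Sum>i\<in>S. \<Sum>t\<in>U. D t (a i)) = (\<Sum>i\<in>S. real N)"
    using U S null_balanced[of U] by (intro sum.cong) (auto simp: max_null_def)
  finally have sumA: "(\<Sum>t\<in>U. A t) = N * x / 2" by (simp add: x_def)
  have "(\<Sum>t\<in>U. exp (- A t)) \<le> (\<Sum>t\<in>U. 1 - A t / x * (1 - exp (- x)))"
    using A x by (intro sum_mono exp_minus_chord) auto
  also have "\<dots> = card U - (\<Sum>t\<in>U. A t) / x * (1 - exp (- x))"
    by (simp add: sum_subtractf sum_distrib_right sum_divide_distrib)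
  also have "\<dots> = N * ((1 + exp (- x)) / 2)"
    using U x by (simp add: sumA max_null_def field_simps)
  finally show ?thesis by (simp add: A_def x_def)
qed

lemma sum_PiE_split:
  fixes g :: "(nat \<Rightarrow> 'v) \<Rightarrow> real"
  assumes "S \<subseteq> {..<n}"
  shows "(\<Sum>w\<in>(\<Pi>\<^sub>E i\<in>{..<n}. if i \<in> S then A else B). g w) =
    (\<Sum>a\<in>S \<rightarrow>\<^sub>E A. \<Sum>b\<in>({..<n} - S) \<rightarrow>\<^sub>E B. g (\<lambda>i. if i \<in> S then a i else b i))"
  unfolding sum.cartesian_product
proof (rule sum.reindex_bij_witness[of _ "\<lambda>(a, b) i. if i \<in> S then a i else b i"
      "\<lambda>w. (restrict w S, restrict w ({..<n} - S))"], goal_cases)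
  case (1 w)
  then show ?case using assms by (auto simp: fun_eq_iff PiE_iff extensional_def)
next
  case (2 w)
  then show ?case using assms by (auto simp: PiE_iff extensional_def split: if_splits)
next
  case (3 ab)
  then show ?case using assms by (auto simp: fun_eq_iff PiE_iff extensional_def)
next
  case (4 ab)
  then show ?case using assms by (auto simp: PiE_iff extensional_def)
next
  case (5 w)
  then have "(\<lambda>i. if i \<in> S then restrict w S i else restrict w ({..<n} - S) i) = w"
    using assms by (auto simp: fun_eq_iff PiE_iff extensional_def)
  then show ?case by simp
qed

text \<open>Only the pairs with one element in \<open>S\<close> and one outside are kept: then the sum over the
  values outside \<open>S\<close> factorises.\<close>

lemma sum_near_max_null:
  fixes s :: real
  assumes U: "U \<in> max_null" and S: "S \<subseteq> {..<n}" and s: "s \<ge> 0"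
  shows "(\<Sum>w\<in>(\<Pi>\<^sub>E i\<in>{..<n}. if i \<in> S then V - U else U). exp (- s * pair_energy D n w)) \<le>
    real (card V) ^ card S * (N * ((1 + exp (- (2 * s * card S))) / 2)) ^ (n - card S)"
proof -
  let ?T = "{..<n} - S"
  have UV: "U \<subseteq> V" using U by (auto simp: max_null_def)
  have finS: "finite S" using S finite_subset by blast
  have finU: "finite U" using UV finite_V finite_subset by blast
  have cT: "card ?T = n - card S" using S finS by (simp add: card_Diff_subset)
  let ?B = "(N * ((1 + exp (- (2 * s * card S))) / 2)) ^ (n - card S)"
  have "(\<Sum>w\<in>(\<Pi>\<^sub>E i\<in>{..<n}. if i \<in> S then V - U else U). exp (- s * pair_energy D n w)) \<le>
    (\<Sum>w\<in>(\<Pi>\<^sub>E i\<in>{..<n}. if i \<in> S then V - U else U). \<Prod>j\<in>?T. exp (- s * (\<Sum>i\<in>S. D (w j) (w i))))"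
  proof (rule sum_mono)
    fix w assume "w \<in> (\<Pi>\<^sub>E i\<in>{..<n}. if i \<in> S then V - U else U)"
    then have w: "w \<in> {..<n} \<rightarrow>\<^sub>E V" using UV by (auto simp: PiE_iff split: if_splits)
    have "exp (- s * pair_energy D n w) \<le> exp (- s * (\<Sum>j\<in>?T. \<Sum>i\<in>S. D (w j) (w i)))"
      using mult_left_mono[OF pair_energy_split[OF w S] s] by simp
    then show "exp (- s * pair_energy D n w) \<le> (\<Prod>j\<in>?T. exp (- s * (\<Sum>i\<in>S. D (w j) (w i))))"
      by (simp add: exp_sum sum_distrib_left flip: sum_negf)
  qed
  also have "\<dots> = (\<Sum>a\<in>S \<rightarrow>\<^sub>E (V - U). \<Sum>b\<in>?T \<rightarrow>\<^sub>E U. \<Prod>j\<in>?T. exp (- s * (\<Sum>i\<in>S. D (b j) (a i))))"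
    by (subst sum_PiE_split[OF S]) (intro sum.cong refl prod.cong, auto)
  also have "\<dots> = (\<Sum>a\<in>S \<rightarrow>\<^sub>E (V - U). \<Prod>j\<in>?T. \<Sum>t\<in>U. exp (- s * (\<Sum>i\<in>S. D t (a i))))"
    using finU by (intro sum.cong refl prod_sum_PiE[symmetric]) auto
  also have "\<dots> = (\<Sum>a\<in>S \<rightarrow>\<^sub>E (V - U). (\<Sum>t\<in>U. exp (- s * (\<Sum>i\<in>S. D t (a i)))) ^ (n - card S))"
    by (simp add: cT)
  also have "\<dots> \<le> (\<Sum>a\<in>S \<rightarrow>\<^sub>E (V - U). ?B)"
  proof (rule sum_mono)
    fix a assume "a \<in> S \<rightarrow>\<^sub>E (V - U)"
    then have "a \<in> S \<rightarrow> V - U" by auto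
    from sum_exp_balanced[OF U finS this s]
    show "(\<Sum>t\<in>U. exp (- s * (\<Sum>i\<in>S. D t (a i)))) ^ (n - card S) \<le> ?B"
      by (intro power_mono) (auto intro: sum_nonneg)
  qed
  also have "\<dots> = real (card (V - U)) ^ card S * ?B" by (simp add: card_PiE finS)
  also have "\<dots> \<le> real (card V) ^ card S * ?B"
    by (intro mult_right_mono power_mono) (auto intro!: card_mono finite_V add_nonneg_nonneg)
  finally show ?thesis .
qed


text \<open>The weight is bounded by 1; the gain lies in the counting, since a position outside
  \<open>S\<close> has at most N - 1 values to choose from.\<close>

lemma sum_outside_max_null:
  assumes S: "S \<subseteq> {..<n}" and U: "U \<subseteq> V" "card U < N" and s: "s \<ge> (0::real)"
  shows "(\<Sum>w\<in>(\<Pi>\<^sub>E i\<in>{..<n}. if i \<in> S then V - U else U). exp (- s * pair_energy D n w)) \<le>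
    real (card V) ^ card S * (real N - 1) ^ (n - card S)"
proof -
  have finS: "finite S" using S finite_subset by blast
  have "(\<Sum>w\<in>(\<Pi>\<^sub>E i\<in>{..<n}. if i \<in> S then V - U else U). exp (- s * pair_energy D n w)) \<le>
    (\<Sum>w\<in>(\<Pi>\<^sub>E i\<in>{..<n}. if i \<in> S then V - U else U). 1)"
  proof (rule sum_mono)
    fix w assume "w \<in> (\<Pi>\<^sub>E i\<in>{..<n}. if i \<in> S then V - U else U)"
    then have w: "w \<in> {..<n} \<rightarrow>\<^sub>E V" using U by (auto simp: PiE_iff split: if_splits)
    show "exp (- s * pair_energy D n w) \<le> 1" using pair_energy_nonneg[OF w] s by simp
  qed
  also have "\<dots> = real (card (V - U)) ^ card S * real (card U) ^ card ({..<n} - S)"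
    by (subst sum_PiE_split[OF S]) (simp add: card_PiE finS)
  also have "card ({..<n} - S) = n - card S" using S finS by (simp add: card_Diff_subset)
  also have "real (card (V - U)) ^ card S * real (card U) ^ (n - card S) \<le>
      real (card V) ^ card S * (real N - 1) ^ (n - card S)"
    using U finite_V by (intro mult_mono power_mono) (auto intro!: card_mono)
  finally show ?thesis .
qed

lemma exists_gap: "\<exists>\<delta>>0. \<forall>u\<in>V. \<forall>v\<in>V. D u v \<noteq> 0 \<longrightarrow> \<delta> \<le> D u v"
proof -
  \<comment> \<open>The inserted 1 keeps the minimum meaningful when all distances vanish.\<close>
  define X where "X = insert 1 {x \<in> (\<lambda>(u, v). D u v) ` (V \<times> V). x \<noteq> 0}"
  have X: "finite X" "X \<noteq> {}" using finite_V by (auto simp: X_def)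
  have "x > 0" if "x \<in> X" for x using that D_nonneg by (force simp: X_def less_le)
  then have "Min X > 0" using X by simp
  moreover have "Min X \<le> D u v" if "u \<in> V" "v \<in> V" "D u v \<noteq> 0" for u v
    using X that by (intro Min_le) (auto simp: X_def)
  ultimately show ?thesis by blast
qed

text \<open>When two labels at positive distance both occur linearly often, this makes the energy of
  order n^2. The weight is then exp(- const n ln n), which beats the number of all maps.\<close>

lemma pair_energy_two_heavy:
  assumes w: "w \<in> {..<n} \<rightarrow>\<^sub>E V" and uv: "u \<in> V" "v \<in> V"
  shows "real (card {i\<in>{..<n}. w i = u}) * real (card {i\<in>{..<n}. w i = v}) * D u v / 2 \<le> pair_energy D n w"
proof -
  have nn: "0 \<le> D (w i) (w j)" if "i < n" "j < n" for i j
    using D_nonneg w that by (auto simp: PiE_iff)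
  have "real (card {i\<in>{..<n}. w i = u}) * real (card {i\<in>{..<n}. w i = v}) * D u v =
    (\<Sum>i\<in>{i\<in>{..<n}. w i = u}. \<Sum>j\<in>{i\<in>{..<n}. w i = v}. D (w i) (w j))"
    by simp
  also have "\<dots> \<le> (\<Sum>i\<in>{i\<in>{..<n}. w i = u}. \<Sum>j<n. D (w i) (w j))"
    using nn by (intro sum_mono sum_mono2) auto
  also have "\<dots> \<le> (\<Sum>i<n. \<Sum>j<n. D (w i) (w j))"
    using nn by (intro sum_mono2) (auto intro!: sum_nonneg)
  finally show ?thesis by (simp add: pair_energy_def)
qed

text \<open>Call a label heavy for a map if it occurs at least \<epsilon> n / M times. Either two
  heavy labels are at positive distance, or the heavy labels form a null set with fewer than N
  elements, or they form a maximal null set. In the last case a stray map has a nonempty set S of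
  positions with light labels. In the last two cases S has at most \<epsilon> n elements.\<close>

theorem sum_stray_maps_tendsto:
  assumes c: "c > 1"
  shows "(\<lambda>n. (\<Sum>w\<in>stray_maps n. exp (- (c * ln (real n) / real n) * pair_energy D n w)) / real N ^ n)
    \<longlonglongrightarrow> 0"
proof -
  define M where "M = real (card V) + 1"
  have M: "M \<ge> 1" "real (card V) \<le> M" by (auto simp: M_def)
  \<comment> \<open>The mean of 1 and 1 / c, so that \<gamma>^2 > 1 / c and \<open>c2\<close> > 1 by
    the inequality of arithmetic and geometric means. One factor \<gamma> is lost in linearising the
    exponential, the other in passing from n to n - card S.\<close>
  define \<gamma> where "\<gamma> = (1 + 1 / c) / 2"
  define c2 where "c2 = c * \<gamma>\<^sup>2"
  have \<gamma>: "0 < \<gamma>" "\<gamma> < 1" using c by (auto simp: \<gamma>_def add_pos_pos)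
  have c2: "c2 > 1"
  proof -
    have "c2 - 1 = c * (1 - 1 / c)\<^sup>2 / 4" using c by (simp add: c2_def \<gamma>_def power2_eq_square field_simps)
    moreover have "c * (1 - 1 / c)\<^sup>2 / 4 > 0" using c by simp
    ultimately show ?thesis by linarith
  qed
  \<comment> \<open>The loss per position at the end x = 1 - \<gamma> of the range of
    \<open>half_one_plus_exp_le\<close>; beyond it every position loses at least this constant
    factor.\<close>
  define \<phi>0 where "\<phi>0 = (1 + exp (- (1 - \<gamma>))) / 2"
  have \<phi>0: "0 < \<phi>0" "\<phi>0 < 1" using \<gamma> by (auto simp: \<phi>0_def add_pos_pos)
  \<comment> \<open>The larger of the two constant losses per position, from energy and from
    counting. The root is taken because only half of the positions are sure to lie outside
    S.\<close>
  define \<sigma> where "\<sigma> = sqrt (max \<phi>0 ((real N - 1) / N))"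
  have \<sigma>: "0 < \<sigma>" "\<sigma> < 1" "\<phi>0 \<le> \<sigma>\<^sup>2" "real N - 1 \<le> N * \<sigma>\<^sup>2"
  proof -
    have p: "max \<phi>0 ((real N - 1) / N) > 0" using \<phi>0 by simp
    then have sq: "\<sigma>\<^sup>2 = max \<phi>0 ((real N - 1) / N)" by (simp add: \<sigma>_def)
    show "0 < \<sigma>" using p by (simp add: \<sigma>_def)
    show "\<sigma> < 1" using \<phi>0 N_pos by (simp add: \<sigma>_def)
    show "\<phi>0 \<le> \<sigma>\<^sup>2" by (simp add: sq)
    have "(real N - 1) / N \<le> \<sigma>\<^sup>2" by (simp add: sq)
    then show "real N - 1 \<le> N * \<sigma>\<^sup>2" using N_pos by (simp add: field_simps)
  qed
  \<comment> \<open>Strictly between 1 and 1 / \<sigma>: the choice of S may cost \<theta>^n and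
    still leave exponential decay.\<close>
  define \<theta> where "\<theta> = (1 + 1 / \<sigma>) / 2"
  have \<theta>: "\<theta> > 1" "0 < \<theta> * \<sigma>" "\<theta> * \<sigma> < 1" using \<sigma> by (auto simp: \<theta>_def field_simps add_pos_pos)
  have "M \<ge> 0" using M by simp
  obtain \<epsilon>0 :: real where \<epsilon>0: "\<epsilon>0 > 0"
    "\<And>n. (\<Sum>S | S \<subseteq> {..<n::nat} \<and> real (card S) \<le> \<epsilon>0 * n. M ^ card S) \<le> \<theta> ^ n"
    using small_subsets_entropy[OF \<open>M \<ge> 0\<close> \<theta>(1)] by metis
  \<comment> \<open>The three bounds serve the entropy of S, the inequality n - card S \<ge>
    \<gamma> n, and n - card S \<ge> n / 2.\<close>
  define \<epsilon> where "\<epsilon> = min \<epsilon>0 (min (1 - \<gamma>) (1 / 2))"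
  have \<epsilon>: "\<epsilon> > 0" "\<epsilon> \<le> \<epsilon>0" "\<epsilon> \<le> 1 - \<gamma>" "\<epsilon> \<le> 1 / 2" using \<epsilon>0(1) \<gamma> by (auto simp: \<epsilon>_def min_def)
  obtain \<delta> where \<delta>: "\<delta> > 0" "\<forall>u\<in>V. \<forall>v\<in>V. D u v \<noteq> 0 \<longrightarrow> \<delta> \<le> D u v"
    using exists_gap by blast
  define \<kappa> where "\<kappa> = c * (\<epsilon> / M)\<^sup>2 * \<delta> / 2"
  have \<kappa>: "\<kappa> > 0" using c \<epsilon> M \<delta> by (simp add: \<kappa>_def)
  define s where "s n = c * ln (real n) / real n" for n :: nat
  define f where "f n w = exp (- s n * pair_energy D n w)" for n w
  define P where "P n U S = (\<Pi>\<^sub>E i\<in>{..<n}. if i \<in> S then V - U else U)" for n :: nat and U S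
  define Q where "Q n = {S. S \<subseteq> {..<n} \<and> real (card S) \<le> \<epsilon> * n}" for n :: nat
  \<comment> \<open>With this threshold the light labels, at most M in number, occupy at most
    \<epsilon> n positions together.\<close>
  define heavy where "heavy n w = {v \<in> V. \<epsilon> * n / M \<le> card {i\<in>{..<n}. w i = v}}" for n :: nat and w
  define A where "A n = {w \<in> {..<n} \<rightarrow>\<^sub>E V. \<exists>u\<in>heavy n w. \<exists>v\<in>heavy n w. D u v \<noteq> 0}" for n
  define bound where "bound n = M ^ n * exp (- \<kappa> * n * ln n) +
      2 ^ card V * (2 * (\<theta> * \<sigma>) ^ n + ((1 + M * real n powr - c2) ^ n - 1))" for n :: nat
  have finQ: "finite (Q n)" for n
    by (rule finite_subset[of _ "Pow {..<n}"]) (auto simp: Q_def)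
  have finP: "finite (P n U S)" if "U \<subseteq> V" for n U S
    unfolding P_def using that finite_V by (intro finite_PiE) (auto intro: finite_subset)
  have s0: "s n \<ge> 0" if "n \<ge> 1" for n using that c by (simp add: s_def)
  have cover: "stray_maps n \<subseteq> A n \<union> ((\<Union>U\<in>{U. U \<subseteq> V \<and> card U < N}. \<Union>S\<in>Q n. P n U S) \<union>
      (\<Union>U\<in>max_null. \<Union>S\<in>Q n - {{}}. P n U S))" for n
  proof
    fix w assume w: "w \<in> stray_maps n"
    then have wV: "w \<in> {..<n} \<rightarrow>\<^sub>E V" by (auto simp: stray_maps_def)
    define U where "U = heavy n w"
    define S where "S = {i\<in>{..<n}. w i \<notin> U}"
    have UV: "U \<subseteq> V" by (auto simp: U_def heavy_def)
    have "S \<subseteq> (\<Union>v\<in>V - U. {i\<in>{..<n}. w i = v})" using wV by (auto simp: S_def)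
    then have "card S \<le> card (\<Union>v\<in>V - U. {i\<in>{..<n}. w i = v})"
      using finite_V by (intro card_mono) auto
    also have "\<dots> \<le> (\<Sum>v\<in>V - U. card {i\<in>{..<n}. w i = v})"
      using finite_V by (intro card_UN_le) auto
    finally have "real (card S) \<le> (\<Sum>v\<in>V - U. real (card {i\<in>{..<n}. w i = v}))"
      by (metis of_nat_le_iff of_nat_sum)
    also have "\<dots> \<le> (\<Sum>v\<in>V - U. \<epsilon> * n / M)"
      by (intro sum_mono) (auto simp: U_def heavy_def)
    also have "\<dots> = card (V - U) * (\<epsilon> * n / M)" by simp
    also have "\<dots> \<le> M * (\<epsilon> * n / M)"
      using card_mono[OF finite_V, of "V - U"] M \<epsilon> by (intro mult_right_mono) auto
    also have "\<dots> = \<epsilon> * n" using M by simp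
    finally have SQ: "S \<in> Q n" by (auto simp: Q_def S_def)
    have wP: "w \<in> P n U S" using wV by (auto simp: P_def S_def PiE_iff)
    show "w \<in> A n \<union> ((\<Union>U\<in>{U. U \<subseteq> V \<and> card U < N}. \<Union>S\<in>Q n. P n U S) \<union>
      (\<Union>U\<in>max_null. \<Union>S\<in>Q n - {{}}. P n U S))"
    proof (cases "\<exists>u\<in>U. \<exists>v\<in>U. D u v \<noteq> 0")
      case True
      then show ?thesis using wV by (auto simp: A_def U_def)
    next
      case False
      then have null: "\<forall>u\<in>U. \<forall>v\<in>U. D u v = 0" by blast
      from null_card[OF UV this] consider "card U < N" | "card U = N" by linarith
      then show ?thesis
      proof cases
        case 1
        then show ?thesis using UV SQ wP by blast
      next
        case 2
        then have U: "U \<in> max_null" using UV null by (auto simp: max_null_def)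
        have "S \<noteq> {}"
        proof
          assume "S = {}"
          then have "w ` {..<n} \<subseteq> U" by (auto simp: S_def)
          then show False using w U by (auto simp: stray_maps_def)
        qed
        then show ?thesis using U SQ wP by blast
      qed
    qed
  qed
  have boundA: "sum (f n) (A n) \<le> real N ^ n * (M ^ n * exp (- \<kappa> * n * ln n))" if n: "n \<ge> 1" for n
  proof -
    have "sum (f n) (A n) \<le> (\<Sum>w\<in>A n. exp (- \<kappa> * n * ln n))"
    proof (rule sum_mono)
      fix w assume "w \<in> A n"
      then obtain u v where w: "w \<in> {..<n} \<rightarrow>\<^sub>E V" and uv: "u \<in> heavy n w" "v \<in> heavy n w" "D u v \<noteq> 0"
        by (auto simp: A_def)
      then have V: "u \<in> V" "v \<in> V" by (auto simp: heavy_def)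
      have "(\<epsilon> * n / M) * (\<epsilon> * n / M) * \<delta> / 2 \<le>
          real (card {i\<in>{..<n}. w i = u}) * real (card {i\<in>{..<n}. w i = v}) * D u v / 2"
        using uv V \<delta> \<epsilon> M by (intro divide_right_mono mult_mono) (auto simp: heavy_def)
      also have "\<dots> \<le> pair_energy D n w" by (rule pair_energy_two_heavy[OF w V])
      finally have "s n * ((\<epsilon> * n / M) * (\<epsilon> * n / M) * \<delta> / 2) \<le> s n * pair_energy D n w"
        by (intro mult_left_mono s0[OF n])
      moreover have "s n * ((\<epsilon> * n / M) * (\<epsilon> * n / M) * \<delta> / 2) = \<kappa> * n * ln n"
        using n by (simp add: s_def \<kappa>_def power2_eq_square)
      ultimately show "f n w \<le> exp (- \<kappa> * n * ln n)" by (simp add: f_def)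
    qed
    also have "\<dots> = card (A n) * exp (- \<kappa> * n * ln n)" by simp
    also have "\<dots> \<le> M ^ n * exp (- \<kappa> * n * ln n)"
    proof (intro mult_right_mono)
      have "card (A n) \<le> card ({..<n} \<rightarrow>\<^sub>E V)"
        using finite_V by (intro card_mono finite_PiE) (auto simp: A_def)
      then have "real (card (A n)) \<le> real (card V) ^ n" by (simp add: card_PiE flip: of_nat_power)
      also have "\<dots> \<le> M ^ n" using M by (intro power_mono) auto
      finally show "real (card (A n)) \<le> M ^ n" .
    qed simp
    also have "\<dots> \<le> real N ^ n * (M ^ n * exp (- \<kappa> * n * ln n))"
    proof -
      have "1 \<le> real N ^ n" using N_pos by (intro one_le_power) simp
      then show ?thesis using mult_right_mono[of 1 "real N ^ n" "M ^ n * exp (- \<kappa> * n * ln n)"] M by simp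
    qed
    finally show ?thesis .
  qed
  have card_Q: "card S \<le> n" "\<gamma> * n \<le> real (n - card S)" "n \<le> 2 * (n - card S)" if "S \<in> Q n" for n S
  proof -
    have S: "S \<subseteq> {..<n}" "real (card S) \<le> \<epsilon> * n" using that by (auto simp: Q_def)
    show k: "card S \<le> n" using card_mono[OF _ S(1)] by simp
    have "\<epsilon> * n \<le> (1 - \<gamma>) * n" "\<epsilon> * n \<le> 1 / 2 * n" by (rule mult_right_mono[OF \<epsilon>(3)], simp) (rule mult_right_mono[OF \<epsilon>(4)], simp)
    then show "\<gamma> * n \<le> real (n - card S)" "n \<le> 2 * (n - card S)"
      using S k by (auto simp: of_nat_diff algebra_simps)
  qed
  have sigma_pow: "(\<sigma>\<^sup>2) ^ (n - card S) \<le> \<sigma> ^ n" if "S \<in> Q n" for n S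
    unfolding power_mult[symmetric] using card_Q(3)[OF that] \<sigma> by (intro power_decreasing) auto
  have N_pow: "real N ^ (n - k) \<le> real N ^ n" for n k
    using N_pos by (intro power_increasing) auto
  have boundB: "sum (f n) (P n U S) \<le> real N ^ n * (M ^ card S * \<sigma> ^ n)"
    if "n \<ge> 1" "U \<subseteq> V" "card U < N" "S \<in> Q n" for n U S
  proof -
    have "sum (f n) (P n U S) \<le> real (card V) ^ card S * (real N - 1) ^ (n - card S)"
      unfolding f_def P_def using that s0 by (intro sum_outside_max_null) (auto simp: Q_def)
    also have "\<dots> \<le> M ^ card S * (N * \<sigma>\<^sup>2) ^ (n - card S)"
      using M \<sigma> N_pos by (intro mult_mono power_mono) auto
    also have "\<dots> = real N ^ (n - card S) * (M ^ card S * (\<sigma>\<^sup>2) ^ (n - card S))"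
      by (simp only: power_mult_distrib mult_ac)
    also have "\<dots> \<le> real N ^ n * (M ^ card S * \<sigma> ^ n)"
      using M \<sigma> by (intro mult_mono N_pow sigma_pow that) auto
    finally show ?thesis .
  qed
  have boundC: "sum (f n) (P n U S) \<le> real N ^ n * ((M * n powr - c2) ^ card S + M ^ card S * \<sigma> ^ n)"
    if n: "n \<ge> 1" and U: "U \<in> max_null" and S: "S \<in> Q n" for n U S
  proof -
    define k where "k = card S"
    define \<phi> where "\<phi> = (1 + exp (- (2 * s n * k))) / 2"
    have \<phi>_nn: "\<phi> \<ge> 0" by (simp add: \<phi>_def add_nonneg_nonneg)
    \<comment> \<open>For few light positions the exponential is nearly linear and each of them
      costs n^(-c2); otherwise every position outside S loses the constant factor \<phi>0.\<close>
    have "\<phi> ^ (n - k) \<le> (n powr - c2) ^ k + \<sigma> ^ n"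
    proof (cases "2 * s n * k \<le> 1 - \<gamma>")
      case True
      have "\<phi> \<le> exp (- \<gamma> * (2 * s n * k) / 2)"
        unfolding \<phi>_def using True s0[OF n] by (intro half_one_plus_exp_le) auto
      then have "\<phi> ^ (n - k) \<le> exp (- \<gamma> * (2 * s n * k) / 2) ^ (n - k)"
        using \<phi>_nn by (intro power_mono)
      also have "\<dots> = exp (- (\<gamma> * s n * k) * real (n - k))"
        by (subst exp_of_nat_mult[symmetric]) (simp add: mult_ac)
      also have "\<dots> \<le> exp (- (\<gamma> * s n * k) * (\<gamma> * n))"
      proof -
        have "(\<gamma> * s n * k) * (\<gamma> * n) \<le> (\<gamma> * s n * k) * real (n - k)"
          using card_Q(2)[OF S] \<gamma> s0[OF n] by (intro mult_left_mono) (auto simp: k_def)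
        then show ?thesis by simp
      qed
      also have "(\<gamma> * s n * k) * (\<gamma> * n) = k * (c2 * ln n)"
        using n by (simp add: s_def c2_def power2_eq_square)
      then have "exp (- (\<gamma> * s n * k) * (\<gamma> * n)) = exp (k * (- c2 * ln n))" by simp
      also have "\<dots> = (n powr - c2) ^ k" using n by (subst exp_of_nat_mult) (simp add: powr_def)
      finally show ?thesis using \<sigma> by (simp add: add_increasing2)
    next
      case False
      have "\<phi> \<le> \<phi>0" using False by (simp add: \<phi>_def \<phi>0_def)
      also have "\<dots> \<le> \<sigma>\<^sup>2" by (rule \<sigma>)
      finally have "\<phi> ^ (n - k) \<le> (\<sigma>\<^sup>2) ^ (n - k)" using \<phi>_nn by (intro power_mono)
      also have "\<dots> \<le> \<sigma> ^ n" using sigma_pow[OF S] by (simp add: k_def)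
      finally show ?thesis by (simp add: add_increasing)
    qed
    note phi_bound = this
    have "sum (f n) (P n U S) \<le> real (card V) ^ k * (N * \<phi>) ^ (n - k)"
      unfolding f_def P_def k_def \<phi>_def using U S s0[OF n] by (intro sum_near_max_null) (auto simp: Q_def)
    also have "\<dots> \<le> M ^ k * (N * \<phi>) ^ (n - k)"
      using M \<phi>_nn by (intro mult_right_mono power_mono) auto
    also have "\<dots> = real N ^ (n - k) * (M ^ k * \<phi> ^ (n - k))"
      by (simp only: power_mult_distrib mult_ac)
    also have "\<dots> \<le> real N ^ n * (M ^ k * ((n powr - c2) ^ k + \<sigma> ^ n))"
      using M \<phi>_nn phi_bound by (intro mult_mono N_pow) auto
    also have "\<dots> = real N ^ n * ((M * n powr - c2) ^ card S + M ^ card S * \<sigma> ^ n)"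
      by (simp add: k_def power_mult_distrib distrib_left)
    finally show ?thesis .
  qed
  have entropy: "(\<Sum>S\<in>Q n. M ^ card S * \<sigma> ^ n) \<le> (\<theta> * \<sigma>) ^ n" for n
  proof -
    have "(\<Sum>S\<in>Q n. M ^ card S) \<le> (\<Sum>S | S \<subseteq> {..<n} \<and> real (card S) \<le> \<epsilon>0 * n. M ^ card S)"
    proof (rule sum_mono2)
      show "Q n \<subseteq> {S. S \<subseteq> {..<n} \<and> real (card S) \<le> \<epsilon>0 * n}"
        using mult_right_mono[OF \<epsilon>(2), of "real n"] by (auto simp: Q_def)
    qed (use M in auto)
    also have "\<dots> \<le> \<theta> ^ n" by (rule \<epsilon>0)
    finally have "(\<Sum>S\<in>Q n. M ^ card S) * \<sigma> ^ n \<le> \<theta> ^ n * \<sigma> ^ n"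
      using \<sigma> by (intro mult_right_mono) auto
    then show ?thesis by (simp add: power_mult_distrib sum_distrib_right)
  qed
  \<comment> \<open>The term 1 is the one of the empty set, whose maps stay inside a maximal null
    set and are not stray; what remains can tend to 0.\<close>
  have nonempty: "(\<Sum>S\<in>Q n - {{}}. y ^ card S) \<le> (1 + y) ^ n - 1" if "y \<ge> 0" for n and y :: real
  proof -
    have "(\<Sum>S\<in>Q n - {{}}. y ^ card S) \<le> (\<Sum>S\<in>Pow {..<n} - {{}}. y ^ card S)"
      using that by (intro sum_mono2) (auto simp: Q_def)
    also have "\<dots> = (1 + y) ^ n - 1"
      using sum_Pow_power_card[of "{..<n}" y] by (simp add: sum_diff1)
    finally show ?thesis .
  qed
  have main: "(\<Sum>w\<in>stray_maps n. f n w) \<le> real N ^ n * bound n" if n: "n \<ge> 1" for n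
  proof -
    let ?B = "\<Union>U\<in>{U. U \<subseteq> V \<and> card U < N}. \<Union>S\<in>Q n. P n U S"
    let ?C = "\<Union>U\<in>max_null. \<Union>S\<in>Q n - {{}}. P n U S"
    have fn: "f n w \<ge> 0" for w by (simp add: f_def)
    have finU: "finite {U. U \<subseteq> V \<and> card U < N}" "finite max_null"
      by (rule finite_subset[of _ "Pow V"]; use finite_V in \<open>auto simp: max_null_def\<close>)+
    have cardU: "real (card {U. U \<subseteq> V \<and> card U < N}) \<le> 2 ^ card V" "real (card max_null) \<le> 2 ^ card V"
    proof -
      have pow: "real (card X) \<le> 2 ^ card V" if "X \<subseteq> Pow V" for X :: "'v set set"
        using card_mono[OF _ that] finite_V by (simp add: card_Pow)
      show "real (card {U. U \<subseteq> V \<and> card U < N}) \<le> 2 ^ card V" by (rule pow) auto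
      show "real (card max_null) \<le> 2 ^ card V" by (rule pow) (auto simp: max_null_def)
    qed
    have finB: "finite ?B" using finU finQ finP by auto
    have finC: "finite ?C" using finU finQ finP by (auto simp: max_null_def)
    have finA: "finite (A n)"
      by (rule finite_subset[of _ "{..<n} \<rightarrow>\<^sub>E V"]) (auto simp: A_def finite_V intro: finite_PiE)
    have "sum (f n) (stray_maps n) \<le> sum (f n) (A n \<union> (?B \<union> ?C))"
      using cover finA finB finC fn by (intro sum_mono2) auto
    also have "\<dots> \<le> sum (f n) (A n) + sum (f n) (?B \<union> ?C)"
      using finA finB finC fn by (simp add: sum_Un sum_nonneg)
    also have "sum (f n) (?B \<union> ?C) \<le> sum (f n) ?B + sum (f n) ?C"
      using finB finC fn by (simp add: sum_Un sum_nonneg)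
    also have "sum (f n) ?B \<le> (\<Sum>U\<in>{U. U \<subseteq> V \<and> card U < N}. \<Sum>S\<in>Q n. sum (f n) (P n U S))"
      using finU finQ finP fn
      by (intro order.trans[OF sum_UN_le] sum_mono sum_UN_le) auto
    also have "\<dots> \<le> (\<Sum>U\<in>{U. U \<subseteq> V \<and> card U < N}. real N ^ n * (\<theta> * \<sigma>) ^ n)"
    proof (rule sum_mono)
      fix U assume U: "U \<in> {U. U \<subseteq> V \<and> card U < N}"
      have "(\<Sum>S\<in>Q n. sum (f n) (P n U S)) \<le> (\<Sum>S\<in>Q n. real N ^ n * (M ^ card S * \<sigma> ^ n))"
        using U n by (intro sum_mono boundB) auto
      also have "\<dots> \<le> real N ^ n * (\<theta> * \<sigma>) ^ n"
        using entropy[of n] by (simp add: mult_left_mono flip: sum_distrib_left)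
      finally show "(\<Sum>S\<in>Q n. sum (f n) (P n U S)) \<le> real N ^ n * (\<theta> * \<sigma>) ^ n" .
    qed
    also have "\<dots> \<le> 2 ^ card V * (real N ^ n * (\<theta> * \<sigma>) ^ n)"
      using cardU \<theta> by (simp add: mult_right_mono)
    also have "sum (f n) ?C \<le> (\<Sum>U\<in>max_null. \<Sum>S\<in>Q n - {{}}. sum (f n) (P n U S))"
      using finU finQ finP fn
      by (intro order.trans[OF sum_UN_le] sum_mono sum_UN_le) (auto simp: max_null_def)
    also have "\<dots> \<le> (\<Sum>U\<in>max_null. real N ^ n * (((1 + M * real n powr - c2) ^ n - 1) + (\<theta> * \<sigma>) ^ n))"
    proof (rule sum_mono)
      fix U assume U: "U \<in> max_null"
      have "(\<Sum>S\<in>Q n - {{}}. sum (f n) (P n U S)) \<le>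
        (\<Sum>S\<in>Q n - {{}}. real N ^ n * ((M * n powr - c2) ^ card S + M ^ card S * \<sigma> ^ n))"
        using U n by (intro sum_mono boundC) auto
      also have "\<dots> = real N ^ n * ((\<Sum>S\<in>Q n - {{}}. (M * n powr - c2) ^ card S) +
          (\<Sum>S\<in>Q n - {{}}. M ^ card S * \<sigma> ^ n))"
        by (simp add: sum.distrib flip: sum_distrib_left)
      also have "\<dots> \<le> real N ^ n * (((1 + M * real n powr - c2) ^ n - 1) + (\<Sum>S\<in>Q n. M ^ card S * \<sigma> ^ n))"
        using M \<sigma> finQ by (intro mult_left_mono add_mono nonempty sum_mono2) auto
      also have "\<dots> \<le> real N ^ n * (((1 + M * real n powr - c2) ^ n - 1) + (\<theta> * \<sigma>) ^ n)"
        by (intro mult_left_mono add_left_mono entropy) auto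
      finally show "(\<Sum>S\<in>Q n - {{}}. sum (f n) (P n U S)) \<le>
        real N ^ n * (((1 + M * real n powr - c2) ^ n - 1) + (\<theta> * \<sigma>) ^ n)" .
    qed
    also have "\<dots> \<le> 2 ^ card V * (real N ^ n * (((1 + M * real n powr - c2) ^ n - 1) + (\<theta> * \<sigma>) ^ n))"
    proof -
      have "(1 + M * real n powr - c2) ^ n \<ge> 1" using M by (intro one_le_power) simp
      then show ?thesis using cardU \<theta> by (simp add: mult_right_mono)
    qed
    finally show ?thesis using boundA[OF n] by (simp add: bound_def algebra_simps)
  qed
  have "bound \<longlonglongrightarrow> 0"
  proof -
    have "M > 0" using M by simp
    have "(\<lambda>n. M ^ n * exp (- \<kappa> * real n * ln (real n))) \<longlonglongrightarrow> 0"
    proof (rule tendsto_sandwich[OF _ _ tendsto_const])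
      have "(\<lambda>n. M * exp (- \<kappa> * ln (real n))) \<longlonglongrightarrow> 0"
        using \<kappa> by real_asymp
      then have "\<forall>\<^sub>F n in sequentially. M * exp (- \<kappa> * ln (real n)) < 1 / 2"
        by (rule order_tendstoD) simp
      then show "\<forall>\<^sub>F n in sequentially. M ^ n * exp (- \<kappa> * real n * ln (real n)) \<le> (1 / 2) ^ n"
      proof eventually_elim
        case (elim n)
        have "M ^ n * exp (- \<kappa> * real n * ln (real n)) = (M * exp (- \<kappa> * ln (real n))) ^ n"
          by (simp add: power_mult_distrib exp_of_nat_mult[symmetric] mult_ac)
        also have "\<dots> \<le> (1 / 2) ^ n" using elim \<open>M > 0\<close> by (intro power_mono) auto
        finally show ?case .
      qed
      show "(\<lambda>n. (1 / 2) ^ n :: real) \<longlonglongrightarrow> 0" by (intro LIMSEQ_realpow_zero) auto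
    qed (use \<open>M > 0\<close> in auto)
    moreover have "(\<lambda>n. (\<theta> * \<sigma>) ^ n) \<longlonglongrightarrow> 0" using \<theta> by (intro LIMSEQ_realpow_zero) auto
    \<comment> \<open>The decisive use of c > 1: since c2 > 1, n n^(-c2) tends to 0, so the losses
      outweigh the choice of the light positions.\<close>
    moreover have "(\<lambda>n. (1 + M * real n powr - c2) ^ n) \<longlonglongrightarrow> 1"
    proof (rule tendsto_sandwich[OF _ _ tendsto_const])
      have "(\<lambda>n. exp (M * real n powr (1 - c2))) \<longlonglongrightarrow> exp (M * 0)"
        using c2 by (intro tendsto_intros tendsto_neg_powr filterlim_real_sequentially) auto
      then show "(\<lambda>n. exp (M * real n powr (1 - c2))) \<longlonglongrightarrow> 1" by simp
      show "\<forall>\<^sub>F n in sequentially. (1 + M * real n powr - c2) ^ n \<le> exp (M * real n powr (1 - c2))"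
        using eventually_ge_at_top[of 1]
      proof eventually_elim
        case (elim n)
        have "(1 + M * real n powr - c2) ^ n \<le> exp (M * real n powr - c2) ^ n"
          using \<open>M > 0\<close> by (intro power_mono exp_ge_add_one_self) auto
        also have "\<dots> = exp (M * (real n * real n powr - c2))"
          by (simp add: exp_of_nat_mult[symmetric] mult_ac)
        also have "real n * real n powr - c2 = real n powr (1 - c2)"
          using elim powr_add[of "real n" 1 "- c2"] by simp
        finally show ?case .
      qed
      show "\<forall>\<^sub>F n in sequentially. 1 \<le> (1 + M * real n powr - c2) ^ n"
        using \<open>M > 0\<close> by (intro always_eventually allI one_le_power) auto
    qed
    ultimately have "(\<lambda>n. M ^ n * exp (- \<kappa> * real n * ln (real n)) +
      2 ^ card V * (2 * (\<theta> * \<sigma>) ^ n + ((1 + M * real n powr - c2) ^ n - 1))) \<longlonglongrightarrow> 0 + 2 ^ card V * (2 * 0 + (1 - 1))"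
      by (intro tendsto_add tendsto_mult tendsto_diff tendsto_const)
    then show ?thesis by (simp add: bound_def[abs_def])
  qed
  then show ?thesis
  proof (rule tendsto_sandwich[OF _ _ tendsto_const, rotated 2])
    show "\<forall>\<^sub>F n in sequentially. (\<Sum>w\<in>stray_maps n. exp (- (c * ln (real n) / real n) * pair_energy D n w)) / real N ^ n \<le> bound n"
      using eventually_ge_at_top[of 1]
    proof eventually_elim
      case (elim n)
      then show ?case using main[of n] N_pos by (simp add: f_def s_def divide_le_eq mult.commute)
    qed
    show "\<forall>\<^sub>F n in sequentially. 0 \<le> (\<Sum>w\<in>stray_maps n. exp (- (c * ln (real n) / real n) * pair_energy D n w)) / real N ^ n"
      by (intro always_eventually allI divide_nonneg_nonneg sum_nonneg) auto
  qed
qed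

end

section \<open>The moments as character sums\<close>

text \<open>Homomorphisms from the cokernel of \<open>L\<close>, encoded by the images of the
  standard basis. The probabilistic part works with these tuples only;
  \<open>card_Sur_cokernel\<close> makes the link to the quotient group.\<close>

definition coker_homs :: "('a, 'b) monoid_scheme \<Rightarrow> int mat \<Rightarrow> (nat \<Rightarrow> 'a) set" where
  "coker_homs G L = {f \<in> {..<dim_row L} \<rightarrow>\<^sub>E carrier G.
     \<forall>j<dim_col L. (\<Otimes>\<^bsub>G\<^esub>i\<in>{..<dim_row L}. f i [^]\<^bsub>G\<^esub> (L $$ (i, j))) = \<one>\<^bsub>G\<^esub>}"

definition coker_surs :: "('a, 'b) monoid_scheme \<Rightarrow> int mat \<Rightarrow> (nat \<Rightarrow> 'a) set" where
  "coker_surs G L = {f \<in> coker_homs G L. generate G (f ` {..<dim_row L}) = carrier G}"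

section \<open>Edges, incidences and expectations over random graphs\<close>

lemma finite_possible_edges: "finite (possible_edges n)"
  by (rule finite_subset[of _ "Pow {..<n}"]) (auto simp: possible_edges_def)

lemma possible_edgesE:
  assumes "e \<in> possible_edges n"
  obtains a b where "a < b" "b < n" "e = {a, b}" "Min e = a" "Max e = b"
proof -
  from assms obtain x y where xy: "e = {x, y}" "x \<noteq> y" "x < n" "y < n"
    by (auto simp: possible_edges_def card_2_iff)
  show ?thesis
  proof (cases "x < y")
    case True
    then show ?thesis using that[of x y] xy by simp
  next
    case False
    then show ?thesis using that[of y x] xy by (simp add: insert_commute)
  qed
qed

lemma dim_reduced_laplacian [simp]:
  "dim_row (reduced_laplacian (Suc m) E) = m" "dim_col (reduced_laplacian (Suc m) E) = m"
  by (auto simp: reduced_laplacian_def laplacian_def mat_delete_def)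

lemma reduced_laplacian_entry:
  assumes "i < m" "j < m"
  shows "reduced_laplacian (Suc m) E $$ (i, j) =
    (if i = j then int (card {e \<in> E. i \<in> e}) else if {i, j} \<in> E then - 1 else 0)"
  using assms by (simp add: reduced_laplacian_def laplacian_def mat_delete_def)

text \<open>Stated for a general commutative monoid since it is used twice: for the product of
  character values over neighbours and for the sum of distances in the energy.\<close>

lemma (in comm_monoid_set) ordered_pairs_eq_edges:
  assumes E: "E \<subseteq> possible_edges n"
  shows "F (\<lambda>j. F (T j) {i\<in>{..<n}. i \<noteq> j \<and> {i, j} \<in> E}) {..<n} =
    F (\<lambda>e. T (Min e) (Max e) \<^bold>* T (Max e) (Min e)) E"
proof -
  let ?S = "SIGMA j:{..<n}. {i\<in>{..<n}. i \<noteq> j \<and> {i, j} \<in> E}"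
  have finE: "finite E" using E finite_possible_edges finite_subset by blast
  have "F (\<lambda>j. F (T j) {i\<in>{..<n}. i \<noteq> j \<and> {i, j} \<in> E}) {..<n} = F (\<lambda>(j, i). T j i) ?S"
    by (rule Sigma) auto
  also have "\<dots> = F (\<lambda>e. F (\<lambda>(j, i). T j i) {x \<in> ?S. {fst x, snd x} = e}) E"
    by (rule group[symmetric]) (auto simp: finE insert_commute)
  also have "\<dots> = F (\<lambda>e. T (Min e) (Max e) \<^bold>* T (Max e) (Min e)) E"
  proof (rule cong[OF refl])
    fix e assume e: "e \<in> E"
    then obtain a b where ab: "a < b" "b < n" "e = {a, b}" "Min e = a" "Max e = b"
      using E possible_edgesE by blast
    have "{x \<in> ?S. {fst x, snd x} = e} = {(a, b), (b, a)}"
      using ab e by (auto simp: doubleton_eq_iff insert_commute)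
    then show "F (\<lambda>(j, i). T j i) {x \<in> ?S. {fst x, snd x} = e} = T (Min e) (Max e) \<^bold>* T (Max e) (Min e)"
      using ab by simp
  qed
  finally show ?thesis .
qed

lemma card_incident_edges:
  assumes E: "E \<subseteq> possible_edges n" and j: "j < n"
  shows "card {e \<in> E. j \<in> e} = card {i\<in>{..<n}. i \<noteq> j \<and> {i, j} \<in> E}"
proof -
  have "bij_betw (\<lambda>i. {i, j}) {i\<in>{..<n}. i \<noteq> j \<and> {i, j} \<in> E} {e \<in> E. j \<in> e}"
    unfolding bij_betw_def
  proof
    show "inj_on (\<lambda>i. {i, j}) {i\<in>{..<n}. i \<noteq> j \<and> {i, j} \<in> E}"
      by (auto simp: inj_on_def doubleton_eq_iff)
    show "(\<lambda>i. {i, j}) ` {i\<in>{..<n}. i \<noteq> j \<and> {i, j} \<in> E} = {e \<in> E. j \<in> e}"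
    proof (intro equalityI subsetI)
      fix e assume e: "e \<in> {e \<in> E. j \<in> e}"
      then obtain a b where ab: "a < b" "b < n" "e = {a, b}"
        using E possible_edgesE by blast
      then consider "j = a" | "j = b" using e by auto
      then show "e \<in> (\<lambda>i. {i, j}) ` {i\<in>{..<n}. i \<noteq> j \<and> {i, j} \<in> E}"
      proof cases
        case 1
        then show ?thesis using ab e by (intro image_eqI[of _ _ b]) (auto simp: insert_commute)
      next
        case 2
        then show ?thesis using ab e by (intro image_eqI[of _ _ a]) auto
      qed
    qed auto
  qed
  then show ?thesis by (simp add: bij_betw_same_card)
qed

lemma expectation_erdos_renyi:
  fixes F :: "nat set set \<Rightarrow> 'b::{banach, second_countable_topology}"
  assumes q: "0 \<le> q" "q \<le> 1"
  shows "measure_pmf.expectation (erdos_renyi n q) F =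
    (\<Sum>E\<in>Pow (possible_edges n). (q ^ card E * (1 - q) ^ card (possible_edges n - E)) *\<^sub>R F E)"
proof -
  let ?P = "possible_edges n"
  let ?X = "PiE_dflt ?P False (\<lambda>_. UNIV)"
  have fin: "finite ?P" by (rule finite_possible_edges)
  have "measure_pmf.expectation (erdos_renyi n q) F =
    measure_pmf.expectation (Pi_pmf ?P False (\<lambda>_. bernoulli_pmf q)) (\<lambda>b. F {e \<in> ?P. b e})"
    by (simp add: erdos_renyi_def)
  also have "\<dots> = (\<Sum>b\<in>?X. pmf (Pi_pmf ?P False (\<lambda>_. bernoulli_pmf q)) b *\<^sub>R F {e \<in> ?P. b e})"
  proof (rule integral_measure_pmf)
    show "finite ?X" using fin by (intro finite_PiE_dflt) auto
  next
    fix b assume "b \<in> set_pmf (Pi_pmf ?P False (\<lambda>_. bernoulli_pmf q))"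
    then show "b \<in> ?X" using set_Pi_pmf_subset'[OF fin] by (fastforce simp: PiE_dflt_def)
  qed
  also have "\<dots> = (\<Sum>E\<in>Pow ?P. (q ^ card E * (1 - q) ^ card (?P - E)) *\<^sub>R F E)"
  proof (rule sum.reindex_bij_witness[of _ "\<lambda>E e. e \<in> E" "\<lambda>b. {e \<in> ?P. b e}"], goal_cases)
    case (5 b)
    have "pmf (Pi_pmf ?P False (\<lambda>_. bernoulli_pmf q)) b = (\<Prod>e\<in>?P. pmf (bernoulli_pmf q) (b e))"
      using 5 fin by (intro pmf_Pi') (auto simp: PiE_dflt_def)
    also have "\<dots> = (\<Prod>e\<in>?P. if b e then q else 1 - q)"
      using q by (intro prod.cong) auto
    also have "\<dots> = q ^ card {e \<in> ?P. b e} * (1 - q) ^ card (?P - {e \<in> ?P. b e})"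
      using fin by (simp add: prod.If_cases Int_def set_diff_eq) (metis (mono_tags, lifting) Collect_cong)
    finally show ?case by simp
  qed (auto simp: PiE_dflt_def fun_eq_iff)
  finally show ?thesis .
qed

lemma expectation_erdos_renyi_prod:
  fixes k :: "nat set \<Rightarrow> complex"
  assumes q: "0 \<le> q" "q \<le> 1"
  shows "measure_pmf.expectation (erdos_renyi n q) (\<lambda>E. \<Prod>e\<in>E. k e) =
    (\<Prod>e\<in>possible_edges n. of_real (1 - q) + of_real q * k e)"
proof -
  let ?P = "possible_edges n"
  have "(\<Prod>e\<in>?P. of_real (1 - q) + of_real q * k e) = (\<Prod>e\<in>?P. complex_of_real q * k e + (1 - q))"
    by (intro prod.cong) auto
  also have "\<dots> = (\<Sum>E\<in>Pow ?P. (\<Prod>e\<in>E. complex_of_real q * k e) * (\<Prod>e\<in>?P - E. 1 - complex_of_real q))"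
    by (subst prod_add[OF finite_possible_edges]) simp
  also have "\<dots> = (\<Sum>E\<in>Pow ?P. (q ^ card E * (1 - q) ^ card (?P - E)) *\<^sub>R (\<Prod>e\<in>E. k e))"
    by (intro sum.cong refl) (simp add: prod.distrib scaleR_conv_of_real)
  finally show ?thesis by (simp add: expectation_erdos_renyi[OF q])
qed

text \<open>For |k| = 1 the squared norm equals 1 - 2 q (1 - q) (1 - Re k), and 1 + x \<le> exp x.
  The bound is symmetric in q and 1 - q, so dense and sparse graphs are treated alike.\<close>

lemma norm_one_minus_plus_le:
  fixes k :: complex and q :: real
  assumes "norm k = 1" "0 \<le> q" "q \<le> 1"
  shows "norm (of_real (1 - q) + of_real q * k) \<le> exp (- (q * (1 - q)) * (1 - Re k))"
proof -
  have k: "(Re k)\<^sup>2 + (Im k)\<^sup>2 = 1" using assms(1) by (simp add: cmod_def)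
  have "(norm (of_real (1 - q) + of_real q * k))\<^sup>2 = (1 - q + q * Re k)\<^sup>2 + (q * Im k)\<^sup>2"
    by (simp add: cmod_power2)
  also have "\<dots> = (1 - q)\<^sup>2 + 2 * (1 - q) * q * Re k + q\<^sup>2 * ((Re k)\<^sup>2 + (Im k)\<^sup>2)"
    by (simp add: power2_eq_square algebra_simps)
  also have "\<dots> = 1 + (- (2 * (q * (1 - q)) * (1 - Re k)))"
    unfolding k by (simp add: power2_eq_square algebra_simps)
  also have "\<dots> \<le> exp (- (2 * (q * (1 - q)) * (1 - Re k)))" by (rule exp_ge_add_one_self)
  also have "\<dots> = (exp (- (q * (1 - q)) * (1 - Re k)))\<^sup>2"
    using exp_double[of "- (q * (1 - q)) * (1 - Re k)"] by (simp add: algebra_simps)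
  finally show ?thesis by (rule power2_le_imp_le) simp
qed

text \<open>The kernel is symmetric, so which end of the edge comes first is immaterial.\<close>

definition edge_kern :: "(nat \<Rightarrow> 'a \<times> ('a \<Rightarrow> complex)) \<Rightarrow> nat set \<Rightarrow> complex" where
  "edge_kern w e = kern (w (Min e)) (w (Max e))"

definition kern_dist :: "'a \<times> ('a \<Rightarrow> complex) \<Rightarrow> 'a \<times> ('a \<Rightarrow> complex) \<Rightarrow> real" where
  "kern_dist u v = 1 - Re (kern u v)"

lemma kern_dist_commute: "kern_dist u v = kern_dist v u"
  unfolding kern_dist_def by (subst kern_commute) (rule refl)

lemma kern_dist_eq_0_iff:
  assumes "u \<in> phase_space G" "v \<in> phase_space G"
  shows "kern_dist u v = 0 \<longleftrightarrow> kern u v = 1"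
proof
  assume "kern_dist u v = 0"
  moreover from this have "(Im (kern u v))\<^sup>2 = 0"
    using norm_kern[OF assms] by (simp add: kern_dist_def cmod_def)
  ultimately show "kern u v = 1" by (simp add: kern_dist_def complex_eq_iff)
qed (simp add: kern_dist_def)

lemma norm_prod_edges_le:
  assumes w: "w \<in> {..<n} \<rightarrow>\<^sub>E phase_space G" and q: "0 \<le> q" "q \<le> 1"
  shows "norm (\<Prod>e\<in>possible_edges n. of_real (1 - q) + of_real q * edge_kern w e) \<le>
    exp (- (q * (1 - q)) * pair_energy kern_dist n w)"
proof -
  let ?P = "possible_edges n"
  have wV: "w i \<in> phase_space G" if "i < n" for i using w that by auto
  have edge: "Min e < n" "Max e < n" if "e \<in> ?P" for e
    using that by (auto elim!: possible_edgesE)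
  have "norm (\<Prod>e\<in>?P. of_real (1 - q) + of_real q * edge_kern w e) = (\<Prod>e\<in>?P. norm (of_real (1 - q) + of_real q * edge_kern w e))"
    by (rule prod_norm[symmetric])
  also have "\<dots> \<le> (\<Prod>e\<in>?P. exp (- (q * (1 - q)) * kern_dist (w (Min e)) (w (Max e))))"
  proof (intro prod_mono conjI norm_ge_zero)
    fix e assume e: "e \<in> ?P"
    have "norm (edge_kern w e) = 1" using norm_kern wV edge[OF e] unfolding edge_kern_def by blast
    from norm_one_minus_plus_le[OF this q]
    show "norm (of_real (1 - q) + of_real q * edge_kern w e) \<le> exp (- (q * (1 - q)) * kern_dist (w (Min e)) (w (Max e)))"
      by (simp add: edge_kern_def kern_dist_def)
  qed
  also have "\<dots> = exp (- (q * (1 - q)) * (\<Sum>e\<in>?P. kern_dist (w (Min e)) (w (Max e))))"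
    by (simp add: exp_sum finite_possible_edges sum_distrib_left flip: sum_negf)
  also have "(\<Sum>e\<in>?P. kern_dist (w (Min e)) (w (Max e))) = pair_energy kern_dist n w"
  proof -
    have "(\<Sum>j<n. \<Sum>i<n. kern_dist (w j) (w i)) =
      (\<Sum>j<n. \<Sum>i\<in>{i\<in>{..<n}. i \<noteq> j \<and> {i, j} \<in> ?P}. kern_dist (w j) (w i))"
    proof (rule sum.cong[OF refl])
      fix j assume j: "j \<in> {..<n}"
      show "(\<Sum>i<n. kern_dist (w j) (w i)) = (\<Sum>i\<in>{i\<in>{..<n}. i \<noteq> j \<and> {i, j} \<in> ?P}. kern_dist (w j) (w i))"
      proof (rule sum.mono_neutral_right; (intro ballI)?)
        fix i assume "i \<in> {..<n} - {i\<in>{..<n}. i \<noteq> j \<and> {i, j} \<in> ?P}"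
        then have "i = j" "j < n" using j by (auto simp: possible_edges_def card_insert_if split: if_splits)
        then show "kern_dist (w j) (w i) = 0" using kern_refl[OF wV] by (simp add: kern_dist_def)
      qed auto
    qed
    also have "\<dots> = (\<Sum>e\<in>?P. kern_dist (w (Min e)) (w (Max e)) + kern_dist (w (Max e)) (w (Min e)))"
      by (rule sum.ordered_pairs_eq_edges) simp
    also have "\<dots> = (\<Sum>e\<in>?P. 2 * kern_dist (w (Min e)) (w (Max e)))"
      by (intro sum.cong refl) (metis kern_dist_commute mult_2)
    finally show ?thesis by (simp add: pair_energy_def flip: sum_distrib_left)
  qed
  finally show ?thesis .
qed

context comm_group
begin

section \<open>Fourier expansion of the number of homomorphisms\<close>

lemma character_int_pow:
  assumes "\<xi> \<in> characters G" "x \<in> carrier G"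
  shows "\<xi> (x [^] (k::int)) = \<xi> x powi k"
proof (cases k rule: int_cases2)
  case (nonneg n)
  then show ?thesis using character_pow[OF assms, of n] by (simp add: int_pow_int)
next
  case (nonpos n)
  have "cnj (\<xi> x) = inverse (\<xi> x)" using characters_cnj_mult[OF assms] by (metis inverse_unique)
  then show ?thesis using nonpos assms character_pow[OF assms, of n]
    by (simp add: int_pow_neg_int character_inv power_int_minus power_inverse)
qed

lemma character_finprod:
  assumes "\<xi> \<in> characters G" "finite A" "g \<in> A \<rightarrow> carrier G"
  shows "\<xi> (finprod G g A) = (\<Prod>i\<in>A. \<xi> (g i))"
  using assms(2,3)
proof (induction A rule: finite_induct)
  case (insert a A)
  then show ?case using assms(1) by (simp add: charactersD Pi_iff)
qed (simp add: assms)

text \<open>The degree on the diagonal gives every edge at j one factor C_j(f_j), to go with the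
  factor cnj(C_j(f_i)) from the entry -1. The two ends of an edge together give \<open>kern\<close>.
  The deleted vertex can be restored since its label is neutral: C_j takes the value 1 at its
  element, and its own character is trivial.\<close>

lemma prod_characters_laplacian:
  assumes E: "E \<subseteq> possible_edges (Suc m)" and w: "w \<in> rooted_maps m"
  shows "(\<Prod>j<m. snd (w j) (\<Otimes>i\<in>{..<m}. fst (w i) [^] (reduced_laplacian (Suc m) E $$ (i, j)))) =
    (\<Prod>e\<in>E. edge_kern w e)"
proof -
  let ?n = "Suc m" and ?nb = "\<lambda>j. {i\<in>{..<Suc m}. i \<noteq> j \<and> {i, j} \<in> E}"
  define f where "f i = fst (w i)" for i
  define C where "C i = snd (w i)" for i
  have fG: "f i \<in> carrier G" and CG: "C i \<in> characters G" if "i < ?n" for i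
    using w that by (auto simp: f_def C_def rooted_maps_def phase_space_def PiE_iff Ball_def)
  have root: "f m = \<one>" "C m = trivial_character G" using w by (auto simp: f_def C_def rooted_maps_def)
  define T where "T j i = C j (f j) * cnj (C j (f i))" for i j
  have cnj_inv: "cnj (C j (f i)) = inverse (C j (f i))" if "i < ?n" "j < ?n" for i j
    using characters_cnj_mult[OF CG[OF that(2)] fG[OF that(1)]] by (metis inverse_unique)
  have inner: "C j (\<Otimes>i\<in>{..<m}. f i [^] (reduced_laplacian ?n E $$ (i, j))) = (\<Prod>i\<in>?nb j. T j i)"
    if j: "j < m" for j
  proof -
    let ?L = "\<lambda>i. if i = j then int (card {e \<in> E. j \<in> e}) else if {i, j} \<in> E then - 1 else 0"
    have "C j (\<Otimes>i\<in>{..<m}. f i [^] (reduced_laplacian ?n E $$ (i, j))) =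
      (\<Prod>i<m. C j (f i) powi (reduced_laplacian ?n E $$ (i, j)))"
      using j fG CG by (subst character_finprod) (auto simp: character_int_pow)
    also have "\<dots> = (\<Prod>i<m. C j (f i) powi ?L i)"
      using j by (intro prod.cong refl) (auto simp: reduced_laplacian_entry)
    also have "\<dots> = (\<Prod>i<?n. C j (f i) powi ?L i)"
      using root CG[of j] j by simp
    also have "\<dots> = C j (f j) powi (int (card {e \<in> E. j \<in> e})) * (\<Prod>i\<in>{..<?n} - {j}. C j (f i) powi ?L i)"
      using j by (subst prod.remove[of _ j]) auto
    also have "(\<Prod>i\<in>{..<?n} - {j}. C j (f i) powi ?L i) = (\<Prod>i\<in>?nb j. cnj (C j (f i)))"
      using j by (intro prod.mono_neutral_cong_right) (auto simp: cnj_inv power_int_minus)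
    also have "C j (f j) powi (int (card {e \<in> E. j \<in> e})) = C j (f j) ^ card (?nb j)"
      using card_incident_edges[OF E, of j] j by simp
    finally show ?thesis by (simp add: T_def prod.distrib)
  qed
  have "(\<Prod>j<m. C j (\<Otimes>i\<in>{..<m}. f i [^] (reduced_laplacian ?n E $$ (i, j)))) = (\<Prod>j<m. \<Prod>i\<in>?nb j. T j i)"
    by (intro prod.cong refl inner) auto
  also have "\<dots> = (\<Prod>j<?n. \<Prod>i\<in>?nb j. T j i)"
  proof -
    have "(\<Prod>i\<in>?nb m. T m i) = 1"
      using fG by (intro prod.neutral) (auto simp: T_def root trivial_character_def)
    then show ?thesis by simp
  qed
  also have "\<dots> = (\<Prod>e\<in>E. T (Min e) (Max e) * T (Max e) (Min e))"
    by (rule prod.ordered_pairs_eq_edges[OF E])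
  also have "\<dots> = (\<Prod>e\<in>E. edge_kern w e)"
    by (intro prod.cong refl) (simp add: T_def edge_kern_def kern_def f_def C_def mult_ac)
  finally show ?thesis by (simp add: f_def C_def)
qed

lemma indicator_fourier:
  assumes fin: "finite (carrier G)" and h: "h \<in> {..<m} \<rightarrow> carrier G"
  shows "(if \<forall>j<m. h j = \<one> then 1 else 0) =
    (\<Sum>C\<in>{..<m} \<rightarrow>\<^sub>E characters G. \<Prod>j<m. C j (h j)) / of_nat (card (carrier G)) ^ m"
proof -
  let ?N = "of_nat (card (carrier G)) :: complex"
  have N: "?N \<noteq> 0" using fin by auto
  have "(\<Sum>C\<in>{..<m} \<rightarrow>\<^sub>E characters G. \<Prod>j<m. C j (h j)) = (\<Prod>j<m. \<Sum>\<xi>\<in>characters G. \<xi> (h j))"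
    by (rule prod_sum_PiE[symmetric]) (auto simp: finite_characters fin)
  also have "\<dots> = (\<Prod>j<m. if h j = \<one> then ?N else 0)"
    using h by (intro prod.cong refl) (auto simp: sum_characters_at fin card_characters Pi_iff)
  also have "\<dots> = (if \<forall>j<m. h j = \<one> then ?N ^ m else 0)"
    by (auto intro: prod_zero)
  finally show ?thesis using N by simp
qed

text \<open>The relations are detected by characters before the expectation is taken, so that for a
  fixed labelling the edges contribute independent factors. The predicate \<open>Pr\<close> lets one
  identity serve for generating tuples and for all homomorphisms.\<close>

lemma moment_fourier:
  assumes fin: "finite (carrier G)" and q: "0 \<le> q" "q \<le> 1"
  shows "complex_of_real (measure_pmf.expectation (erdos_renyi (Suc m) q)
      (\<lambda>E. real (card {f \<in> coker_homs G (reduced_laplacian (Suc m) E). Pr (f ` {..<m})}))) =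
    (\<Sum>w | w \<in> rooted_maps m \<and> Pr (fst ` w ` {..<m}). \<Prod>e\<in>possible_edges (Suc m). of_real (1 - q) + of_real q * edge_kern w e)
      / of_nat (card (carrier G)) ^ m"
proof -
  let ?P = "possible_edges (Suc m)" and ?N = "of_nat (card (carrier G)) :: complex"
  define X where "X = {f \<in> {..<m} \<rightarrow>\<^sub>E carrier G. Pr (f ` {..<m})}"
  define W where "W = {w \<in> rooted_maps m. Pr (fst ` w ` {..<m})}"
  have finX: "finite X" unfolding X_def using finite_PiE[of "{..<m}" "\<lambda>_. carrier G"] fin by simp
  define mk where "mk f C = (\<lambda>i\<in>{..<Suc m}. if i = m then (\<one>, trivial_character G) else (f i, C i))"
    for f :: "nat \<Rightarrow> 'a" and C :: "nat \<Rightarrow> 'a \<Rightarrow> complex"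
  have mk: "mk f C \<in> W" if "f \<in> X" "C \<in> {..<m} \<rightarrow>\<^sub>E characters G" for f C
  proof -
    have "fst ` mk f C ` {..<m} = (\<lambda>i. fst (mk f C i)) ` {..<m}" by (simp add: image_image)
    also have "\<dots> = f ` {..<m}" by (rule image_cong) (auto simp: mk_def)
    finally have "fst ` mk f C ` {..<m} = f ` {..<m}" .
    then show ?thesis using that by (auto simp: W_def X_def rooted_maps_def mk_def phase_space_def PiE_iff)
  qed
  have reindex: "(\<Sum>f\<in>X. \<Sum>C\<in>{..<m} \<rightarrow>\<^sub>E characters G. g (mk f C)) = sum g W"
    for g :: "(nat \<Rightarrow> 'a \<times> ('a \<Rightarrow> complex)) \<Rightarrow> complex"
    unfolding sum.cartesian_product
  proof (rule sum.reindex_bij_witness[of _ "\<lambda>w. (\<lambda>i\<in>{..<m}. fst (w i), \<lambda>i\<in>{..<m}. snd (w i))" "\<lambda>(f, C). mk f C"],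
      goal_cases)
    case (1 a)
    then show ?case by (auto simp: mk_def X_def fun_eq_iff PiE_iff extensional_def)
  next
    case (2 a)
    then show ?case using mk by auto
  next
    case (3 w)
    then have w: "w \<in> {..<Suc m} \<rightarrow>\<^sub>E phase_space G" "w m = (\<one>, trivial_character G)"
      by (auto simp: W_def rooted_maps_def)
    show ?case
    proof
      fix i show "(case (\<lambda>i\<in>{..<m}. fst (w i), \<lambda>i\<in>{..<m}. snd (w i)) of (f, C) \<Rightarrow> mk f C) i = w i"
        using w by (cases "i < m"; cases "i = m") (auto simp: mk_def PiE_iff extensional_def)
    qed
  next
    case (4 w)
    then have w: "w \<in> {..<Suc m} \<rightarrow>\<^sub>E phase_space G" "Pr (fst ` w ` {..<m})"
      by (auto simp: W_def rooted_maps_def)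
    have wi: "w i \<in> phase_space G" if "i < m" for i
      by (rule PiE_mem[OF w(1)]) (use that in simp)
    have "(\<lambda>i\<in>{..<m}. fst (w i)) ` {..<m} = fst ` w ` {..<m}" by (simp add: image_image)
    then show ?case using w(2) phase_spaceD[OF wi] by (auto simp: X_def)
  next
    case (5 a)
    then show ?case by auto
  qed
  define h where "h E f j = (\<Otimes>i\<in>{..<m}. f i [^] (reduced_laplacian (Suc m) E $$ (i, j)))" for E f j
  have card_eq: "of_nat (card {f \<in> coker_homs G (reduced_laplacian (Suc m) E). Pr (f ` {..<m})}) =
      (\<Sum>w\<in>W. \<Prod>e\<in>E. edge_kern w e) / ?N ^ m" if E: "E \<subseteq> ?P" for E
  proof -
    have "{f \<in> coker_homs G (reduced_laplacian (Suc m) E). Pr (f ` {..<m})} = {f \<in> X. \<forall>j<m. h E f j = \<one>}"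
      by (auto simp: coker_homs_def X_def h_def)
    then have "of_nat (card {f \<in> coker_homs G (reduced_laplacian (Suc m) E). Pr (f ` {..<m})}) =
      (\<Sum>f\<in>X. if \<forall>j<m. h E f j = \<one> then 1 else 0 :: complex)"
      using finX by (simp add: sum.If_cases Int_def)
    also have "\<dots> = (\<Sum>f\<in>X. (\<Sum>C\<in>{..<m} \<rightarrow>\<^sub>E characters G. \<Prod>j<m. C j (h E f j)) / ?N ^ m)"
      by (intro sum.cong refl indicator_fourier[OF fin]) (auto simp: h_def X_def PiE_iff intro!: finprod_closed)
    also have "\<dots> = (\<Sum>f\<in>X. \<Sum>C\<in>{..<m} \<rightarrow>\<^sub>E characters G. \<Prod>e\<in>E. edge_kern (mk f C) e) / ?N ^ m"
    proof -
      have "(\<Prod>j<m. C j (h E f j)) = (\<Prod>e\<in>E. edge_kern (mk f C) e)"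
        if "f \<in> X" "C \<in> {..<m} \<rightarrow>\<^sub>E characters G" for f C
      proof -
        have "(\<Prod>j<m. C j (h E f j)) = (\<Prod>j<m. snd (mk f C j) (\<Otimes>i\<in>{..<m}. fst (mk f C i) [^]
            (reduced_laplacian (Suc m) E $$ (i, j))))"
        proof (intro prod.cong refl)
          fix j assume "j \<in> {..<m}"
          moreover have "f i \<in> carrier G" if "i < m" for i using \<open>f \<in> X\<close> that by (auto simp: X_def)
          then have "h E f j = (\<Otimes>i\<in>{..<m}. fst (mk f C i) [^] (reduced_laplacian (Suc m) E $$ (i, j)))"
            unfolding h_def by (intro finprod_cong') (auto simp: mk_def)
          ultimately show "C j (h E f j) = snd (mk f C j) (\<Otimes>i\<in>{..<m}. fst (mk f C i) [^]
            (reduced_laplacian (Suc m) E $$ (i, j)))" by (simp add: mk_def)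
        qed
        also have "\<dots> = (\<Prod>e\<in>E. edge_kern (mk f C) e)"
          using mk[OF that] by (intro prod_characters_laplacian[OF E]) (auto simp: W_def)
        finally show ?thesis .
      qed
      then show ?thesis by (simp flip: sum_divide_distrib)
    qed
    also have "\<dots> = (\<Sum>w\<in>W. \<Prod>e\<in>E. edge_kern w e) / ?N ^ m" by (subst reindex) simp
    finally show ?thesis .
  qed
  let ?wt = "\<lambda>E. q ^ card E * (1 - q) ^ card (?P - E)"
  have "complex_of_real (measure_pmf.expectation (erdos_renyi (Suc m) q)
      (\<lambda>E. real (card {f \<in> coker_homs G (reduced_laplacian (Suc m) E). Pr (f ` {..<m})}))) =
    (\<Sum>E\<in>Pow ?P. complex_of_real (?wt E) * of_nat (card {f \<in> coker_homs G (reduced_laplacian (Suc m) E). Pr (f ` {..<m})}))"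
    by (simp add: expectation_erdos_renyi[OF q])
  also have "\<dots> = (\<Sum>E\<in>Pow ?P. complex_of_real (?wt E) * ((\<Sum>w\<in>W. \<Prod>e\<in>E. edge_kern w e) / ?N ^ m))"
    by (intro sum.cong refl) (simp add: card_eq)
  also have "\<dots> = (\<Sum>w\<in>W. \<Sum>E\<in>Pow ?P. complex_of_real (?wt E) * (\<Prod>e\<in>E. edge_kern w e)) / ?N ^ m"
    by (subst sum.swap) (simp add: sum_distrib_left sum_divide_distrib)
  also have "\<dots> = (\<Sum>w\<in>W. \<Prod>e\<in>?P. of_real (1 - q) + of_real q * edge_kern w e) / ?N ^ m"
  proof -
    have "(\<Sum>E\<in>Pow ?P. complex_of_real (?wt E) * (\<Prod>e\<in>E. edge_kern w e)) =
      (\<Prod>e\<in>?P. of_real (1 - q) + of_real q * edge_kern w e)" for w :: "nat \<Rightarrow> 'a \<times> ('a \<Rightarrow> complex)"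
      using expectation_erdos_renyi_prod[OF q, of "Suc m" "edge_kern w"]
      unfolding expectation_erdos_renyi[OF q] scaleR_conv_of_real .
    then show ?thesis by (simp only:)
  qed
  finally show ?thesis by (simp add: W_def)
qed

end

section \<open>The limit of the moments\<close>

context comm_group
begin

lemma energy_kernel_phase_space:
  assumes fin: "finite (carrier G)"
  shows "energy_kernel (phase_space G) kern_dist (card (carrier G))"
proof
  show "finite (phase_space G)" by (rule finite_phase_space[OF fin])
  show "card (carrier G) > 0" using fin by (auto simp: card_gt_0_iff)
  fix u v assume "u \<in> phase_space G" "v \<in> phase_space G"
  then have "\<bar>Re (kern u v)\<bar> \<le> 1" using abs_Re_le_cmod[of "kern u v"] norm_kern by metis
  then show "0 \<le> kern_dist u v" "kern_dist u v \<le> 2" by (auto simp: kern_dist_def)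
next
  show "kern_dist u v = kern_dist v u" for u v by (rule kern_dist_commute)
next
  fix U assume U: "U \<subseteq> phase_space G" "\<forall>u\<in>U. \<forall>v\<in>U. kern_dist u v = 0"
  then have iso: "isotropic U" using kern_dist_eq_0_iff unfolding isotropic_def by blast
  show "card U \<le> card (carrier G)" by (rule isotropic_bound(1)[OF fin U(1) iso])
  fix v assume c: "card U = card (carrier G)" and v: "v \<in> phase_space G - U"
  have "(\<Sum>u\<in>U. kern_dist u v) = card U - Re (\<Sum>u\<in>U. kern u v)"
    by (simp add: kern_dist_def sum_subtractf)
  also have "(\<Sum>u\<in>U. kern u v) = 0" by (rule isotropic_bound(2)[OF fin U(1) iso c v])
  finally show "(\<Sum>u\<in>U. kern_dist u v) = real (card (carrier G))" using c by simp
qed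

text \<open>Normalised by |G|^n, while the moments are divided by |G|^(n - 1) only; this is the
  origin of the extra factor |G| in the later bounds.\<close>

definition error_sum :: "(nat \<Rightarrow> real) \<Rightarrow> nat \<Rightarrow> real" where
  "error_sum s n = (\<Sum>w\<in>energy_kernel.stray_maps (phase_space G) kern_dist (card (carrier G)) n.
     exp (- s n * pair_energy kern_dist n w)) / real (card (carrier G)) ^ n"

lemma error_sum_tendsto:
  assumes fin: "finite (carrier G)" and "c > 1"
  shows "error_sum (\<lambda>n. c * ln (real n) / real n) \<longlonglongrightarrow> 0"
  unfolding error_sum_def[abs_def]
  by (rule energy_kernel.sum_stray_maps_tendsto[OF energy_kernel_phase_space[OF fin] assms(2)])

lemma sum_norm_stray_le:
  assumes fin: "finite (carrier G)" and q: "0 \<le> q" "q \<le> 1" and s: "s (Suc m) \<le> q * (1 - q)"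
    and W: "W \<subseteq> energy_kernel.stray_maps (phase_space G) kern_dist (card (carrier G)) (Suc m)"
  shows "norm (\<Sum>w\<in>W. \<Prod>e\<in>possible_edges (Suc m). of_real (1 - q) + of_real q * edge_kern w e)
    \<le> card (carrier G) ^ Suc m * error_sum s (Suc m)"
proof -
  interpret energy_kernel "phase_space G" kern_dist "card (carrier G)"
    by (rule energy_kernel_phase_space[OF fin])
  have wV: "w \<in> {..<Suc m} \<rightarrow>\<^sub>E phase_space G" if "w \<in> W" for w
    using W that unfolding stray_maps_def by auto
  have fins: "finite (stray_maps (Suc m))"
    by (rule finite_subset[of _ "{..<Suc m} \<rightarrow>\<^sub>E phase_space G"])
       (auto simp: stray_maps_def intro!: finite_PiE finite_V)
  have "norm (\<Sum>w\<in>W. \<Prod>e\<in>possible_edges (Suc m). of_real (1 - q) + of_real q * edge_kern w e) \<le>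
    (\<Sum>w\<in>W. exp (- s (Suc m) * pair_energy kern_dist (Suc m) w))"
  proof (rule sum_norm_le)
    fix w assume w: "w \<in> W"
    have "norm (\<Prod>e\<in>possible_edges (Suc m). of_real (1 - q) + of_real q * edge_kern w e) \<le>
      exp (- (q * (1 - q)) * pair_energy kern_dist (Suc m) w)"
      by (rule norm_prod_edges_le[OF wV[OF w] q])
    also have "\<dots> \<le> exp (- s (Suc m) * pair_energy kern_dist (Suc m) w)"
      using mult_right_mono[OF s pair_energy_nonneg[OF wV[OF w]]] by simp
    finally show "norm (\<Prod>e\<in>possible_edges (Suc m). of_real (1 - q) + of_real q * edge_kern w e) \<le>
      exp (- s (Suc m) * pair_energy kern_dist (Suc m) w)" .
  qed
  also have "\<dots> \<le> (\<Sum>w\<in>stray_maps (Suc m). exp (- s (Suc m) * pair_energy kern_dist (Suc m) w))"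
    by (rule sum_mono2[OF fins W]) auto
  also have "\<dots> = card (carrier G) ^ Suc m * error_sum s (Suc m)"
    using N_pos by (simp add: error_sum_def)
  finally show ?thesis .
qed

lemma main_map_weight:
  assumes "isotropic (w ` {..<n})"
  shows "(\<Prod>e\<in>possible_edges n. of_real (1 - q) + of_real q * edge_kern w e) = 1"
proof (rule prod.neutral, rule ballI)
  fix e assume "e \<in> possible_edges n"
  then have "edge_kern w e = 1"
    using assms by (auto simp: edge_kern_def isotropic_def elim!: possible_edgesE)
  then show "of_real (1 - q) + of_real q * edge_kern w e = 1" by simp
qed

lemma card_rooted_surjections:
  assumes fin: "finite (carrier G)"
  defines "N \<equiv> card (carrier G)"
  shows "card (rooted_surjections m) \<le> N ^ m" "N ^ m \<le> card (rooted_surjections m) + N * (N - 1) ^ m"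
proof -
  define X where "X = {g \<in> {..<m} \<rightarrow>\<^sub>E carrier G. insert \<one> (g ` {..<m}) = carrier G}"
  have "bij_betw (\<lambda>f. restrict f {..<m}) (rooted_surjections m) X"
  proof (rule bij_betwI[of _ _ _ "\<lambda>g. \<lambda>i\<in>{..<Suc m}. if i = m then \<one> else g i"])
    show "(\<lambda>f. restrict f {..<m}) \<in> rooted_surjections m \<rightarrow> X"
      by (auto simp: rooted_surjections_def X_def lessThan_Suc PiE_iff)
    show "(\<lambda>g. \<lambda>i\<in>{..<Suc m}. if i = m then \<one> else g i) \<in> X \<rightarrow> rooted_surjections m"
    proof
      fix g assume g: "g \<in> X"
      let ?f = "\<lambda>i\<in>{..<Suc m}. if i = m then \<one> else g i"
      have "?f ` {..<Suc m} = insert (?f m) (?f ` {..<m})" by (simp only: lessThan_Suc image_insert)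
      also have "?f ` {..<m} = g ` {..<m}" by (rule image_cong) auto
      also have "insert (?f m) (g ` {..<m}) = carrier G" using g by (simp add: X_def)
      finally show "?f \<in> rooted_surjections m"
        using g by (auto simp: rooted_surjections_def X_def PiE_iff)
    qed
    show "(\<lambda>i\<in>{..<Suc m}. if i = m then \<one> else restrict f {..<m} i) = f" if "f \<in> rooted_surjections m" for f
      using that by (auto simp: rooted_surjections_def fun_eq_iff PiE_iff extensional_def)
    show "restrict (\<lambda>i\<in>{..<Suc m}. if i = m then \<one> else g i) {..<m} = g" if "g \<in> X" for g
      using that by (auto simp: X_def fun_eq_iff PiE_iff extensional_def)
  qed
  then have c: "card (rooted_surjections m) = card X" by (rule bij_betw_same_card)
  have finP: "finite ({..<m} \<rightarrow>\<^sub>E carrier G)" using fin by (intro finite_PiE) auto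
  have X: "X \<subseteq> {..<m} \<rightarrow>\<^sub>E carrier G" by (auto simp: X_def)
  have cP: "card ({..<m} \<rightarrow>\<^sub>E carrier G) = N ^ m" by (simp add: card_PiE N_def)
  show "card (rooted_surjections m) \<le> N ^ m" using card_mono[OF finP X] by (simp add: c cP)
  have "({..<m} \<rightarrow>\<^sub>E carrier G) - X \<subseteq> (\<Union>x\<in>carrier G. {..<m} \<rightarrow>\<^sub>E (carrier G - {x}))"
  proof
    fix g assume g: "g \<in> ({..<m} \<rightarrow>\<^sub>E carrier G) - X"
    then have "insert \<one> (g ` {..<m}) \<noteq> carrier G" "insert \<one> (g ` {..<m}) \<subseteq> carrier G"
      by (auto simp: X_def)
    then obtain x where "x \<in> carrier G" "x \<notin> g ` {..<m}" by blast
    then show "g \<in> (\<Union>x\<in>carrier G. {..<m} \<rightarrow>\<^sub>E (carrier G - {x}))"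
      using g by (intro UN_I[of x]) (auto simp: PiE_iff)
  qed
  then have "card (({..<m} \<rightarrow>\<^sub>E carrier G) - X) \<le> card (\<Union>x\<in>carrier G. {..<m} \<rightarrow>\<^sub>E (carrier G - {x}))"
    using fin by (intro card_mono) (auto intro!: finite_PiE)
  also have "\<dots> \<le> (\<Sum>x\<in>carrier G. card ({..<m} \<rightarrow>\<^sub>E (carrier G - {x})))"
    by (rule card_UN_le[OF fin])
  also have "\<dots> = (\<Sum>x\<in>carrier G. (N - 1) ^ m)"
    using fin by (intro sum.cong refl) (simp add: card_PiE N_def)
  also have "\<dots> = N * (N - 1) ^ m" by (simp add: N_def)
  finally show "N ^ m \<le> card (rooted_surjections m) + N * (N - 1) ^ m"
    using card_Diff_subset[OF finite_subset[OF X finP] X] by (simp add: c cP)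
qed

lemma rooted_surjections_ratio:
  assumes fin: "finite (carrier G)"
  shows "(\<lambda>m. card (rooted_surjections m) / real (card (carrier G)) ^ m) \<longlonglongrightarrow> 1"
proof -
  let ?N = "card (carrier G)"
  have N: "?N > 0" using fin by (auto simp: card_gt_0_iff)
  define r where "r = real (?N - 1) / ?N"
  have r: "0 \<le> r" "r < 1" using N by (auto simp: r_def)
  show ?thesis
  proof (rule tendsto_sandwich[OF _ _ _ tendsto_const])
    have "(\<lambda>m. 1 - ?N * r ^ m) \<longlonglongrightarrow> 1 - real ?N * 0"
      by (intro tendsto_diff tendsto_mult tendsto_const LIMSEQ_realpow_zero r)
    then show "(\<lambda>m. 1 - ?N * r ^ m) \<longlonglongrightarrow> 1" by simp
    have "1 - ?N * r ^ m \<le> card (rooted_surjections m) / real ?N ^ m" for m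
    proof -
      have "real (?N ^ m) \<le> real (card (rooted_surjections m) + ?N * (?N - 1) ^ m)"
        by (intro of_nat_mono card_rooted_surjections(2)[OF fin])
      then have "real ?N ^ m - ?N * real (?N - 1) ^ m \<le> card (rooted_surjections m)" by simp
      then have "(real ?N ^ m - ?N * real (?N - 1) ^ m) / real ?N ^ m \<le> card (rooted_surjections m) / real ?N ^ m"
        by (rule divide_right_mono) simp
      moreover have "(real ?N ^ m - ?N * real (?N - 1) ^ m) / real ?N ^ m = 1 - ?N * r ^ m"
        by (simp only: r_def power_divide diff_divide_distrib) (use N in simp)
      ultimately show ?thesis by simp
    qed
    then show "\<forall>\<^sub>F m in sequentially. 1 - ?N * r ^ m \<le> card (rooted_surjections m) / real ?N ^ m" by simp
    have "card (rooted_surjections m) / real ?N ^ m \<le> 1" for m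
    proof -
      have "real (card (rooted_surjections m)) \<le> real (?N ^ m)"
        by (intro of_nat_mono card_rooted_surjections(1)[OF fin])
      then show ?thesis using N by simp
    qed
    then show "\<forall>\<^sub>F m in sequentially. card (rooted_surjections m) / real ?N ^ m \<le> 1" by simp
  qed
qed

section \<open>Generating maps that are not main maps\<close>

lemma generate_remove_one:
  assumes "A \<subseteq> carrier G"
  shows "generate G (insert \<one> A) = generate G A"
proof
  show "generate G A \<subseteq> generate G (insert \<one> A)" by (intro mono_generate) auto
  show "generate G (insert \<one> A) \<subseteq> generate G A"
    using assms generate_is_subgroup[OF assms] generate.one[of G A] generate.incl[of _ A G]
    by (intro generate_subgroup_incl) auto
qed

definition generating_maps :: "nat \<Rightarrow> (nat \<Rightarrow> 'a \<times> ('a \<Rightarrow> complex)) set" where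
  "generating_maps m = {w \<in> rooted_maps m. generate G (fst ` w ` {..<m}) = carrier G}"

lemma rooted_image: 
  assumes "w \<in> rooted_maps m"
  shows "fst ` w ` {..<Suc m} = insert \<one> (fst ` w ` {..<m})" "fst ` w ` {..<m} \<subseteq> carrier G"
proof -
  show "fst ` w ` {..<Suc m} = insert \<one> (fst ` w ` {..<m})"
    using assms by (simp add: lessThan_Suc rooted_maps_def)
  have "w i \<in> phase_space G" if "i < m" for i
    using assms that by (auto simp: rooted_maps_def PiE_iff)
  then have "fst (w i) \<in> carrier G" if "i < m" for i using that phase_spaceD(1) by blast
  then show "fst ` w ` {..<m} \<subseteq> carrier G" by auto
qed

lemma main_maps_subset: "main_maps m \<subseteq> generating_maps m"
proof
  fix w assume w: "w \<in> main_maps m"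
  then have r: "w \<in> rooted_maps m" by (simp add: main_maps_def)
  have "generate G (fst ` w ` {..<m}) = generate G (fst ` w ` {..<Suc m})"
    using rooted_image[OF r] generate_remove_one by simp
  also have "\<dots> = carrier G"
    using w generate_incl[of "carrier G"] generate.incl[of _ "carrier G" G] by (auto simp: main_maps_def)
  finally show "w \<in> generating_maps m" using r by (simp add: generating_maps_def)
qed

text \<open>A map that is not stray lies in a maximal null set. If it filled out that set,
  \<open>isotropic_generating\<close> would make it a main map; hence it misses a value.\<close>

lemma nonmain_generating_cover:
  assumes fin: "finite (carrier G)"
  defines "mn \<equiv> energy_kernel.max_null (phase_space G) kern_dist (card (carrier G))"
  shows "generating_maps m - main_maps m \<subseteq>
    energy_kernel.stray_maps (phase_space G) kern_dist (card (carrier G)) (Suc m) \<union>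
    (\<Union>U\<in>mn. \<Union>u\<in>U. {..<Suc m} \<rightarrow>\<^sub>E (U - {u}))"
proof
  interpret energy_kernel "phase_space G" kern_dist "card (carrier G)"
    by (rule energy_kernel_phase_space[OF fin])
  fix w assume w: "w \<in> generating_maps m - main_maps m"
  then have r: "w \<in> rooted_maps m" and gen: "generate G (fst ` w ` {..<m}) = carrier G"
    by (auto simp: generating_maps_def)
  have wV: "w \<in> {..<Suc m} \<rightarrow>\<^sub>E phase_space G" using r by (simp add: rooted_maps_def)
  show "w \<in> stray_maps (Suc m) \<union> (\<Union>U\<in>mn. \<Union>u\<in>U. {..<Suc m} \<rightarrow>\<^sub>E (U - {u}))"
  proof (cases "w \<in> stray_maps (Suc m)")
    case False
    then obtain U where U: "U \<in> max_null" "w ` {..<Suc m} \<subseteq> U" using wV by (auto simp: stray_maps_def)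
    then have UV: "U \<subseteq> phase_space G" "card U = card (carrier G)" by (auto simp: max_null_def)
    have iso: "isotropic U" using U kern_dist_eq_0_iff UV unfolding isotropic_def max_null_def by blast
    have "w ` {..<Suc m} \<noteq> U"
    proof
      assume eq: "w ` {..<Suc m} = U"
      have "generate G (fst ` U) = carrier G"
        using gen rooted_image[OF r] generate_remove_one eq by metis
      moreover have "\<one> \<in> fst ` U" using rooted_image[OF r] eq by auto
      ultimately have "fst ` U = carrier G" using isotropic_generating[OF fin UV(1) iso UV(2)] by blast
      then have "w \<in> main_maps m" using r iso eq by (simp add: main_maps_def)
      then show False using w by blast
    qed
    then obtain u where "u \<in> U" "u \<notin> w ` {..<Suc m}" using U by blast
    then have "w \<in> {..<Suc m} \<rightarrow>\<^sub>E (U - {u})" using U(2) wV by (auto simp: PiE_iff)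
    then show ?thesis using U(1) \<open>u \<in> U\<close> unfolding mn_def by blast
  qed simp
qed

lemma card_nonsurjective_into_max_null:
  assumes fin: "finite (carrier G)"
  defines "mn \<equiv> energy_kernel.max_null (phase_space G) kern_dist (card (carrier G))"
    and "N \<equiv> card (carrier G)"
  shows "finite (\<Union>U\<in>mn. \<Union>u\<in>U. {..<n::nat} \<rightarrow>\<^sub>E (U - {u}))"
    "card (\<Union>U\<in>mn. \<Union>u\<in>U. {..<n::nat} \<rightarrow>\<^sub>E (U - {u})) \<le> card mn * (N * (N - 1) ^ n)"
proof -
  interpret energy_kernel "phase_space G" kern_dist "card (carrier G)"
    by (rule energy_kernel_phase_space[OF fin])
  have finmn: "finite mn"
    by (rule finite_subset[of _ "Pow (phase_space G)"]) (auto simp: mn_def max_null_def finite_V)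
  have U: "finite U" "card U = N" if "U \<in> mn" for U
    using that finite_V by (auto simp: mn_def max_null_def N_def intro: finite_subset)
  show "finite (\<Union>U\<in>mn. \<Union>u\<in>U. {..<n} \<rightarrow>\<^sub>E (U - {u}))"
    using finmn U by (auto intro!: finite_PiE)
  have "card (\<Union>U\<in>mn. \<Union>u\<in>U. {..<n} \<rightarrow>\<^sub>E (U - {u})) \<le> (\<Sum>U\<in>mn. card (\<Union>u\<in>U. {..<n} \<rightarrow>\<^sub>E (U - {u})))"
    by (rule card_UN_le[OF finmn])
  also have "\<dots> \<le> (\<Sum>U\<in>mn. \<Sum>u\<in>U. card ({..<n} \<rightarrow>\<^sub>E (U - {u})))"
    by (intro sum_mono card_UN_le U)
  also have "\<dots> = (\<Sum>U\<in>mn. \<Sum>u\<in>U. (N - 1) ^ n)"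
    by (intro sum.cong refl) (simp add: card_PiE U)
  also have "\<dots> = card mn * (N * (N - 1) ^ n)" by (simp add: U)
  finally show "card (\<Union>U\<in>mn. \<Union>u\<in>U. {..<n} \<rightarrow>\<^sub>E (U - {u})) \<le> card mn * (N * (N - 1) ^ n)" .
qed

end

section \<open>Limit and boundedness of the moments\<close>

abbreviation expected_surs :: "('a, 'b) monoid_scheme \<Rightarrow> nat \<Rightarrow> real \<Rightarrow> real" where
  "expected_surs G n q \<equiv> measure_pmf.expectation (erdos_renyi n q)
     (\<lambda>E. real (card (coker_surs G (reduced_laplacian n E))))"

abbreviation expected_homs :: "('a, 'b) monoid_scheme \<Rightarrow> nat \<Rightarrow> real \<Rightarrow> real" where
  "expected_homs G n q \<equiv> measure_pmf.expectation (erdos_renyi n q)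
     (\<lambda>E. real (card (coker_homs G (reduced_laplacian n E))))"

text \<open>The lower bound is put on the edge variance q (1 - q), the quantity that appears in
  \<open>norm_one_minus_plus_le\<close>.\<close>

definition dense_enough :: "real \<Rightarrow> (nat \<Rightarrow> real) \<Rightarrow> bool" where
  "dense_enough c q \<longleftrightarrow> c > 1 \<and>
     (\<forall>\<^sub>F n in sequentially. 0 \<le> q n \<and> q n \<le> 1 \<and> c * ln (real n) / real n \<le> q n * (1 - q n))"

context comm_group
begin

lemma expected_surs_bound:
  assumes fin: "finite (carrier G)" and q: "0 \<le> q" "q \<le> 1" and s: "s (Suc m) \<le> q * (1 - q)"
  defines "mn \<equiv> energy_kernel.max_null (phase_space G) kern_dist (card (carrier G))"
    and "N \<equiv> card (carrier G)"
  shows "\<bar>expected_surs G (Suc m) q - card (main_maps m) / real N ^ m\<bar> \<le>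
    N * error_sum s (Suc m) + card mn * N * N * (real (N - 1) / N) ^ Suc m"
proof -
  interpret energy_kernel "phase_space G" kern_dist "card (carrier G)"
    by (rule energy_kernel_phase_space[OF fin])
  have N: "N > 0" using N_pos by (simp add: N_def)
  let ?g = "\<lambda>w. \<Prod>e\<in>possible_edges (Suc m). of_real (1 - q) + of_real q * edge_kern w e"
  have coker: "coker_surs G (reduced_laplacian (Suc m) E) =
    {f \<in> coker_homs G (reduced_laplacian (Suc m) E). generate G (f ` {..<m}) = carrier G}" for E
    by (simp add: coker_surs_def)
  have eq: "complex_of_real (expected_surs G (Suc m) q) = (\<Sum>w\<in>generating_maps m. ?g w) / of_nat N ^ m"
    unfolding coker N_def generating_maps_def
    by (rule moment_fourier[OF fin q, of _ "\<lambda>A. generate G A = carrier G"])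
  have fing: "finite (generating_maps m)"
    by (rule finite_subset[of _ "{..<Suc m} \<rightarrow>\<^sub>E phase_space G"])
       (auto simp: generating_maps_def rooted_maps_def intro!: finite_PiE finite_V)
  have main: "(\<Sum>w\<in>main_maps m. ?g w) = of_nat (card (main_maps m))"
  proof -
    have "(\<Sum>w\<in>main_maps m. ?g w) = (\<Sum>w\<in>main_maps m. 1)"
      by (rule sum.cong[OF refl]) (rule main_map_weight, simp add: main_maps_def)
    then show ?thesis by simp
  qed
  define R where "R = generating_maps m - main_maps m"
  define S where "S = stray_maps (Suc m)"
  define T where "T = (\<Union>U\<in>mn. \<Union>u\<in>U. {..<Suc m} \<rightarrow>\<^sub>E (U - {u}))"
  have cover: "R \<subseteq> S \<union> T"
    using nonmain_generating_cover[OF fin, of m] by (simp add: R_def S_def T_def mn_def)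
  have finR: "finite R" using fing by (simp add: R_def)
  have cT: "card T \<le> card mn * (N * (N - 1) ^ Suc m)" and finT: "finite T"
    using card_nonsurjective_into_max_null[OF fin, of "Suc m"] by (simp_all add: T_def mn_def N_def)
  have "(\<Sum>w\<in>generating_maps m. ?g w) = (\<Sum>w\<in>R. ?g w) + of_nat (card (main_maps m))"
    unfolding R_def main[symmetric] by (rule sum.subset_diff[OF main_maps_subset fing])
  also have "(\<Sum>w\<in>R. ?g w) = (\<Sum>w\<in>R - S. ?g w) + (\<Sum>w\<in>R \<inter> S. ?g w)"
    using sum.Int_Diff[OF finR, of ?g S] by (simp add: add.commute)
  finally have split: "(\<Sum>w\<in>generating_maps m. ?g w) =
    (\<Sum>w\<in>R - S. ?g w) + (\<Sum>w\<in>R \<inter> S. ?g w) + of_nat (card (main_maps m))" .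
  have b1: "norm (\<Sum>w\<in>R \<inter> S. ?g w) \<le> N ^ Suc m * error_sum s (Suc m)"
    unfolding N_def by (rule sum_norm_stray_le[where s = s and m = m, OF fin q s]) (auto simp: S_def)
  \<comment> \<open>These maps may have no energy at all, but they miss a value of a maximal null
    set, and already their number is small against |G|^n.\<close>
  have b2: "norm (\<Sum>w\<in>R - S. ?g w) \<le> card T"
  proof -
    have "norm (\<Sum>w\<in>R - S. ?g w) \<le> (\<Sum>w\<in>R - S. 1)"
    proof (rule sum_norm_le)
      fix w assume "w \<in> R - S"
      then have w: "w \<in> {..<Suc m} \<rightarrow>\<^sub>E phase_space G"
        by (auto simp: R_def generating_maps_def rooted_maps_def)
      have "norm (?g w) \<le> exp (- (q * (1 - q)) * pair_energy kern_dist (Suc m) w)"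
        by (rule norm_prod_edges_le[OF w q])
      also have "\<dots> \<le> 1" using pair_energy_nonneg[OF w] q by (simp add: mult_nonneg_nonneg)
      finally show "norm (?g w) \<le> 1" .
    qed
    also have "\<dots> \<le> card T" using cover by (simp add: card_mono[OF finT] Diff_subset_conv)
    finally show ?thesis .
  qed
  have "\<bar>expected_surs G (Suc m) q - card (main_maps m) / real N ^ m\<bar> =
    norm (complex_of_real (expected_surs G (Suc m) q) - of_nat (card (main_maps m)) / of_nat N ^ m)"
    by (simp add: norm_of_real[symmetric, where 'a = complex] del: norm_of_real)
  also have "\<dots> = norm ((\<Sum>w\<in>R - S. ?g w) + (\<Sum>w\<in>R \<inter> S. ?g w)) / real N ^ m"
    unfolding eq split diff_divide_distrib[symmetric] by (simp add: norm_divide norm_power)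
  also have "\<dots> \<le> (card T + N ^ Suc m * error_sum s (Suc m)) / real N ^ m"
    using b1 b2 by (intro divide_right_mono norm_triangle_le add_mono) auto
  also have "\<dots> \<le> (card mn * (N * (N - 1) ^ Suc m) + N ^ Suc m * error_sum s (Suc m)) / real N ^ m"
    using cT by (intro divide_right_mono add_right_mono) (auto simp flip: of_nat_mult of_nat_power)
  also have "\<dots> = N * error_sum s (Suc m) + card mn * N * N * (real (N - 1) / N) ^ Suc m"
    using N by (simp add: field_simps power_divide)
  finally show ?thesis .
qed

theorem expected_surs_tendsto:
  assumes fin: "finite (carrier G)" and q: "dense_enough c q"
  shows "(\<lambda>n. expected_surs G n (q n)) \<longlonglongrightarrow> card (alt_bichars G)"
proof (rule LIMSEQ_imp_Suc, rule Lim_transform)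
  let ?N = "card (carrier G)" and ?s = "\<lambda>n. c * ln (real n) / real n"
  let ?mn = "energy_kernel.max_null (phase_space G) kern_dist (card (carrier G))"
  have N: "?N > 0" using fin by (auto simp: card_gt_0_iff)
  have "(\<lambda>m. card (rooted_surjections m) / real ?N ^ m * card (alt_bichars G)) \<longlonglongrightarrow> 1 * real (card (alt_bichars G))"
    by (intro tendsto_mult rooted_surjections_ratio[OF fin] tendsto_const)
  then show "(\<lambda>m. card (main_maps m) / real ?N ^ m) \<longlonglongrightarrow> card (alt_bichars G)"
    by (simp add: card_main_maps)
  have ev: "\<forall>\<^sub>F m in sequentially. 0 \<le> q (Suc m) \<and> q (Suc m) \<le> 1 \<and> ?s (Suc m) \<le> q (Suc m) * (1 - q (Suc m))"
    using q unfolding dense_enough_def by (subst eventually_sequentially_Suc) auto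
  have err: "(\<lambda>m. ?N * error_sum ?s (Suc m) + card ?mn * ?N * ?N * (real (?N - 1) / ?N) ^ Suc m)
    \<longlonglongrightarrow> real ?N * 0 + real (card ?mn * ?N * ?N) * 0"
  proof (intro tendsto_add tendsto_mult tendsto_const)
    show "(\<lambda>m. error_sum ?s (Suc m)) \<longlonglongrightarrow> 0"
      using error_sum_tendsto[OF fin] q by (subst filterlim_sequentially_Suc) (auto simp: dense_enough_def)
    show "(\<lambda>m. (real (?N - 1) / ?N) ^ Suc m) \<longlonglongrightarrow> 0"
      using N by (subst filterlim_sequentially_Suc) (intro LIMSEQ_realpow_zero, auto)
  qed
  show "(\<lambda>m. expected_surs G (Suc m) (q (Suc m)) - card (main_maps m) / real ?N ^ m) \<longlonglongrightarrow> 0"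
  proof (rule Lim_null_comparison)
    show "\<forall>\<^sub>F m in sequentially. norm (expected_surs G (Suc m) (q (Suc m)) - card (main_maps m) / real ?N ^ m) \<le>
      ?N * error_sum ?s (Suc m) + card ?mn * ?N * ?N * (real (?N - 1) / ?N) ^ Suc m"
      using ev
    proof eventually_elim
      case (elim m)
      then show ?case using expected_surs_bound[OF fin, of "q (Suc m)" ?s m] by simp
    qed
  qed (use err in simp)
qed

text \<open>Without the generating condition, each maximal null set contributes up to |G|^n maps of
  weight at most 1, hence at most |G| after the normalisation. The bound serves to control what
  happens on the rare singular matrices.\<close>

theorem expected_homs_bounded:
  assumes fin: "finite (carrier G)" and q: "dense_enough c q"
  shows "\<exists>B. \<forall>\<^sub>F n in sequentially. expected_homs G n (q n) \<le> B"
proof -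
  interpret energy_kernel "phase_space G" kern_dist "card (carrier G)"
    by (rule energy_kernel_phase_space[OF fin])
  let ?N = "card (carrier G)" and ?s = "\<lambda>n. c * ln (real n) / real n"
  have finmn: "finite max_null"
    by (rule finite_subset[of _ "Pow (phase_space G)"]) (auto simp: max_null_def finite_V)
  have bound: "expected_homs G (Suc m) q' \<le> ?N * error_sum ?s (Suc m) + card max_null * ?N"
    if q': "0 \<le> q'" "q' \<le> 1" "?s (Suc m) \<le> q' * (1 - q')" for m q'
  proof -
    let ?g = "\<lambda>w. \<Prod>e\<in>possible_edges (Suc m). of_real (1 - q') + of_real q' * edge_kern w e"
    define S where "S = stray_maps (Suc m)"
    have eq: "complex_of_real (expected_homs G (Suc m) q') = (\<Sum>w\<in>rooted_maps m. ?g w) / of_nat ?N ^ m"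
      using moment_fourier[OF fin q'(1,2), of m "\<lambda>_. True"] by simp
    have finr: "finite (rooted_maps m)"
      by (rule finite_subset[of _ "{..<Suc m} \<rightarrow>\<^sub>E phase_space G"])
         (auto simp: rooted_maps_def intro!: finite_PiE finite_V)
    have sub: "rooted_maps m - S \<subseteq> (\<Union>U\<in>max_null. {..<Suc m} \<rightarrow>\<^sub>E U)"
    proof
      fix w assume w: "w \<in> rooted_maps m - S"
      then have wV: "w \<in> {..<Suc m} \<rightarrow>\<^sub>E phase_space G" by (simp add: rooted_maps_def)
      then obtain U where "U \<in> max_null" "w ` {..<Suc m} \<subseteq> U" using w by (auto simp: S_def stray_maps_def)
      then show "w \<in> (\<Union>U\<in>max_null. {..<Suc m} \<rightarrow>\<^sub>E U)" using wV by (intro UN_I[of U]) (auto simp: PiE_iff)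
    qed
    have finU: "finite U" "card U = ?N" if "U \<in> max_null" for U
      using that finite_V by (auto simp: max_null_def intro: finite_subset)
    have "card (rooted_maps m - S) \<le> card (\<Union>U\<in>max_null. {..<Suc m} \<rightarrow>\<^sub>E U)"
      using finmn finU by (intro card_mono[OF _ sub]) (auto intro!: finite_PiE)
    also have "\<dots> \<le> (\<Sum>U\<in>max_null. card ({..<Suc m} \<rightarrow>\<^sub>E U))" by (rule card_UN_le[OF finmn])
    also have "\<dots> = card max_null * ?N ^ Suc m" by (simp add: card_PiE finU)
    finally have c: "card (rooted_maps m - S) \<le> card max_null * ?N ^ Suc m" .
    have b1: "norm (\<Sum>w\<in>rooted_maps m \<inter> S. ?g w) \<le> ?N ^ Suc m * error_sum ?s (Suc m)"
      by (rule sum_norm_stray_le[where s = ?s and m = m, OF fin q']) (auto simp: S_def)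
    have b2: "norm (\<Sum>w\<in>rooted_maps m - S. ?g w) \<le> (\<Sum>w\<in>rooted_maps m - S. 1)"
    proof (rule sum_norm_le)
      fix w assume "w \<in> rooted_maps m - S"
      then have w: "w \<in> {..<Suc m} \<rightarrow>\<^sub>E phase_space G" by (auto simp: rooted_maps_def)
      have "norm (?g w) \<le> exp (- (q' * (1 - q')) * pair_energy kern_dist (Suc m) w)"
        by (rule norm_prod_edges_le[OF w q'(1,2)])
      also have "\<dots> \<le> 1" using pair_energy_nonneg[OF w] q' by (simp add: mult_nonneg_nonneg)
      finally show "norm (?g w) \<le> 1" .
    qed
    have "expected_homs G (Suc m) q' \<le> norm (complex_of_real (expected_homs G (Suc m) q'))"
      unfolding norm_of_real by (rule abs_ge_self)
    also have "\<dots> = norm ((\<Sum>w\<in>rooted_maps m \<inter> S. ?g w) + (\<Sum>w\<in>rooted_maps m - S. ?g w)) / real ?N ^ m"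
      unfolding eq by (simp add: sum.Int_Diff[OF finr, symmetric] norm_divide norm_power)
    also have "\<dots> \<le> (?N ^ Suc m * error_sum ?s (Suc m) + card max_null * ?N ^ Suc m) / real ?N ^ m"
    proof (intro divide_right_mono norm_triangle_le add_mono b1)
      show "norm (\<Sum>w\<in>rooted_maps m - S. ?g w) \<le> card max_null * ?N ^ Suc m"
        using b2 c by (simp flip: of_nat_mult of_nat_power)
    qed simp
    also have "\<dots> = ?N * error_sum ?s (Suc m) + card max_null * ?N"
      using N_pos by (simp add: field_simps)
    finally show ?thesis .
  qed
  have "error_sum ?s \<longlonglongrightarrow> 0" using error_sum_tendsto[OF fin] q by (auto simp: dense_enough_def)
  then have "\<forall>\<^sub>F n in sequentially. error_sum ?s n < 1" by (rule order_tendstoD) simp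
  moreover have "\<forall>\<^sub>F n in sequentially. 0 \<le> q n \<and> q n \<le> 1 \<and> ?s n \<le> q n * (1 - q n)"
    using q by (simp add: dense_enough_def)
  moreover note eventually_ge_at_top[of 1]
  ultimately have "\<forall>\<^sub>F n in sequentially. expected_homs G n (q n) \<le> ?N + card max_null * ?N"
  proof eventually_elim
    case (elim n)
    then obtain m where n: "n = Suc m" by (cases n) auto
    have "expected_homs G n (q n) \<le> ?N * error_sum ?s n + card max_null * ?N"
      unfolding n by (rule bound) (use elim n in auto)
    also have "?N * error_sum ?s n \<le> real ?N * 1" using elim by (intro mult_left_mono) auto
    finally show ?case by simp
  qed
  then show ?thesis by blast
qed

end

section \<open>The exterior square\<close>

lemma FactGroup_lift:
  assumes A: "comm_group A" and R: "subgroup R A" and B: "group B"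
    and h: "h \<in> hom A B" "\<And>r. r \<in> R \<Longrightarrow> h r = \<one>\<^bsub>B\<^esub>"
  obtains g where "g \<in> hom (A Mod R) B" "\<And>x. x \<in> carrier A \<Longrightarrow> g (R #>\<^bsub>A\<^esub> x) = h x"
proof -
  interpret A: comm_group A by (rule A)
  interpret B: group B by (rule B)
  interpret R: subgroup R A by (rule R)
  have "R \<lhd> A" using R by (simp add: A.normal_iff_subgroup)
  moreover have "h x = h y" if xy: "x \<in> carrier A" "y \<in> carrier A" "R #>\<^bsub>A\<^esub> x = R #>\<^bsub>A\<^esub> y" for x y
  proof -
    have "x \<in> R #>\<^bsub>A\<^esub> y" using A.rcos_self[OF xy(1) R] xy by simp
    then obtain r where r: "r \<in> R" "x = r \<otimes>\<^bsub>A\<^esub> y" by (auto simp: r_coset_def)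
    have "h y \<in> carrier B" using hom_in_carrier[OF h(1) xy(2)] .
    then show ?thesis using r xy h(2) hom_mult[OF h(1), of r y] by simp
  qed
  ultimately show ?thesis using FactGroup_universal[OF h(1)] that by metis
qed

lemma hom_trivial_on_generate:
  assumes A: "group A" and B: "group B" and h: "h \<in> hom A B" and S: "S \<subseteq> carrier A"
    and triv: "\<And>s. s \<in> S \<Longrightarrow> h s = \<one>\<^bsub>B\<^esub>" and r: "r \<in> generate A S"
  shows "h r = \<one>\<^bsub>B\<^esub>"
proof -
  interpret group_hom A B h using A B h by (simp add: group_hom_def group_hom_axioms_def)
  have "generate A S \<subseteq> kernel A B h"
    by (rule G.generate_subgroup_incl[OF _ subgroup_kernel]) (use S triv in \<open>auto simp: kernel_def\<close>)
  then show ?thesis using r by (auto simp: kernel_def)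
qed

lemma hom_free_Abelian_group_diff:
  assumes B: "group B" and h: "h \<in> hom (free_Abelian_group S) B"
    and ab: "Poly_Mapping.keys a \<subseteq> S" "Poly_Mapping.keys b \<subseteq> S"
  shows "h (a - b) = h a \<otimes>\<^bsub>B\<^esub> inv\<^bsub>B\<^esub> (h b)"
proof -
  interpret group_hom "free_Abelian_group S" B h
    using B h by (simp add: group_hom_def group_hom_axioms_def)
  have "a - b = a \<otimes>\<^bsub>free_Abelian_group S\<^esub> inv\<^bsub>free_Abelian_group S\<^esub> b" using ab by simp
  then have "h (a - b) = h (a \<otimes>\<^bsub>free_Abelian_group S\<^esub> inv\<^bsub>free_Abelian_group S\<^esub> b)" by (rule arg_cong)
  also have "\<dots> = h a \<otimes>\<^bsub>B\<^esub> h (inv\<^bsub>free_Abelian_group S\<^esub> b)"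
    using ab by (intro hom_mult) auto
  also have "h (inv\<^bsub>free_Abelian_group S\<^esub> b) = inv\<^bsub>B\<^esub> (h b)" using ab by (intro hom_inv) simp
  finally show ?thesis .
qed

text \<open>Adjoining one generator multiplies the subgroup by a finite cyclic group. It serves for
  the finiteness of the exterior square, a quotient of an infinite group.\<close>

lemma (in comm_group) finite_generate_torsion:
  assumes "finite S" "S \<subseteq> carrier G" "N > (0::nat)" "\<And>x. x \<in> S \<Longrightarrow> x [^] N = \<one>"
  shows "finite (generate G S)"
  using assms
proof (induction S rule: finite_induct)
  case empty
  then show ?case by (simp add: generate_empty)
next
  case (insert x S)
  have x: "x \<in> carrier G" and S: "S \<subseteq> carrier G" using insert.prems by auto
  have "generate G {x} \<subseteq> (\<lambda>k. x [^] (k::int)) ` {0..<int N}"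
  proof
    fix y assume "y \<in> generate G {x}"
    then obtain k :: int where k: "y = x [^] k" using generate_pow[OF x] by auto
    have "x [^] int N = \<one>" using insert.prems by (simp add: int_pow_int)
    then have "x [^] (int N * (k div int N)) = \<one>" using x by (simp add: int_pow_pow[symmetric])
    then have "x [^] (int N * (k div int N) + k mod int N) = x [^] (k mod int N)"
      using int_pow_mult[OF x, of "int N * (k div int N)" "k mod int N"] x by simp
    then have "y = x [^] (k mod int N)" using k by simp
    then show "y \<in> (\<lambda>k. x [^] (k::int)) ` {0..<int N}" using insert.prems(2) by auto
  qed
  then have fx: "finite (generate G {x})" by (rule finite_subset) simp
  have sx: "subgroup (generate G {x}) G" and sS: "subgroup (generate G S) G"
    using x S by (auto intro!: generate_is_subgroup)
  have "generate G (insert x S) \<subseteq> generate G {x} <#> generate G S"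
  proof (rule generate_subgroup_incl)
    show "subgroup (generate G {x} <#> generate G S) G" by (rule mult_subgroups[OF sx sS])
    show "insert x S \<subseteq> generate G {x} <#> generate G S"
    proof
      fix y assume y: "y \<in> insert x S"
      then have yG: "y \<in> carrier G" using x S by auto
      from y consider "y = x" | "y \<in> S" by blast
      then show "y \<in> generate G {x} <#> generate G S"
      proof cases
        case 1
        have "y = y \<otimes> \<one>" using yG by simp
        moreover have "y \<in> generate G {x}" "\<one> \<in> generate G S"
          using 1 by (auto intro: generate.incl generate.one)
        ultimately show ?thesis unfolding set_mult_def by blast
      next
        case 2
        have "y = \<one> \<otimes> y" using yG by simp
        moreover have "\<one> \<in> generate G {x}" "y \<in> generate G S"
          using 2 by (auto intro: generate.incl generate.one)
        ultimately show ?thesis unfolding set_mult_def by blast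
      qed
    qed
  qed
  moreover have "finite (generate G {x} <#> generate G S)"
  proof -
    have "generate G {x} <#> generate G S = (\<lambda>(a, b). a \<otimes> b) ` (generate G {x} \<times> generate G S)"
      by (auto simp: set_mult_def)
    then show ?thesis using fx insert by auto
  qed
  ultimately show ?case by (rule finite_subset)
qed

locale exterior =
  fixes G :: "('a, 'b) monoid_scheme" (structure)
  assumes comm: "comm_group G" and fin: "finite (carrier G)"
begin

section \<open>The two quotients and the wedge map\<close>

sublocale comm_group G by (rule comm)

abbreviation F where "F \<equiv> free_Abelian_group (carrier G \<times> carrier G)"
abbreviation T where "T \<equiv> tensor_group G G"
abbreviation W where "W \<equiv> exterior_square G"

definition tensor_gens :: "('a \<times> 'a \<Rightarrow>\<^sub>0 int) set" where
  "tensor_gens = {frag_of (x \<otimes> x', y) - frag_of (x, y) - frag_of (x', y) | x x' y.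
         x \<in> carrier G \<and> x' \<in> carrier G \<and> y \<in> carrier G} \<union>
      {frag_of (x, y \<otimes> y') - frag_of (x, y) - frag_of (x, y') | x y y'.
         x \<in> carrier G \<and> y \<in> carrier G \<and> y' \<in> carrier G}"

definition R where "R = tensor_relations G G"
definition Q where "Q = generate T {pure_tensor G G g g | g. g \<in> carrier G}"

lemma F_comm: "comm_group F" by (rule abelian_free_Abelian_group)

lemma diff_carrier_F: "a \<in> carrier F \<Longrightarrow> b \<in> carrier F \<Longrightarrow> a - b \<in> carrier F"
  using keys_diff[of a b] by auto

lemma tensor_gens_carrier: "tensor_gens \<subseteq> carrier F"
  unfolding tensor_gens_def by (auto intro!: diff_carrier_F simp del: carrier_free_Abelian_group_iff)

lemma R_eq: "R = generate F tensor_gens"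
  by (simp add: R_def tensor_relations_def tensor_gens_def)

lemma R_subgroup: "subgroup R F"
  unfolding R_eq by (rule group.generate_is_subgroup[OF _ tensor_gens_carrier]) simp

lemma T_eq: "T = F Mod R" by (simp add: tensor_group_def R_def)

lemma T_comm: "comm_group T"
  unfolding T_eq by (rule comm_group.abelian_FactGroup[OF F_comm R_subgroup])

lemma pure_tensor_eq: "pure_tensor G G x y = R #>\<^bsub>F\<^esub> frag_of (x, y)"
  by (simp add: pure_tensor_def R_def)

lemma pure_tensor_carrier: "x \<in> carrier G \<Longrightarrow> y \<in> carrier G \<Longrightarrow> pure_tensor G G x y \<in> carrier T"
  unfolding pure_tensor_eq T_eq carrier_FactGroup by (intro imageI) simp

lemma Q_gens: "{pure_tensor G G g g | g. g \<in> carrier G} \<subseteq> carrier T"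
  using pure_tensor_carrier by auto

lemma Q_subgroup: "subgroup Q T"
  unfolding Q_def using T_comm Q_gens by (intro group.generate_is_subgroup) (auto simp: comm_group_def)

lemma W_eq: "W = T Mod Q" by (simp add: exterior_square_def Q_def)

lemma W_comm: "comm_group W"
  unfolding W_eq by (rule comm_group.abelian_FactGroup[OF T_comm Q_subgroup])

definition proj :: "('a \<times> 'a \<Rightarrow>\<^sub>0 int) \<Rightarrow> ('a \<times> 'a \<Rightarrow>\<^sub>0 int) set set" where
  "proj u = Q #>\<^bsub>T\<^esub> (R #>\<^bsub>F\<^esub> u)"

lemma proj_hom: "proj \<in> hom F W"
proof -
  have "(\<lambda>u. R #>\<^bsub>F\<^esub> u) \<in> hom F T" unfolding T_eq
    using comm_group.normal_iff_subgroup[OF F_comm] R_subgroup by (intro normal.r_coset_hom_Mod) simp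
  moreover have "(\<lambda>u. Q #>\<^bsub>T\<^esub> u) \<in> hom T W" unfolding W_eq
    using comm_group.normal_iff_subgroup[OF T_comm] Q_subgroup by (intro normal.r_coset_hom_Mod) simp
  ultimately show ?thesis unfolding proj_def[abs_def]
    using Group.hom_compose[of "\<lambda>u. R #>\<^bsub>F\<^esub> u" F T "\<lambda>u. Q #>\<^bsub>T\<^esub> u" W] by (simp add: comp_def)
qed

lemma proj_onto: "carrier W = proj ` carrier F"
  unfolding W_eq carrier_FactGroup T_eq proj_def[abs_def] by (simp add: image_image)

definition wedge where "wedge x y = proj (frag_of (x, y))"

lemma wedge_carrier: "x \<in> carrier G \<Longrightarrow> y \<in> carrier G \<Longrightarrow> wedge x y \<in> carrier W"
  unfolding wedge_def by (rule hom_in_carrier[OF proj_hom]) simp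

lemma proj_relation:
  assumes "r \<in> R" shows "proj r = \<one>\<^bsub>W\<^esub>"
proof -
  have "R #>\<^bsub>F\<^esub> r = \<one>\<^bsub>T\<^esub>"
    using group.coset_join2[OF _ _ R_subgroup assms] subgroup.mem_carrier[OF R_subgroup assms]
    by (simp add: T_eq)
  moreover have "Q #>\<^bsub>T\<^esub> \<one>\<^bsub>T\<^esub> = \<one>\<^bsub>W\<^esub>"
    using group.coset_join2[OF _ _ Q_subgroup subgroup.one_closed[OF Q_subgroup]] T_comm
      subgroup.mem_carrier[OF Q_subgroup subgroup.one_closed[OF Q_subgroup]]
    by (simp add: W_eq comm_group_def)
  ultimately show ?thesis by (simp add: proj_def)
qed

lemma wedge_self: "x \<in> carrier G \<Longrightarrow> wedge x x = \<one>\<^bsub>W\<^esub>"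
proof -
  assume x: "x \<in> carrier G"
  have "pure_tensor G G x x \<in> Q" unfolding Q_def by (rule generate.incl) (use x in auto)
  then have "Q #>\<^bsub>T\<^esub> pure_tensor G G x x = Q"
    using group.coset_join2[OF _ _ Q_subgroup] T_comm pure_tensor_carrier[OF x x] by (auto simp: comm_group_def)
  then show ?thesis by (simp add: wedge_def proj_def pure_tensor_eq W_eq)
qed

text \<open>The bilinearity relations are differences of this shape in the free group; here they
  become equations in the quotient.\<close>

lemma proj_add3:
  assumes "a - b - c \<in> R" "b \<in> carrier F" "c \<in> carrier F"
  shows "proj a = proj b \<otimes>\<^bsub>W\<^esub> proj c"
proof -
  interpret W: comm_group W by (rule W_comm)
  have R: "a - b - c \<in> carrier F" by (rule subgroup.mem_carrier[OF R_subgroup assms(1)])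
  have bc: "b + c \<in> carrier F" using keys_add[of b c] assms by auto
  have "a = (a - b - c) + (b + c)" by simp
  then have "proj a = proj ((a - b - c) \<otimes>\<^bsub>F\<^esub> (b \<otimes>\<^bsub>F\<^esub> c))" by simp
  also have "\<dots> = proj (a - b - c) \<otimes>\<^bsub>W\<^esub> (proj b \<otimes>\<^bsub>W\<^esub> proj c)"
  proof -
    have "b \<otimes>\<^bsub>F\<^esub> c \<in> carrier F" using bc by (simp only: mult_free_Abelian_group)
    then show ?thesis using hom_mult[OF proj_hom R] hom_mult[OF proj_hom assms(2,3)] by metis
  qed
  also have "\<dots> = proj b \<otimes>\<^bsub>W\<^esub> proj c"
    using proj_relation[OF assms(1)] hom_in_carrier[OF proj_hom] assms by simp
  finally show ?thesis .
qed

lemma wedge_mult: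
  assumes "x \<in> carrier G" "y \<in> carrier G" "z \<in> carrier G"
  shows "wedge (x \<otimes> y) z = wedge x z \<otimes>\<^bsub>W\<^esub> wedge y z"
    and "wedge z (x \<otimes> y) = wedge z x \<otimes>\<^bsub>W\<^esub> wedge z y"
proof -
  have "frag_of (x \<otimes> y, z) - frag_of (x, z) - frag_of (y, z) \<in> tensor_gens"
    "frag_of (z, x \<otimes> y) - frag_of (z, x) - frag_of (z, y) \<in> tensor_gens"
    unfolding tensor_gens_def using assms by blast+
  then have R: "frag_of (x \<otimes> y, z) - frag_of (x, z) - frag_of (y, z) \<in> R"
    "frag_of (z, x \<otimes> y) - frag_of (z, x) - frag_of (z, y) \<in> R"
    unfolding R_eq by (auto intro: generate.incl)
  show "wedge (x \<otimes> y) z = wedge x z \<otimes>\<^bsub>W\<^esub> wedge y z"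
    unfolding wedge_def by (rule proj_add3[OF R(1)]) (use assms in auto)
  show "wedge z (x \<otimes> y) = wedge z x \<otimes>\<^bsub>W\<^esub> wedge z y"
    unfolding wedge_def by (rule proj_add3[OF R(2)]) (use assms in auto)
qed

lemma hom_eq_if_wedge_eq:
  assumes g: "g \<in> hom W B" "g' \<in> hom W B" "group B"
    and eq: "\<And>x y. x \<in> carrier G \<Longrightarrow> y \<in> carrier G \<Longrightarrow> g (wedge x y) = g' (wedge x y)"
    and w: "w \<in> carrier W"
  shows "g w = g' w"
proof -
  interpret B: group B by fact
  have gp: "(\<lambda>u. g (proj u)) \<in> hom F B" "(\<lambda>u. g' (proj u)) \<in> hom F B"
    using Group.hom_compose[OF proj_hom g(1)] Group.hom_compose[OF proj_hom g(2)] by (simp_all add: comp_def)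
  have "g (proj u) = g' (proj u)" if "Poly_Mapping.keys u \<subseteq> carrier G \<times> carrier G" for u
  proof (rule free_Abelian_group_induct[OF that])
    show "g (proj 0) = g' (proj 0)"
      using group_hom.hom_one[of F B "\<lambda>u. g (proj u)"] group_hom.hom_one[of F B "\<lambda>u. g' (proj u)"] gp
      by (simp add: group_hom_def group_hom_axioms_def \<open>group B\<close>)
    show "g (proj (x - y)) = g' (proj (x - y))"
      if "Poly_Mapping.keys x \<subseteq> carrier G \<times> carrier G" "Poly_Mapping.keys y \<subseteq> carrier G \<times> carrier G"
        "g (proj x) = g' (proj x)" "g (proj y) = g' (proj y)" for x y
      using hom_free_Abelian_group_diff[OF \<open>group B\<close> gp(1) that(1,2)]
        hom_free_Abelian_group_diff[OF \<open>group B\<close> gp(2) that(1,2)] that(3,4) by simp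
    show "g (proj (frag_of a)) = g' (proj (frag_of a))" if "a \<in> carrier G \<times> carrier G" for a
      using eq[of "fst a" "snd a"] that by (auto simp: wedge_def)
  qed
  moreover obtain u where "u \<in> carrier F" "w = proj u" using w proj_onto by auto
  ultimately show ?thesis by simp
qed

lemma wedge_pow:
  assumes "x \<in> carrier G" "y \<in> carrier G"
  shows "wedge (x [^] (n::nat)) y = wedge x y [^]\<^bsub>W\<^esub> n"
proof (induction n)
  case 0
  interpret W: comm_group W by (rule W_comm)
  have "wedge \<one> y \<otimes>\<^bsub>W\<^esub> wedge \<one> y = wedge \<one> y" using wedge_mult(1)[of \<one> \<one> y] assms by simp
  then have "wedge \<one> y = \<one>\<^bsub>W\<^esub>" using wedge_carrier[of \<one> y] assms W.r_cancel_one by blast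
  then show ?case by simp
next
  case (Suc n)
  then show ?case using wedge_mult(1)[of "x [^] n" x y] assms by simp
qed

text \<open>The wedges are finitely many generators, each killed by the order of G.\<close>

lemma finite_W: "finite (carrier W)"
proof -
  interpret W: comm_group W by (rule W_comm)
  let ?C = "(\<lambda>(x, y). wedge x y) ` (carrier G \<times> carrier G)"
  have C: "?C \<subseteq> carrier W" using wedge_carrier by auto
  have fg: "finite (generate W ?C)"
  proof (rule W.finite_generate_torsion[of _ "order G"])
    show "order G > 0" using fin by (simp add: order_gt_0_iff_finite)
    show "w [^]\<^bsub>W\<^esub> order G = \<one>\<^bsub>W\<^esub>" if "w \<in> ?C" for w
    proof -
      from that obtain x y where xy: "x \<in> carrier G" "y \<in> carrier G" "w = wedge x y" by auto
      have "w [^]\<^bsub>W\<^esub> order G = wedge \<one> y"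
        using wedge_pow[OF xy(1,2), of "order G"] xy pow_order_eq_1[OF xy(1)] by simp
      also have "\<dots> = \<one>\<^bsub>W\<^esub>" using wedge_pow[OF xy(1,2), of 0] by simp
      finally show ?thesis .
    qed
  qed (use fin C in auto)
  have sub: "subgroup (generate W ?C) W" by (rule W.generate_is_subgroup[OF C])
  have "carrier W \<subseteq> generate W ?C"
  proof
    fix w assume "w \<in> carrier W"
    then obtain u where u: "Poly_Mapping.keys u \<subseteq> carrier G \<times> carrier G" "w = proj u"
      using proj_onto by auto
    have "proj u \<in> generate W ?C"
    proof (rule free_Abelian_group_induct[OF u(1)])
      have "proj \<one>\<^bsub>F\<^esub> = \<one>\<^bsub>W\<^esub>"
        by (rule hom_one[OF proj_hom]) (simp_all add: W.is_group)
      then show "proj 0 \<in> generate W ?C" by (simp add: generate.one)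
      show "proj (x - y) \<in> generate W ?C"
        if "Poly_Mapping.keys x \<subseteq> carrier G \<times> carrier G" "Poly_Mapping.keys y \<subseteq> carrier G \<times> carrier G"
          "proj x \<in> generate W ?C" "proj y \<in> generate W ?C" for x y
        using hom_free_Abelian_group_diff[OF W.is_group proj_hom that(1,2)] that(3,4) sub
        by (simp add: subgroup.m_closed subgroup.m_inv_closed)
      show "proj (frag_of a) \<in> generate W ?C" if "a \<in> carrier G \<times> carrier G" for a
        by (rule generate.incl) (use that in \<open>auto simp: wedge_def\<close>)
    qed
    then show "w \<in> generate W ?C" using u by simp
  qed
  then show ?thesis using fg finite_subset by blast
qed

text \<open>Composition with the wedge identifies the characters of \<open>W\<close> with the
  alternating bicharacters, by the universal property of the quotient; and a finite abelian group
  has as many elements as characters.\<close>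

theorem card_exterior_square: "card (carrier W) = card (alt_bichars G)"
proof -
  interpret W: comm_group W by (rule W_comm)
  interpret C: comm_group circle_group by (rule comm_group_circle_group)
  define \<Phi> where "\<Phi> \<xi> = (\<lambda>x\<in>carrier G. \<lambda>y\<in>carrier G. \<xi> (wedge x y))" for \<xi> :: "_ \<Rightarrow> complex"
  have "bij_betw \<Phi> (characters W) (alt_bichars G)"
    unfolding bij_betw_def
  proof
    show "inj_on \<Phi> (characters W)"
    proof (rule inj_onI)
      fix \<xi> \<xi>' assume x: "\<xi> \<in> characters W" "\<xi>' \<in> characters W" and e: "\<Phi> \<xi> = \<Phi> \<xi>'"
      show "\<xi> = \<xi>'"
      proof (rule characters_eqI[OF x])
        fix w assume w: "w \<in> carrier W"
        show "\<xi> w = \<xi>' w"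
        proof (rule hom_eq_if_wedge_eq[OF _ _ C.is_group _ w])
          show "\<xi> \<in> hom W circle_group" "\<xi>' \<in> hom W circle_group" using x by (auto simp: characters_def)
          fix x y assume xy: "x \<in> carrier G" "y \<in> carrier G"
          show "\<xi> (wedge x y) = \<xi>' (wedge x y)"
            using fun_cong[OF fun_cong[OF e, of x], of y] xy by (simp add: \<Phi>_def)
        qed
      qed
    qed
    show "\<Phi> ` characters W = alt_bichars G"
    proof (intro equalityI subsetI)
      fix b assume "b \<in> \<Phi> ` characters W"
      then obtain \<xi> where \<xi>: "\<xi> \<in> characters W" "b = \<Phi> \<xi>" by blast
      have "b x \<in> characters G" if "x \<in> carrier G" for x
        unfolding \<xi>(2) \<Phi>_def using that
        by (intro charactersI) (auto simp: charactersD[OF \<xi>(1)] wedge_carrier wedge_mult)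
      then show "b \<in> alt_bichars G"
        unfolding alt_bichars_def
        by (auto simp: \<xi>(2) \<Phi>_def charactersD[OF \<xi>(1)] wedge_carrier wedge_mult wedge_self W.character_one[OF \<xi>(1)])
    next
      fix b assume b: "b \<in> alt_bichars G"
      have bc: "norm (b x y) = 1" if "x \<in> carrier G" "y \<in> carrier G" for x y
        using charactersD(1)[OF alt_bicharsD(1)[OF b that(1)] that(2)] .
      have b2: "b x (y \<otimes> z) = b x y * b x z" if "x \<in> carrier G" "y \<in> carrier G" "z \<in> carrier G" for x y z
        using charactersD(2)[OF alt_bicharsD(1)[OF b that(1)] that(2,3)] .
      \<comment> \<open>The bicharacter is extended to the free group and then pushed through both
        quotients: bilinearity kills the tensor relations, the alternating property the diagonal
        tensors.\<close>
      obtain h where h: "h \<in> hom F circle_group"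
        "\<And>xy. xy \<in> carrier G \<times> carrier G \<Longrightarrow> h (frag_of xy) = (\<lambda>(x, y). b x y) xy"
      proof (rule C.free_Abelian_group_universal[of "\<lambda>(x, y). b x y" "carrier G \<times> carrier G"])
        show "(\<lambda>(x, y). b x y) ` (carrier G \<times> carrier G) \<subseteq> carrier circle_group" using bc by auto
      qed blast
      have hd: "h (a - b) = h a * cnj (h b)" if "a \<in> carrier F" "b \<in> carrier F" for a b
      proof -
        have "h b \<in> carrier circle_group" using hom_in_carrier[OF h(1) that(2)] .
        moreover have "cnj (h b) \<in> carrier circle_group" using calculation by simp
        ultimately have "inv\<^bsub>circle_group\<^esub> (h b) = cnj (h b)"
          by (intro C.inv_equality) (auto simp: norm_1_mult_cnj)
        then show ?thesis using hom_free_Abelian_group_diff[OF C.is_group h(1), of a b] that by simp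
      qed
      have hR: "h r = \<one>\<^bsub>circle_group\<^esub>" if r: "r \<in> R" for r
      proof (rule hom_trivial_on_generate[OF _ C.is_group h(1) tensor_gens_carrier _ r[unfolded R_eq]])
        fix s assume "s \<in> tensor_gens"
        then consider (1) x x' y where "x \<in> carrier G" "x' \<in> carrier G" "y \<in> carrier G"
            "s = frag_of (x \<otimes> x', y) - frag_of (x, y) - frag_of (x', y)"
          | (2) x y y' where "x \<in> carrier G" "y' \<in> carrier G" "y \<in> carrier G"
            "s = frag_of (x, y \<otimes> y') - frag_of (x, y) - frag_of (x, y')"
          unfolding tensor_gens_def by blast
        then show "h s = \<one>\<^bsub>circle_group\<^esub>"
        proof cases
          case 1
          have "h s = (b x y * b x' y) * cnj (b x y) * cnj (b x' y)"
            using 1 h(2) alt_bicharsD(2)[OF b]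
            by (simp add: hd diff_carrier_F del: carrier_free_Abelian_group_iff)
          also have "\<dots> = (b x y * cnj (b x y)) * (b x' y * cnj (b x' y))" by simp
          finally show ?thesis using norm_1_mult_cnj(1)[OF bc] 1 by simp
        next
          case 2
          have "h s = (b x y * b x y') * cnj (b x y) * cnj (b x y')"
            using 2 h(2) b2
            by (simp add: hd diff_carrier_F del: carrier_free_Abelian_group_iff)
          also have "\<dots> = (b x y * cnj (b x y)) * (b x y' * cnj (b x y'))" by simp
          finally show ?thesis using norm_1_mult_cnj(1)[OF bc] 2 by simp
        qed
      qed simp
      obtain h1 where h1: "h1 \<in> hom T circle_group" "\<And>x. x \<in> carrier F \<Longrightarrow> h1 (R #>\<^bsub>F\<^esub> x) = h x"
        using FactGroup_lift[OF F_comm R_subgroup C.is_group h(1) hR] unfolding T_eq by blast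
      have h1Q: "h1 r = \<one>\<^bsub>circle_group\<^esub>" if r: "r \<in> Q" for r
      proof (rule hom_trivial_on_generate[OF _ C.is_group h1(1) Q_gens _ r[unfolded Q_def]])
        show "group T" using T_comm by (simp add: comm_group_def)
        fix s assume "s \<in> {pure_tensor G G g g | g. g \<in> carrier G}"
        then obtain g where g: "g \<in> carrier G" "s = pure_tensor G G g g" by blast
        have "h1 s = h (frag_of (g, g))" unfolding g(2) pure_tensor_eq by (rule h1(2)) (use g in simp)
        also have "\<dots> = 1" using h(2)[of "(g, g)"] g alt_bicharsD(3)[OF b g(1)] by simp
        finally show "h1 s = \<one>\<^bsub>circle_group\<^esub>" by simp
      qed
      obtain h2 where h2: "h2 \<in> hom W circle_group" "\<And>x. x \<in> carrier T \<Longrightarrow> h2 (Q #>\<^bsub>T\<^esub> x) = h1 x"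
        using FactGroup_lift[OF T_comm Q_subgroup C.is_group h1(1) h1Q] unfolding W_eq by blast
      define \<xi> where "\<xi> = restrict h2 (carrier W)"
      have "\<xi> \<in> characters W"
        using h2(1) W.m_closed by (auto simp: characters_def \<xi>_def hom_def)
      moreover have "\<Phi> \<xi> = b"
      proof (rule PiE_ext[of _ "carrier G" "\<lambda>_. characters G"])
        show "b \<in> carrier G \<rightarrow>\<^sub>E characters G" using b by (simp add: alt_bichars_def)
        have eq: "\<xi> (wedge x y) = b x y" if "x \<in> carrier G" "y \<in> carrier G" for x y
        proof -
          have "\<xi> (wedge x y) = h2 (Q #>\<^bsub>T\<^esub> pure_tensor G G x y)"
            using wedge_carrier[OF that] by (simp add: \<xi>_def wedge_def proj_def pure_tensor_eq)
          also have "\<dots> = h1 (pure_tensor G G x y)" by (rule h2(2)[OF pure_tensor_carrier[OF that]])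
          also have "\<dots> = h (frag_of (x, y))" unfolding pure_tensor_eq by (rule h1(2)) (use that in simp)
          also have "\<dots> = b x y" using h(2)[of "(x, y)"] that by simp
          finally show ?thesis .
        qed
        have eq2: "\<Phi> \<xi> x = b x" if "x \<in> carrier G" for x
        proof
          fix y
          show "\<Phi> \<xi> x y = b x y"
            using eq that charactersD(3)[OF alt_bicharsD(1)[OF b that], of y]
            by (cases "y \<in> carrier G") (auto simp: \<Phi>_def)
        qed
        show "\<Phi> \<xi> x = b x" if "x \<in> carrier G" for x by (rule eq2[OF that])
        show "\<Phi> \<xi> \<in> carrier G \<rightarrow>\<^sub>E characters G"
          using eq2 alt_bicharsD(1)[OF b] by (auto simp: PiE_iff) (simp add: \<Phi>_def)
      qed
      ultimately show "b \<in> \<Phi> ` characters W" by blast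
    qed
  qed
  then show ?thesis using W.card_characters[OF finite_W] by (simp add: bij_betw_same_card)
qed

end

section \<open>Cokernels of integer matrices\<close>

abbreviation Zn :: "nat \<Rightarrow> int vec monoid" where "Zn m \<equiv> monoid_vec TYPE(int) m"

lemma comm_group_Zn: "comm_group (Zn m)" by (rule comm_group_vec)

lemma inv_Zn: 
  assumes "v \<in> carrier_vec m"
  shows "inv\<^bsub>Zn m\<^esub> v = - v"
proof -
  interpret comm_group "Zn m" by (rule comm_group_Zn)
  show ?thesis using assms by (intro inv_equality) (auto simp: monoid_vec_simps)
qed

lemma nat_pow_Zn:
  assumes v: "v \<in> carrier_vec m"
  shows "v [^]\<^bsub>Zn m\<^esub> (k::nat) = int k \<cdot>\<^sub>v v"
proof -
  interpret comm_group "Zn m" by (rule comm_group_Zn)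
  show ?thesis
  proof (induction k)
    case 0
    show ?case using v by (auto simp: monoid_vec_simps)
  next
    case (Suc k)
    then show ?case using v by (auto simp: monoid_vec_simps algebra_simps)
  qed
qed

lemma int_pow_Zn:
  assumes v: "v \<in> carrier_vec m"
  shows "v [^]\<^bsub>Zn m\<^esub> (k::int) = k \<cdot>\<^sub>v v"
proof -
  interpret comm_group "Zn m" by (rule comm_group_Zn)
  show ?thesis
  proof (cases k rule: int_cases2)
    case (nonneg n)
    then show ?thesis using nat_pow_Zn[OF v, of n] by (simp add: int_pow_int)
  next
    case (nonpos n)
    have "v [^]\<^bsub>Zn m\<^esub> k = inv\<^bsub>Zn m\<^esub> (int n \<cdot>\<^sub>v v)"
      using nonpos v nat_pow_Zn[OF v, of n] by (simp add: int_pow_neg_int monoid_vec_simps)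
    also have "\<dots> = k \<cdot>\<^sub>v v" using v nonpos by (subst inv_Zn) auto
    finally show ?thesis .
  qed
qed

definition eval_hom :: "('a, 'b) monoid_scheme \<Rightarrow> nat \<Rightarrow> (nat \<Rightarrow> 'a) \<Rightarrow> int vec \<Rightarrow> 'a" where
  "eval_hom G m f v = (\<Otimes>\<^bsub>G\<^esub>i\<in>{..<m}. f i [^]\<^bsub>G\<^esub> (v $ i))"

context comm_group
begin

lemma eval_hom_hom:
  assumes f: "f \<in> {..<m} \<rightarrow> carrier G"
  shows "eval_hom G m f \<in> hom (Zn m) G"
proof (rule homI)
  fix u v assume uv: "u \<in> carrier (Zn m)" "v \<in> carrier (Zn m)"
  have "eval_hom G m f (u \<otimes>\<^bsub>Zn m\<^esub> v) = (\<Otimes>i\<in>{..<m}. f i [^] (u $ i) \<otimes> f i [^] (v $ i))"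
    unfolding eval_hom_def
    by (intro finprod_cong') (use uv f in \<open>auto simp: monoid_vec_simps int_pow_mult Pi_iff\<close>)
  also have "\<dots> = eval_hom G m f u \<otimes> eval_hom G m f v"
    unfolding eval_hom_def by (intro finprod_multf) (use f in auto)
  finally show "eval_hom G m f (u \<otimes>\<^bsub>Zn m\<^esub> v) = eval_hom G m f u \<otimes> eval_hom G m f v" .
qed (use f in \<open>auto simp: eval_hom_def intro!: finprod_closed\<close>)

lemma eval_hom_unit:
  assumes f: "f \<in> {..<m} \<rightarrow> carrier G" and i: "i < m"
  shows "eval_hom G m f (unit_vec m i) = f i"
proof -
  have "eval_hom G m f (unit_vec m i) = (\<Otimes>j\<in>{..<m}. if i = j then f j else \<one>)"
    unfolding eval_hom_def by (intro finprod_cong') (use f i in \<open>auto simp: Pi_iff\<close>)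
  also have "\<dots> = f i" using f i by (intro finprod_singleton) auto
  finally show ?thesis .
qed

lemma hom_Zn_eq_eval_hom:
  assumes \<phi>: "\<phi> \<in> hom (Zn m) G" and v: "v \<in> carrier_vec m"
  shows "\<phi> v = eval_hom G m (\<lambda>i. \<phi> (unit_vec m i)) v"
proof -
  interpret Z: comm_group "Zn m" by (rule comm_group_Zn)
  interpret h: group_hom "Zn m" G \<phi>
    using \<phi> by (simp add: group_hom_def group_hom_axioms_def Z.is_group)
  \<comment> \<open>Truncations of \<open>v\<close> carry the induction, since consecutive ones
    differ by a multiple of a unit vector.\<close>
  let ?v = "\<lambda>k. vec m (\<lambda>i. if i < k then v $ i else 0)"
  have e: "\<phi> (unit_vec m i) \<in> carrier G" for i
    using h.hom_closed[of "unit_vec m i"] by (simp add: monoid_vec_simps)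
  have "\<phi> (?v k) = (\<Otimes>i\<in>{..<k}. \<phi> (unit_vec m i) [^] (v $ i))" if "k \<le> m" for k
    using that
  proof (induction k)
    case 0
    have "?v 0 = \<one>\<^bsub>Zn m\<^esub>" by (auto simp: monoid_vec_simps)
    then show ?case using h.hom_one by simp
  next
    case (Suc k)
    have "?v (Suc k) = ?v k \<otimes>\<^bsub>Zn m\<^esub> ((v $ k) \<cdot>\<^sub>v unit_vec m k)"
      using Suc by (auto simp: monoid_vec_simps less_Suc_eq)
    then have "\<phi> (?v (Suc k)) = \<phi> (?v k) \<otimes> \<phi> ((v $ k) \<cdot>\<^sub>v unit_vec m k)"
      using h.hom_mult[of "?v k" "(v $ k) \<cdot>\<^sub>v unit_vec m k"] by (simp add: monoid_vec_simps)
    also have "\<phi> ((v $ k) \<cdot>\<^sub>v unit_vec m k) = \<phi> (unit_vec m k) [^] (v $ k)"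
      using h.hom_int_pow[of "unit_vec m k" "v $ k"] int_pow_Zn[of "unit_vec m k" m "v $ k"]
      by (simp add: monoid_vec_simps)
    finally show ?case using Suc e by (simp add: lessThan_Suc m_comm)
  qed
  from this[of m] have "\<phi> (?v m) = eval_hom G m (\<lambda>i. \<phi> (unit_vec m i)) v" by (simp add: eval_hom_def)
  moreover have "?v m = v" using v by auto
  ultimately show ?thesis by simp
qed

end

section \<open>The cokernel as a quotient, and its surjections\<close>

lemma mult_mat_vec_in_carrier [simp]: "L *\<^sub>v v \<in> carrier_vec (dim_row L)"
  by (rule carrier_vecI) simp

definition mat_image :: "int mat \<Rightarrow> int vec set" where
  "mat_image L = (\<lambda>v. L *\<^sub>v v) ` carrier_vec (dim_col L)"

lemma cokernel_eq: "cokernel L = Zn (dim_row L) Mod mat_image L"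
  by (simp add: cokernel_def mat_image_def)

lemma mat_image_subgroup: "subgroup (mat_image L) (Zn (dim_row L))"
proof -
  interpret comm_group "Zn (dim_row L)" by (rule comm_group_Zn)
  have L: "L \<in> carrier_mat (dim_row L) (dim_col L)" by simp
  show ?thesis
  proof (rule subgroupI)
    show "mat_image L \<subseteq> carrier (Zn (dim_row L))" by (auto simp: mat_image_def monoid_vec_simps)
    show "mat_image L \<noteq> {}" 
      using zero_carrier_vec[of "dim_col L", where 'a = int] unfolding mat_image_def by blast
  next
    fix a assume "a \<in> mat_image L"
    then obtain v where v: "v \<in> carrier_vec (dim_col L)" "a = L *\<^sub>v v" by (auto simp: mat_image_def)
    then have "inv\<^bsub>Zn (dim_row L)\<^esub> a = - a" by (intro inv_Zn) auto
    also have "\<dots> = L *\<^sub>v (- v)" using v by auto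
    finally show "inv\<^bsub>Zn (dim_row L)\<^esub> a \<in> mat_image L" using v by (auto simp: mat_image_def)
  next
    fix a b assume "a \<in> mat_image L" "b \<in> mat_image L"
    then obtain v w where v: "v \<in> carrier_vec (dim_col L)" "a = L *\<^sub>v v"
      and w: "w \<in> carrier_vec (dim_col L)" "b = L *\<^sub>v w" by (auto simp: mat_image_def)
    have "a \<otimes>\<^bsub>Zn (dim_row L)\<^esub> b = L *\<^sub>v (v + w)"
      using v w mult_add_distrib_mat_vec[OF L v(1) w(1)] by (simp add: monoid_vec_simps)
    then show "a \<otimes>\<^bsub>Zn (dim_row L)\<^esub> b \<in> mat_image L" using v w by (auto simp: mat_image_def)
  qed
qed

lemma comm_group_cokernel: "comm_group (cokernel L)"
  unfolding cokernel_eq by (rule comm_group.abelian_FactGroup[OF comm_group_Zn mat_image_subgroup])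

definition coset :: "int mat \<Rightarrow> int vec \<Rightarrow> int vec set" where
  "coset L v = mat_image L #>\<^bsub>Zn (dim_row L)\<^esub> v"

lemma normal_mat_image: "mat_image L \<lhd> Zn (dim_row L)"
  using comm_group.normal_iff_subgroup[OF comm_group_Zn] mat_image_subgroup by blast

lemma coset_hom: "coset L \<in> hom (Zn (dim_row L)) (cokernel L)"
  unfolding cokernel_eq coset_def[abs_def] by (rule normal.r_coset_hom_Mod[OF normal_mat_image])

lemma carrier_cokernel: "carrier (cokernel L) = coset L ` carrier_vec (dim_row L)"
  unfolding cokernel_eq carrier_FactGroup coset_def by (simp add: monoid_vec_simps)

lemma coset_eq_iff:
  assumes "u \<in> carrier_vec (dim_row L)" "v \<in> carrier_vec (dim_row L)"
  shows "coset L u = coset L v \<longleftrightarrow> u - v \<in> mat_image L"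
proof -
  interpret comm_group "Zn (dim_row L)" by (rule comm_group_Zn)
  interpret I: subgroup "mat_image L" "Zn (dim_row L)" by (rule mat_image_subgroup)
  have c: "u \<in> carrier (Zn (dim_row L))" "v \<in> carrier (Zn (dim_row L))"
    using assms by (simp_all add: monoid_vec_simps)
  have "coset L u = coset L v \<longleftrightarrow> u \<otimes>\<^bsub>Zn (dim_row L)\<^esub> inv\<^bsub>Zn (dim_row L)\<^esub> v \<in> mat_image L"
  proof
    assume "coset L u = coset L v"
    then have "u \<in> mat_image L #>\<^bsub>Zn (dim_row L)\<^esub> v"
      using rcos_self[OF _ mat_image_subgroup, of u] assms by (simp add: coset_def monoid_vec_simps)
    then obtain r where r: "r \<in> mat_image L" "u = r \<otimes>\<^bsub>Zn (dim_row L)\<^esub> v" by (auto simp: r_coset_def)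
    then have "u \<otimes>\<^bsub>Zn (dim_row L)\<^esub> inv\<^bsub>Zn (dim_row L)\<^esub> v = r"
      using c I.mem_carrier[OF r(1)] by (simp add: m_assoc)
    then show "u \<otimes>\<^bsub>Zn (dim_row L)\<^esub> inv\<^bsub>Zn (dim_row L)\<^esub> v \<in> mat_image L" using r by simp
  next
    assume r: "u \<otimes>\<^bsub>Zn (dim_row L)\<^esub> inv\<^bsub>Zn (dim_row L)\<^esub> v \<in> mat_image L"
    have "u = (u \<otimes>\<^bsub>Zn (dim_row L)\<^esub> inv\<^bsub>Zn (dim_row L)\<^esub> v) \<otimes>\<^bsub>Zn (dim_row L)\<^esub> v"
      using c by (simp add: m_assoc)
    then have "u \<in> mat_image L #>\<^bsub>Zn (dim_row L)\<^esub> v" using r by (auto simp: r_coset_def)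
    then show "coset L u = coset L v"
      unfolding coset_def using assms repr_independence[OF _ _ mat_image_subgroup, of u v]
      by (simp add: monoid_vec_simps)
  qed
  also have "u \<otimes>\<^bsub>Zn (dim_row L)\<^esub> inv\<^bsub>Zn (dim_row L)\<^esub> v = u - v"
    using assms by (simp add: inv_Zn monoid_vec_simps) auto
  finally show ?thesis .
qed

lemma coset_eq_one_iff:
  assumes "v \<in> carrier_vec (dim_row L)"
  shows "coset L v = \<one>\<^bsub>cokernel L\<^esub> \<longleftrightarrow> v \<in> mat_image L"
proof -
  have "coset L (0\<^sub>v (dim_row L)) = \<one>\<^bsub>cokernel L\<^esub>"
    using hom_one[OF coset_hom, of L] comm_group_Zn comm_group_cokernel
    by (simp add: comm_group_def monoid_vec_simps)
  then show ?thesis using coset_eq_iff[OF assms, of "0\<^sub>v (dim_row L)"] assms by simp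
qed

lemma coset_pow:
  assumes "v \<in> carrier_vec (dim_row L)"
  shows "coset L v [^]\<^bsub>cokernel L\<^esub> (k::nat) = coset L (int k \<cdot>\<^sub>v v)"
  unfolding cokernel_eq coset_def
  using normal.FactGroup_pow[OF normal_mat_image, of v L k] assms nat_pow_Zn[OF assms, of k]
  by (simp add: monoid_vec_simps)

lemma col_in_mat_image:
  assumes "j < dim_col L" shows "col L j \<in> mat_image L"
proof -
  have "L *\<^sub>v unit_vec (dim_col L) j = col L j"
    using assms by (intro eq_vecI) (auto simp: scalar_prod_right_unit)
  then show ?thesis by (auto simp: mat_image_def intro!: image_eqI[of _ _ "unit_vec (dim_col L) j"])
qed

context comm_group
begin

lemma coker_homs_iff:
  assumes "f \<in> {..<dim_row L} \<rightarrow>\<^sub>E carrier G"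
  shows "f \<in> coker_homs G L \<longleftrightarrow> (\<forall>j<dim_col L. eval_hom G (dim_row L) f (col L j) = \<one>)"
proof -
  have "eval_hom G (dim_row L) f (col L j) = (\<Otimes>i\<in>{..<dim_row L}. f i [^] (L $$ (i, j)))" if "j < dim_col L" for j
    unfolding eval_hom_def by (intro finprod_cong') (use assms that in \<open>auto simp: PiE_iff\<close>)
  then show ?thesis using assms by (auto simp: coker_homs_def)
qed

text \<open>Composing with \<open>L\<close> gives a homomorphism on integer vectors, which is
  determined by its values at unit vectors; these are the values at the columns.\<close>

lemma eval_hom_mat_image:
  assumes f: "f \<in> coker_homs G L" and r: "r \<in> mat_image L"
  shows "eval_hom G (dim_row L) f r = \<one>"
proof -
  let ?n = "dim_row L" and ?k = "dim_col L"
  have L: "L \<in> carrier_mat ?n ?k" by simp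
  have fE: "f \<in> {..<?n} \<rightarrow>\<^sub>E carrier G" using f by (simp add: coker_homs_def)
  then have f': "f \<in> {..<?n} \<rightarrow> carrier G" by auto
  obtain v where v: "v \<in> carrier_vec ?k" "r = L *\<^sub>v v" using r by (auto simp: mat_image_def)
  define \<phi> where "\<phi> v = eval_hom G ?n f (L *\<^sub>v v)" for v
  have \<phi>: "\<phi> \<in> hom (Zn ?k) G"
  proof (rule homI)
    fix u w assume uw: "u \<in> carrier (Zn ?k)" "w \<in> carrier (Zn ?k)"
    then have "L *\<^sub>v (u \<otimes>\<^bsub>Zn ?k\<^esub> w) = (L *\<^sub>v u) \<otimes>\<^bsub>Zn ?n\<^esub> (L *\<^sub>v w)"
      using mult_add_distrib_mat_vec[OF L, of u w] by (simp add: monoid_vec_simps)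
    then show "\<phi> (u \<otimes>\<^bsub>Zn ?k\<^esub> w) = \<phi> u \<otimes> \<phi> w"
      unfolding \<phi>_def using hom_mult[OF eval_hom_hom[OF f'], of "L *\<^sub>v u" "L *\<^sub>v w"] by (simp add: monoid_vec_simps)
  next
    fix u show "\<phi> u \<in> carrier G" unfolding \<phi>_def
      using hom_in_carrier[OF eval_hom_hom[OF f'], of "L *\<^sub>v u"] by (simp add: monoid_vec_simps)
  qed
  have "\<phi> v = eval_hom G ?k (\<lambda>j. \<phi> (unit_vec ?k j)) v" by (rule hom_Zn_eq_eval_hom[OF \<phi> v(1)])
  also have "\<dots> = \<one>"
  proof -
    have "\<phi> (unit_vec ?k j) = \<one>" if "j < ?k" for j
    proof -
      have "L *\<^sub>v unit_vec ?k j = col L j"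
        using that by (intro eq_vecI) (auto simp: scalar_prod_right_unit)
      then show ?thesis using f that coker_homs_iff[OF fE] by (simp add: \<phi>_def)
    qed
    then show ?thesis unfolding eval_hom_def by (intro finprod_one_eqI) simp
  qed
  finally show ?thesis using v by (simp add: \<phi>_def)
qed

text \<open>A homomorphism is determined by its values on the classes of the unit vectors, and its
  image is the subgroup generated by them, so being onto is the generating condition of
  \<open>coker_surs\<close>.\<close>

lemma card_Sur_cokernel:
  "card (Sur (cokernel L) G) = card (coker_surs G L)"
proof -
  let ?n = "dim_row L" and ?S = "cokernel L"
  interpret S: comm_group ?S by (rule comm_group_cokernel)
  interpret Z: comm_group "Zn ?n" by (rule comm_group_Zn)
  define \<Phi> where "\<Phi> \<phi> = (\<lambda>i\<in>{..<?n}. \<phi> (coset L (unit_vec ?n i)))" for \<phi> :: "int vec set \<Rightarrow> 'a"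
  have lift: "(\<lambda>v. \<phi> (coset L v)) \<in> hom (Zn ?n) G" if "\<phi> \<in> hom ?S G" for \<phi>
    using Group.hom_compose[OF coset_hom that] by (simp add: comp_def)
  have eval: "\<phi> (coset L v) = eval_hom G ?n (\<Phi> \<phi>) v" if "\<phi> \<in> hom ?S G" "v \<in> carrier_vec ?n" for \<phi> v
  proof -
    have "\<phi> (coset L v) = eval_hom G ?n (\<lambda>i. \<phi> (coset L (unit_vec ?n i))) v"
      by (rule hom_Zn_eq_eval_hom[OF lift[OF that(1)] that(2)])
    also have "\<dots> = eval_hom G ?n (\<Phi> \<phi>) v"
      unfolding eval_hom_def
      by (intro finprod_cong') (use hom_in_carrier[OF lift[OF that(1)]] in \<open>auto simp: \<Phi>_def monoid_vec_simps\<close>)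
    finally show ?thesis .
  qed
  have \<Phi>E: "\<Phi> \<phi> \<in> {..<?n} \<rightarrow>\<^sub>E carrier G" if "\<phi> \<in> hom ?S G" for \<phi>
    using hom_in_carrier[OF lift[OF that]] by (auto simp: \<Phi>_def monoid_vec_simps)
  have gen: "eval_hom G ?n f v \<in> generate G (f ` {..<?n})" if f: "f \<in> {..<?n} \<rightarrow>\<^sub>E carrier G" for f v
  proof -
    have sub: "subgroup (generate G (f ` {..<?n})) G" using f by (intro generate_is_subgroup) auto
    have "f i [^] (v $ i) \<in> generate G (f ` {..<?n})" if "i < ?n" for i
      by (rule subgroup_int_pow_closed[OF sub]) (use that in \<open>auto intro: generate.incl\<close>)
    moreover have fp: "(\<Otimes>i\<in>A. g i) \<in> generate G (f ` {..<?n})"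
      if "finite A" "\<And>i. i \<in> A \<Longrightarrow> g i \<in> generate G (f ` {..<?n})" for A g
      using that
    proof (induction A rule: finite_induct)
      case (insert a A)
      then have "g \<in> insert a A \<rightarrow> carrier G" using subgroup.mem_carrier[OF sub] by auto
      then show ?case using insert subgroup.m_closed[OF sub] by simp
    qed (simp add: subgroup.one_closed[OF sub])
    ultimately show ?thesis unfolding eval_hom_def by (intro fp) auto
  qed
  have "bij_betw \<Phi> (Sur ?S G) (coker_surs G L)"
    unfolding bij_betw_def
  proof
    show "inj_on \<Phi> (Sur ?S G)"
    proof (rule inj_onI)
      fix \<phi> \<psi> assume h: "\<phi> \<in> Sur ?S G" "\<psi> \<in> Sur ?S G" and e: "\<Phi> \<phi> = \<Phi> \<psi>"
      then have hom: "\<phi> \<in> hom ?S G" "\<psi> \<in> hom ?S G" by (auto simp: Sur_def epi_def)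
      show "\<phi> = \<psi>"
      proof (rule extensionalityI[of _ "carrier ?S"])
        fix x assume "x \<in> carrier ?S"
        then obtain v where "v \<in> carrier_vec ?n" "x = coset L v" by (auto simp: carrier_cokernel)
        then show "\<phi> x = \<psi> x" using eval[OF hom(1)] eval[OF hom(2)] e by simp
      qed (use h in \<open>auto simp: Sur_def\<close>)
    qed
    show "\<Phi> ` Sur ?S G = coker_surs G L"
    proof (intro equalityI subsetI)
      fix f assume "f \<in> \<Phi> ` Sur ?S G"
      then obtain \<phi> where \<phi>: "\<phi> \<in> Sur ?S G" "f = \<Phi> \<phi>" by blast
      then have hom: "\<phi> \<in> hom ?S G" and surj: "\<phi> ` carrier ?S = carrier G" by (auto simp: Sur_def epi_def)
      have fE: "f \<in> {..<?n} \<rightarrow>\<^sub>E carrier G" using \<Phi>E[OF hom] \<phi> by simp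
      have "eval_hom G ?n f (col L j) = \<one>" if "j < dim_col L" for j
      proof -
        have "eval_hom G ?n f (col L j) = \<phi> (coset L (col L j))" using eval[OF hom, of "col L j"] \<phi> by simp
        also have "coset L (col L j) = \<one>\<^bsub>?S\<^esub>" using coset_eq_one_iff col_in_mat_image[OF that] by simp
        finally show ?thesis using hom_one[OF hom S.is_group is_group] by simp
      qed
      then have "f \<in> coker_homs G L" using coker_homs_iff[OF fE] by blast
      moreover have "carrier G \<subseteq> generate G (f ` {..<?n})"
      proof
        fix g assume "g \<in> carrier G"
        then obtain v where "v \<in> carrier_vec ?n" "g = \<phi> (coset L v)"
          using surj by (force simp: carrier_cokernel)
        then show "g \<in> generate G (f ` {..<?n})" using eval[OF hom] gen[OF fE] \<phi> by simp
      qed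
      moreover have "generate G (f ` {..<?n}) \<subseteq> carrier G" using fE by (intro generate_incl) auto
      ultimately show "f \<in> coker_surs G L" by (auto simp: coker_surs_def)
    next
      fix f assume f: "f \<in> coker_surs G L"
      then have fh: "f \<in> coker_homs G L" and fg: "generate G (f ` {..<?n}) = carrier G"
        by (auto simp: coker_surs_def)
      have fE: "f \<in> {..<?n} \<rightarrow>\<^sub>E carrier G" using fh by (simp add: coker_homs_def)
      then have f': "f \<in> {..<?n} \<rightarrow> carrier G" by auto
      obtain g where g: "g \<in> hom ?S G" "\<And>v. v \<in> carrier (Zn ?n) \<Longrightarrow> g (mat_image L #>\<^bsub>Zn ?n\<^esub> v) = eval_hom G ?n f v"
        using FactGroup_lift[OF comm_group_Zn mat_image_subgroup is_group eval_hom_hom[OF f'] eval_hom_mat_image[OF fh]]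
        unfolding cokernel_eq by blast
      have gv: "g (coset L v) = eval_hom G ?n f v" if "v \<in> carrier_vec ?n" for v
        using g(2)[of v] that by (simp add: coset_def monoid_vec_simps)
      define \<phi> where "\<phi> = restrict g (carrier ?S)"
      have hom: "\<phi> \<in> hom ?S G" using g(1) S.m_closed by (auto simp: hom_def \<phi>_def)
      have unit: "\<phi> (coset L (unit_vec ?n i)) = f i" if "i < ?n" for i
        using gv[of "unit_vec ?n i"] eval_hom_unit[OF f' that] by (simp add: \<phi>_def carrier_cokernel)
      have img: "subgroup (\<phi> ` carrier ?S) G"
        using group_hom.img_is_subgroup[of ?S G \<phi>] hom
        by (simp add: group_hom_def group_hom_axioms_def S.is_group)
      have "f ` {..<?n} \<subseteq> \<phi> ` carrier ?S"
      proof
        fix y assume "y \<in> f ` {..<?n}"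
        then obtain i where "i < ?n" "y = f i" by auto
        then show "y \<in> \<phi> ` carrier ?S"
          using unit[of i] by (intro image_eqI[of _ _ "coset L (unit_vec ?n i)"]) (auto simp: carrier_cokernel)
      qed
      then have "carrier G \<subseteq> \<phi> ` carrier ?S" using generate_subgroup_incl[OF _ img] fg by blast
      then have "\<phi> ` carrier ?S = carrier G" using subgroup.subset[OF img] by blast
      then have "\<phi> \<in> Sur ?S G" using hom by (auto simp: Sur_def epi_def \<phi>_def)
      moreover have "\<Phi> \<phi> = f"
        by (rule PiE_ext[OF \<Phi>E[OF hom] fE]) (simp add: \<Phi>_def unit)
      ultimately show "f \<in> \<Phi> ` Sur ?S G" by blast
    qed
  qed
  then show ?thesis by (rule bij_betw_same_card)
qed

end

section \<open>Sylow parts and torsion\<close>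

text \<open>Applying \<open>L\<close> to the adjugate times v yields det L times v, so every such
  multiple is in the image.\<close>

lemma cokernel_exponent:
  assumes L: "L \<in> carrier_mat m m" and x: "x \<in> carrier (cokernel L)"
  shows "x [^]\<^bsub>cokernel L\<^esub> nat \<bar>det L\<bar> = \<one>\<^bsub>cokernel L\<^esub>"
proof -
  have dims: "dim_row L = m" "dim_col L = m" using L by auto
  obtain v where v: "v \<in> carrier_vec m" "x = coset L v" using x dims by (auto simp: carrier_cokernel)
  have scaled: "(k * det L) \<cdot>\<^sub>v v \<in> mat_image L" for k
  proof -
    have "L *\<^sub>v (adj_mat L *\<^sub>v (k \<cdot>\<^sub>v v)) = (L * adj_mat L) *\<^sub>v (k \<cdot>\<^sub>v v)"
      using assoc_mult_mat_vec[OF L adj_mat(1)[OF L], of "k \<cdot>\<^sub>v v"] v by simp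
    also have "\<dots> = (k * det L) \<cdot>\<^sub>v v"
      unfolding adj_mat(2)[OF L] using v by (intro eq_vecI) auto
    finally show ?thesis
      using v adj_mat(1)[OF L] dims by (auto simp: mat_image_def intro!: image_eqI[of _ _ "adj_mat L *\<^sub>v (k \<cdot>\<^sub>v v)"])
  qed
  have "int (nat \<bar>det L\<bar>) = sgn (det L) * det L" using abs_sgn[of "det L"] by (simp add: mult.commute)
  then have "int (nat \<bar>det L\<bar>) \<cdot>\<^sub>v v \<in> mat_image L" using scaled[of "sgn (det L)"] by metis
  then show ?thesis using coset_pow[of v L] v dims coset_eq_one_iff[of "int (nat \<bar>det L\<bar>) \<cdot>\<^sub>v v" L] by simp
qed

lemma carrier_sylow_part:
  assumes "prime p" and S: "group S"
  shows "carrier (sylow_part p S) = {x \<in> carrier S. \<exists>j. x [^]\<^bsub>S\<^esub> (p ^ j) = \<one>\<^bsub>S\<^esub>}"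
proof -
  interpret S: group S by (rule S)
  have "(\<exists>j. S.ord x = p ^ j) \<longleftrightarrow> (\<exists>j. x [^]\<^bsub>S\<^esub> (p ^ j) = \<one>\<^bsub>S\<^esub>)" if x: "x \<in> carrier S" for x
  proof
    assume "\<exists>j. S.ord x = p ^ j"
    then show "\<exists>j. x [^]\<^bsub>S\<^esub> (p ^ j) = \<one>\<^bsub>S\<^esub>" using S.pow_ord_eq_1[OF x] by metis
  next
    assume "\<exists>j. x [^]\<^bsub>S\<^esub> (p ^ j) = \<one>\<^bsub>S\<^esub>"
    then obtain j where "S.ord x dvd p ^ j" using S.pow_eq_id[OF x] by metis
    then show "\<exists>j. S.ord x = p ^ j" using divides_primepow_nat[OF assms(1)] by blast
  qed
  then show ?thesis by (auto simp: sylow_part_def)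
qed

lemma (in group) pow_cong_one:
  assumes x: "x \<in> carrier G" "x [^] (q::nat) = \<one>" and u: "[u = 1] (mod q)"
  shows "x [^] u = x"
proof -
  obtain k1 k2 where k: "u + k1 * q = 1 + k2 * q"
    using u unfolding cong_iff_lin_nat by metis
  have z: "x [^] (k * q) = \<one>" for k
    using x nat_pow_pow[of x q k] by (simp add: mult.commute)
  have "x [^] (u + k1 * q) = x [^] u" using x z[of k1] by (simp add: nat_pow_mult[symmetric])
  moreover have "x [^] (1 + k2 * q) = x" using x z[of k2] nat_pow_mult[of x 1 "k2 * q"] by simp
  ultimately show ?thesis using k by simp
qed

text \<open>Write D = p^a m with m prime to p and take u divisible by m and congruent to 1 modulo
  p^(a + k). Raising to the power u projects S onto its p-part and is the identity on G, so f(x) =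
  f(x^u) for every homomorphism f. Restriction to the p-part thus loses nothing, and composition
  with the projection inverts it.\<close>

lemma card_Sur_sylow_part:
  assumes p: "prime p" and S: "comm_group S" and G: "comm_group G"
    and cG: "card (carrier G) = p ^ k"
    and D: "D > (0::nat)" "\<And>x. x \<in> carrier S \<Longrightarrow> x [^]\<^bsub>S\<^esub> D = \<one>\<^bsub>S\<^esub>"
  shows "card (Sur (sylow_part p S) G) = card (Sur S G)"
proof -
  interpret S: comm_group S by (rule S)
  interpret G: comm_group G by (rule G)
  define P where "P = {x \<in> carrier S. \<exists>j. x [^]\<^bsub>S\<^esub> (p ^ j) = \<one>\<^bsub>S\<^esub>}"
  have Sp: "sylow_part p S = S\<lparr>carrier := P\<rparr>"
    using carrier_sylow_part[OF p S.is_group] by (simp add: P_def sylow_part_def)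
  define a where "a = multiplicity p D"
  have p_unit: "\<not> is_unit p" using p by auto
  obtain m where m: "D = p ^ a * m" "\<not> p dvd m"
    using multiplicity_decompose'[of D p] gr_implies_not0[OF D(1)] p_unit unfolding a_def by blast
  have cop: "coprime m (p ^ (a + k))"
    using prime_imp_coprime[OF p m(2)] by (simp add: coprime_commute)
  obtain t where "[m * t = 1] (mod p ^ (a + k))"
    using cong_solve_coprime_nat[OF cop] by auto
  moreover define u where "u = m * t"
  ultimately have u: "[u = 1] (mod p ^ (a + k))" by simp
  have u_a: "[u = 1] (mod p ^ a)" and u_k: "[u = 1] (mod p ^ k)"
    using u by (auto simp: power_add intro: cong_modulus_mult_nat) (metis cong_modulus_mult_nat mult.commute)
  have Gu: "g [^]\<^bsub>G\<^esub> u = g" if "g \<in> carrier G" for g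
    by (rule G.pow_cong_one[OF that _ u_k]) (use G.pow_order_eq_1[OF that] cG in \<open>simp add: order_def\<close>)
  have SP: "x [^]\<^bsub>S\<^esub> u \<in> P" if x: "x \<in> carrier S" for x
  proof -
    have "(x [^]\<^bsub>S\<^esub> u) [^]\<^bsub>S\<^esub> (p ^ a) = (x [^]\<^bsub>S\<^esub> D) [^]\<^bsub>S\<^esub> t"
      using x by (simp add: S.nat_pow_pow u_def m(1) mult_ac)
    then show ?thesis using x D(2)[OF x] by (auto simp: P_def intro!: exI[of _ a])
  qed
  have Pu: "x [^]\<^bsub>S\<^esub> u = x" if x: "x \<in> P" for x
  proof -
    have xS: "x \<in> carrier S" using x by (simp add: P_def)
    from x obtain j where "x [^]\<^bsub>S\<^esub> (p ^ j) = \<one>\<^bsub>S\<^esub>" by (auto simp: P_def)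
    then obtain i where i: "S.ord x = p ^ i"
      using S.pow_eq_id[OF xS] divides_primepow_nat[OF p] by metis
    have "p ^ i dvd p ^ a * m" using D(2)[OF xS] S.pow_eq_id[OF xS] i m by metis
    moreover have "coprime (p ^ i) m" using m(2) p by (simp add: prime_imp_coprime)
    ultimately have "p ^ i dvd p ^ a" by (simp add: coprime_dvd_mult_left_iff)
    then have "x [^]\<^bsub>S\<^esub> (p ^ a) = \<one>\<^bsub>S\<^esub>" using S.pow_eq_id[OF xS] i by metis
    then show ?thesis by (rule S.pow_cong_one[OF xS _ u_a])
  qed
  have PS: "P \<subseteq> carrier S" by (auto simp: P_def)
  have "bij_betw (\<lambda>f. restrict f P) (Sur S G) (Sur (sylow_part p S) G)"
    unfolding bij_betw_def
  proof
    have fu: "f x = f (x [^]\<^bsub>S\<^esub> u)" if "f \<in> hom S G" "x \<in> carrier S" for f x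
    proof -
      interpret h: group_hom S G f using that(1) by (simp add: group_hom_def group_hom_axioms_def)
      show ?thesis using h.hom_nat_pow[OF that(2), of u] Gu[OF h.hom_closed[OF that(2)]] by simp
    qed
    show "inj_on (\<lambda>f. restrict f P) (Sur S G)"
    proof (rule inj_onI)
      fix f g assume f: "f \<in> Sur S G" and g: "g \<in> Sur S G" and e: "restrict f P = restrict g P"
      have "f x = g x" if x: "x \<in> carrier S" for x
      proof -
        have "f (x [^]\<^bsub>S\<^esub> u) = g (x [^]\<^bsub>S\<^esub> u)" using fun_cong[OF e, of "x [^]\<^bsub>S\<^esub> u"] SP[OF x] by simp
        then show ?thesis using fu[OF _ x, of f] fu[OF _ x, of g] f g by (auto simp: Sur_def epi_def)
      qed
      then show "f = g" using f g by (intro extensionalityI[of f "carrier S" g]) (auto simp: Sur_def)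
    qed
    show "(\<lambda>f. restrict f P) ` Sur S G = Sur (sylow_part p S) G"
    proof (intro equalityI subsetI)
      fix h assume "h \<in> (\<lambda>f. restrict f P) ` Sur S G"
      then obtain f where f: "f \<in> hom S G" "f ` carrier S = carrier G" "h = restrict f P"
        by (auto simp: Sur_def epi_def)
      have Pm: "x \<otimes>\<^bsub>S\<^esub> y \<in> P" if "x \<in> P" "y \<in> P" for x y
      proof -
        from that obtain i j where ij: "x [^]\<^bsub>S\<^esub> (p ^ i) = \<one>\<^bsub>S\<^esub>" "y [^]\<^bsub>S\<^esub> (p ^ j) = \<one>\<^bsub>S\<^esub>"
          and c: "x \<in> carrier S" "y \<in> carrier S" by (auto simp: P_def)
        have "x [^]\<^bsub>S\<^esub> (p ^ (i + j)) = \<one>\<^bsub>S\<^esub>"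
          using S.nat_pow_pow[OF c(1), of "p ^ i" "p ^ j"] ij by (simp add: power_add)
        moreover have "y [^]\<^bsub>S\<^esub> (p ^ (i + j)) = \<one>\<^bsub>S\<^esub>"
          using S.nat_pow_pow[OF c(2), of "p ^ j" "p ^ i"] ij by (simp add: power_add mult.commute)
        ultimately have "(x \<otimes>\<^bsub>S\<^esub> y) [^]\<^bsub>S\<^esub> (p ^ (i + j)) = \<one>\<^bsub>S\<^esub>"
          using c by (simp add: S.nat_pow_distrib)
        then show ?thesis using c by (auto simp: P_def)
      qed
      have "h ` P = carrier G"
      proof (intro equalityI subsetI)
        fix g assume "g \<in> h ` P"
        then show "g \<in> carrier G" using f PS by (auto simp: hom_def)
      next
        fix g assume "g \<in> carrier G"
        then obtain x where "x \<in> carrier S" "g = f x" using f(2) by auto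
        then show "g \<in> h ` P" using fu[OF f(1)] SP[of x] f(3) by (intro image_eqI[of _ _ "x [^]\<^bsub>S\<^esub> u"]) auto
      qed
      moreover have "h \<in> hom (S\<lparr>carrier := P\<rparr>) G"
        using f(1,3) PS Pm by (auto simp: hom_def Pi_iff subset_iff)
      ultimately show "h \<in> Sur (sylow_part p S) G" using f(3) by (auto simp: Sur_def epi_def Sp)
    next
      fix h assume "h \<in> Sur (sylow_part p S) G"
      then have h: "h \<in> hom (S\<lparr>carrier := P\<rparr>) G" "h ` P = carrier G" "h \<in> extensional P"
        by (auto simp: Sur_def epi_def Sp)
      define f where "f = (\<lambda>x\<in>carrier S. h (x [^]\<^bsub>S\<^esub> u))"
      have "f \<in> hom S G"
      proof (rule homI)
        fix x y assume "x \<in> carrier S" "y \<in> carrier S"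
        then show "f (x \<otimes>\<^bsub>S\<^esub> y) = f x \<otimes>\<^bsub>G\<^esub> f y"
          using h(1) SP by (simp add: f_def S.nat_pow_distrib hom_def)
      qed (use h(1) SP in \<open>auto simp: f_def hom_def\<close>)
      moreover have fP: "f x = h x" if "x \<in> P" for x using that PS Pu[OF that] by (auto simp: f_def)
      moreover have "f ` carrier S = carrier G"
      proof (intro equalityI subsetI)
        fix g assume "g \<in> f ` carrier S"
        then show "g \<in> carrier G" using calculation(1) by (auto simp: hom_def)
      next
        fix g assume "g \<in> carrier G"
        then obtain x where "x \<in> P" "g = h x" using h(2) by auto
        then show "g \<in> f ` carrier S" using fP PS by (intro image_eqI[of _ _ x]) auto
      qed
      moreover have "restrict f P = h"
        using h(3) fP by (auto simp: fun_eq_iff extensional_def)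
      ultimately show "h \<in> (\<lambda>f. restrict f P) ` Sur S G"
        by (intro image_eqI[of _ _ f]) (auto simp: Sur_def epi_def f_def)
    qed
  qed
  then show ?thesis by (simp add: bij_betw_same_card)
qed

text \<open>Both sides equal \<open>\<Sum>\<xi> a ^ n / |G|\<close>, the sum over all characters \<open>\<xi>\<close> and elements \<open>a\<close> being
  evaluated in the two possible orders.\<close>

lemma (in comm_group) card_torsion_characters:
  assumes fin: "finite (carrier G)"
  shows "card {\<xi> \<in> characters G. \<forall>a\<in>carrier G. \<xi> a ^ n = 1} = card {a \<in> carrier G. a [^] (n::nat) = \<one>}"
proof -
  let ?N = "of_nat (card (carrier G)) :: complex"
  have N: "?N \<noteq> 0" using fin by auto
  have inner1: "(\<Sum>a\<in>carrier G. \<xi> a ^ n) = (if \<forall>a\<in>carrier G. \<xi> a ^ n = 1 then ?N else 0)"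
    if \<xi>: "\<xi> \<in> characters G" for \<xi>
  proof -
    define \<psi> where "\<psi> = (\<lambda>a\<in>carrier G. \<xi> a ^ n)"
    have \<psi>: "\<psi> \<in> characters G"
      using \<xi> by (intro charactersI) (auto simp: \<psi>_def charactersD norm_power power_mult_distrib)
    have "(\<Sum>a\<in>carrier G. \<xi> a ^ n) = (\<Sum>a\<in>carrier G. \<psi> a * cnj (trivial_character G a))"
      by (simp add: \<psi>_def trivial_character_def)
    also have "\<dots> = (if \<psi> = trivial_character G then ?N else 0)"
      by (rule characters_orthogonal[OF fin \<psi>]) simp
    also have "\<psi> = trivial_character G \<longleftrightarrow> (\<forall>a\<in>carrier G. \<xi> a ^ n = 1)"
      by (auto simp: \<psi>_def trivial_character_def fun_eq_iff)
    finally show ?thesis .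
  qed
  have inner2: "(\<Sum>\<xi>\<in>characters G. \<xi> a ^ n) = (if a [^] n = \<one> then ?N else 0)" if a: "a \<in> carrier G" for a
  proof -
    have "(\<Sum>\<xi>\<in>characters G. \<xi> a ^ n) = (\<Sum>\<xi>\<in>characters G. \<xi> (a [^] n))"
      using a by (intro sum.cong refl) (simp add: character_pow)
    then show ?thesis using sum_characters_at[OF fin, of "a [^] n"] a by (simp add: card_characters[OF fin])
  qed
  have "(\<Sum>\<xi>\<in>characters G. \<Sum>a\<in>carrier G. \<xi> a ^ n) = ?N * of_nat (card {\<xi> \<in> characters G. \<forall>a\<in>carrier G. \<xi> a ^ n = 1})"
    using finite_characters[OF fin] by (simp add: inner1 sum.If_cases Int_def)
  moreover have "(\<Sum>a\<in>carrier G. \<Sum>\<xi>\<in>characters G. \<xi> a ^ n) = ?N * of_nat (card {a \<in> carrier G. a [^] n = \<one>})"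
    using fin by (simp add: inner2 sum.If_cases Int_def)
  ultimately have "complex_of_nat (card {\<xi> \<in> characters G. \<forall>a\<in>carrier G. \<xi> a ^ n = 1}) =
      of_nat (card {a \<in> carrier G. a [^] n = \<one>})"
    using N sum.swap[of "\<lambda>\<xi> a. \<xi> a ^ n" "carrier G" "characters G"] by simp
  then show ?thesis by simp
qed

text \<open>A homomorphism is determined by the pullbacks of the |G| characters of G. Each pullback
  is a character of A of order dividing |G|, and A has as many of these as elements killed by |G|.
  So the bound depends on A only through this torsion and stays fixed when A is enlarged without new
  such elements.\<close>

lemma card_hom_le:
  assumes A: "comm_group A" "finite (carrier A)" and G: "comm_group G" "finite (carrier G)"
  shows "finite (hom A G \<inter> extensional (carrier A))"
    "card (hom A G \<inter> extensional (carrier A)) \<le>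
      card {a \<in> carrier A. a [^]\<^bsub>A\<^esub> card (carrier G) = \<one>\<^bsub>A\<^esub>} ^ card (carrier G)"
proof -
  interpret A: comm_group A by (rule A)
  interpret G: comm_group G by (rule G)
  let ?n = "card (carrier G)"
  let ?T = "{\<xi> \<in> characters A. \<forall>a\<in>carrier A. \<xi> a ^ ?n = 1}"
  have finT: "finite (characters G \<rightarrow>\<^sub>E ?T)"
    using A.finite_characters[OF A(2)] G.finite_characters[OF G(2)] by (intro finite_PiE) auto
  define \<Phi> where "\<Phi> f = (\<lambda>\<xi>\<in>characters G. \<lambda>a\<in>carrier A. \<xi> (f a))" for f :: "'a \<Rightarrow> 'c"
  have into: "\<Phi> ` (hom A G \<inter> extensional (carrier A)) \<subseteq> characters G \<rightarrow>\<^sub>E ?T"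
  proof (intro subsetI, elim imageE)
    fix y f assume f: "f \<in> hom A G \<inter> extensional (carrier A)" and y: "y = \<Phi> f"
    have fa: "f a \<in> carrier G" if "a \<in> carrier A" for a using f that by (auto simp: hom_def)
    have fm: "f (a \<otimes>\<^bsub>A\<^esub> b) = f a \<otimes>\<^bsub>G\<^esub> f b" if "a \<in> carrier A" "b \<in> carrier A" for a b
      using f that by (auto simp: hom_def)
    have "(\<lambda>a\<in>carrier A. \<xi> (f a)) \<in> ?T" if \<xi>: "\<xi> \<in> characters G" for \<xi>
    proof (intro CollectI conjI ballI)
      show "(\<lambda>a\<in>carrier A. \<xi> (f a)) \<in> characters A"
        by (rule charactersI) (auto simp: fa fm charactersD[OF \<xi>])
      fix a assume a: "a \<in> carrier A"
      have "\<xi> (f a) ^ ?n = \<xi> (f a [^]\<^bsub>G\<^esub> ?n)" using G.character_pow[OF \<xi> fa[OF a]] by simp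
      also have "\<dots> = 1" using G.pow_order_eq_1[OF fa[OF a]] G.character_one[OF \<xi>] by (simp add: order_def)
      finally show "(\<lambda>a\<in>carrier A. \<xi> (f a)) a ^ ?n = 1" using a by simp
    qed
    then show "y \<in> characters G \<rightarrow>\<^sub>E ?T" unfolding y \<Phi>_def by (intro PiE_I) auto
  qed
  have inj: "inj_on \<Phi> (hom A G \<inter> extensional (carrier A))"
  proof (rule inj_onI)
    fix f g assume f: "f \<in> hom A G \<inter> extensional (carrier A)" and g: "g \<in> hom A G \<inter> extensional (carrier A)"
      and e: "\<Phi> f = \<Phi> g"
    have "f a = g a" if a: "a \<in> carrier A" for a
    proof (rule ccontr)
      assume ne: "f a \<noteq> g a"
      have c: "f a \<in> carrier G" "g a \<in> carrier G" using f g a by (auto simp: hom_def)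
      have "f a \<otimes>\<^bsub>G\<^esub> inv\<^bsub>G\<^esub> g a \<noteq> \<one>\<^bsub>G\<^esub>"
        using ne c G.inv_equality by fastforce
      then obtain \<xi> where \<xi>: "\<xi> \<in> characters G" "\<xi> (f a \<otimes>\<^bsub>G\<^esub> inv\<^bsub>G\<^esub> g a) \<noteq> 1"
        using G.characters_separate[OF G(2), of "f a \<otimes>\<^bsub>G\<^esub> inv\<^bsub>G\<^esub> g a"] c by auto
      have "\<xi> (f a) = \<xi> (g a)" using fun_cong[OF fun_cong[OF e, of \<xi>], of a] \<xi> a by (simp add: \<Phi>_def)
      then have "\<xi> (f a \<otimes>\<^bsub>G\<^esub> inv\<^bsub>G\<^esub> g a) = 1"
        using c \<xi>(1) by (simp add: charactersD G.character_inv characters_cnj_mult)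
      then show False using \<xi> by simp
    qed
    then show "f = g" using f g by (intro extensionalityI[of f "carrier A" g]) auto
  qed
  show "finite (hom A G \<inter> extensional (carrier A))"
    by (rule finite_imageD[OF finite_subset[OF into finT] inj])
  have "card (hom A G \<inter> extensional (carrier A)) \<le> card (characters G \<rightarrow>\<^sub>E ?T)"
    by (rule card_inj_on_le[OF inj into finT])
  also have "\<dots> = card ?T ^ ?n"
    by (simp add: card_PiE G.finite_characters[OF G(2)] G.card_characters[OF G(2)])
  also have "card ?T = card {a \<in> carrier A. a [^]\<^bsub>A\<^esub> ?n = \<one>\<^bsub>A\<^esub>}"
    by (rule A.card_torsion_characters[OF A(2)])
  finally show "card (hom A G \<inter> extensional (carrier A)) \<le>
      card {a \<in> carrier A. a [^]\<^bsub>A\<^esub> ?n = \<one>\<^bsub>A\<^esub>} ^ ?n" .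
qed

section \<open>Torsion in the cokernel of a symmetric matrix\<close>

lemma coker_homs_integer_mod_group:
  assumes n: "n > 0"
  shows "coker_homs (integer_mod_group n) L =
    {f \<in> {..<dim_row L} \<rightarrow>\<^sub>E {0..<int n}. \<forall>j<dim_col L. int n dvd (\<Sum>i<dim_row L. L $$ (i, j) * f i)}"
proof -
  interpret Z: comm_group "integer_mod_group n" by simp
  have car: "carrier (integer_mod_group n) = {0..<int n}" using n by (simp add: carrier_integer_mod_group)
  have fp: "finprod (integer_mod_group n) g A = (\<Sum>i\<in>A. g i) mod int n"
    if "finite A" "g \<in> A \<rightarrow> {0..<int n}" for A :: "nat set" and g
    using that
  proof (induction A rule: finite_induct)
    case (insert a A)
    then have "g \<in> insert a A \<rightarrow> carrier (integer_mod_group n)" by (simp add: car)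
    then show ?case using insert by (simp add: Pi_iff mod_add_right_eq)
  qed simp
  have "(finprod (integer_mod_group n) (\<lambda>i. f i [^]\<^bsub>integer_mod_group n\<^esub> (L $$ (i, j))) {..<dim_row L} = 0) \<longleftrightarrow>
      int n dvd (\<Sum>i<dim_row L. L $$ (i, j) * f i)" for f j
    using n by (subst fp) (auto simp: int_pow_integer_mod_group mod_sum_eq dvd_eq_mod_eq_0)
  then show ?thesis by (simp add: coker_homs_def car)
qed

definition sym_mat :: "int mat \<Rightarrow> nat \<Rightarrow> bool" where
  "sym_mat L m \<longleftrightarrow> L \<in> carrier_mat m m \<and> (\<forall>i<m. \<forall>j<m. L $$ (i, j) = L $$ (j, i))"

lemma sym_mat_mult_vec:
  assumes "sym_mat L m" "v \<in> carrier_vec m" "j < m"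
  shows "(L *\<^sub>v v) $ j = (\<Sum>i<m. L $$ (i, j) * v $ i)"
  using assms by (auto simp: sym_mat_def scalar_prod_def lessThan_atLeast0 intro!: sum.cong)

text \<open>If the class of v is killed by n, then n v = L y, and by symmetry of L the entries of y
  modulo n define a homomorphism from the cokernel to \<int>/n. If y and y' agree modulo n, say y -
  y' = n z, then dividing n (v - v') = n L z by n puts v - v' into the image, so the class is
  recovered from y modulo n.\<close>

lemma card_torsion_cokernel:
  assumes L: "sym_mat L m" and n: "n > 0"
  defines "T \<equiv> {x \<in> carrier (cokernel L). x [^]\<^bsub>cokernel L\<^esub> (n::nat) = \<one>\<^bsub>cokernel L\<^esub>}"
  shows "finite T" "card T \<le> card (coker_homs (integer_mod_group n) L)"
proof -
  have dims: "dim_row L = m" "dim_col L = m" and Lc: "L \<in> carrier_mat m m" using L by (auto simp: sym_mat_def)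
  have "\<exists>v y. v \<in> carrier_vec m \<and> y \<in> carrier_vec m \<and> x = coset L v \<and> int n \<cdot>\<^sub>v v = L *\<^sub>v y" if x: "x \<in> T" for x
  proof -
    from x obtain v where v: "v \<in> carrier_vec m" "x = coset L v" by (auto simp: T_def carrier_cokernel dims)
    have "int n \<cdot>\<^sub>v v \<in> mat_image L"
      using x v coset_pow[of v L n] coset_eq_one_iff[of "int n \<cdot>\<^sub>v v" L] by (simp add: T_def dims)
    then show ?thesis using v by (auto simp: mat_image_def dims)
  qed
  then obtain v y where vy: "\<And>x. x \<in> T \<Longrightarrow> v x \<in> carrier_vec m \<and> y x \<in> carrier_vec m \<and> x = coset L (v x) \<and> int n \<cdot>\<^sub>v v x = L *\<^sub>v y x"
    by metis
  define \<Phi> where "\<Phi> x = (\<lambda>i\<in>{..<m}. (y x $ i) mod int n)" for x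
  have inj: "inj_on \<Phi> T"
  proof (rule inj_onI)
    fix x x' assume x: "x \<in> T" "x' \<in> T" and e: "\<Phi> x = \<Phi> x'"
    have m: "y x $ i mod int n = y x' $ i mod int n" if "i < m" for i
      using fun_cong[OF e, of i] that by (simp add: \<Phi>_def)
    define z where "z = vec m (\<lambda>i. (y x $ i - y x' $ i) div int n)"
    have z: "y x - y x' = int n \<cdot>\<^sub>v z"
      using vy[OF x(1)] vy[OF x(2)] m by (intro eq_vecI) (auto simp: z_def mod_eq_dvd_iff)
    have zc: "z \<in> carrier_vec m" by (simp add: z_def)
    have "(v x - v x') $ i = (L *\<^sub>v z) $ i" if i: "i < m" for i
    proof -
      have "int n * (v x $ i - v x' $ i) = (int n \<cdot>\<^sub>v v x) $ i - (int n \<cdot>\<^sub>v v x') $ i"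
      proof -
        have "v x \<in> carrier_vec m" "v x' \<in> carrier_vec m" using vy x by blast+
        then show ?thesis using i by (simp add: right_diff_distrib)
      qed
      also have "\<dots> = (L *\<^sub>v y x) $ i - (L *\<^sub>v y x') $ i" using vy[OF x(1)] vy[OF x(2)] by metis
      also have "\<dots> = (\<Sum>j<m. L $$ (j, i) * (y x - y x') $ j)"
      proof -
        have "y x \<in> carrier_vec m" "y x' \<in> carrier_vec m" using vy x by blast+
        then show ?thesis using i
          by (simp add: sym_mat_mult_vec[OF L] sum_subtractf[symmetric])
             (intro sum.cong, auto simp: right_diff_distrib)
      qed
      also have "\<dots> = (\<Sum>j<m. L $$ (j, i) * (int n * z $ j))"
        unfolding z using zc by (intro sum.cong) auto
      also have "\<dots> = int n * (L *\<^sub>v z) $ i"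
        using zc i by (simp add: sym_mat_mult_vec[OF L] sum_distrib_left mult_ac)
      finally have "v x $ i - v x' $ i = (L *\<^sub>v z) $ i" using n by simp
      moreover have "v x' \<in> carrier_vec m" using vy x by blast
      ultimately show ?thesis using i by simp
    qed
    then have "v x - v x' = L *\<^sub>v z"
      using vy[OF x(1)] vy[OF x(2)] dims by (intro eq_vecI) auto
    then have "v x - v x' \<in> mat_image L" using zc by (auto simp: mat_image_def dims)
    then have "coset L (v x) = coset L (v x')"
      using coset_eq_iff[of "v x" L "v x'"] vy[OF x(1)] vy[OF x(2)] by (simp add: dims)
    then show "x = x'" using vy[OF x(1)] vy[OF x(2)] by metis
  qed
  have into: "\<Phi> ` T \<subseteq> coker_homs (integer_mod_group n) L"
  proof (intro subsetI, elim imageE)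
    fix f x assume x: "x \<in> T" and f: "f = \<Phi> x"
    have "int n dvd (\<Sum>i<m. L $$ (i, j) * f i)" if j: "j < m" for j
    proof -
      have "(\<Sum>i<m. L $$ (i, j) * f i) mod int n = (\<Sum>i<m. L $$ (i, j) * y x $ i) mod int n"
        unfolding f \<Phi>_def by (rule cong_sum[unfolded cong_def]) (auto simp: mod_mult_right_eq)
      also have "(\<Sum>i<m. L $$ (i, j) * y x $ i) = (L *\<^sub>v y x) $ j"
        using sym_mat_mult_vec[OF L _ j] vy[OF x] by simp
      also have "L *\<^sub>v y x = int n \<cdot>\<^sub>v v x" using vy[OF x] by simp
      also have "(int n \<cdot>\<^sub>v v x) $ j = int n * v x $ j"
      proof -
        have "v x \<in> carrier_vec m" using vy[OF x] by blast
        then show ?thesis using j by simp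
      qed
      finally show ?thesis by (simp add: dvd_eq_mod_eq_0)
    qed
    then show "f \<in> coker_homs (integer_mod_group n) L"
      using n by (auto simp: coker_homs_integer_mod_group[OF n] dims f \<Phi>_def)
  qed
  have fin: "finite (coker_homs (integer_mod_group n) L)"
    by (rule finite_subset[of _ "{..<dim_row L} \<rightarrow>\<^sub>E {0..<int n}"])
       (auto simp: coker_homs_integer_mod_group[OF n] intro!: finite_PiE)
  show "finite T" by (rule finite_imageD[OF finite_subset[OF into fin] inj])
  show "card T \<le> card (coker_homs (integer_mod_group n) L)" by (rule card_inj_on_le[OF inj into fin])
qed

section \<open>Singular Laplacians\<close>

lemma (in comm_group) torsion_subgroup: "subgroup {x \<in> carrier G. x [^] (n::nat) = \<one>} G"
proof (rule subgroupI)
  show "inv a \<in> {x \<in> carrier G. x [^] n = \<one>}" if "a \<in> {x \<in> carrier G. x [^] n = \<one>}" for a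
    using that by (simp add: nat_pow_inv)
  show "a \<otimes> b \<in> {x \<in> carrier G. x [^] n = \<one>}"
    if "a \<in> {x \<in> carrier G. x [^] n = \<one>}" "b \<in> {x \<in> carrier G. x [^] n = \<one>}" for a b
    using that by (simp add: nat_pow_distrib)
qed (auto intro: exI[of _ \<one>])

lemma (in comm_group) comm_group_subgroup:
  assumes "subgroup H G"
  shows "comm_group (G\<lparr>carrier := H\<rparr>)"
proof (rule group.group_comm_groupI)
  show "group (G\<lparr>carrier := H\<rparr>)" by (rule subgroup_imp_group[OF assms])
  show "x \<otimes>\<^bsub>G\<lparr>carrier := H\<rparr>\<^esub> y = y \<otimes>\<^bsub>G\<lparr>carrier := H\<rparr>\<^esub> x"
    if "x \<in> carrier (G\<lparr>carrier := H\<rparr>)" "y \<in> carrier (G\<lparr>carrier := H\<rparr>)" for x y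
    using that subgroup.mem_carrier[OF assms] by (simp add: m_comm)
qed

text \<open>The Sylow part is the increasing union of finite torsion subgroups, and finitely many maps are
  already told apart on one of these; so there is no need to know that the Sylow part is finite.\<close>

lemma card_Sur_sylow_part_le:
  assumes p: "prime p" and L: "sym_mat L m" and G: "comm_group G" "finite (carrier G)"
  shows "card (Sur (sylow_part p (cokernel L)) G) \<le>
    card (coker_homs (integer_mod_group (card (carrier G))) L) ^ card (carrier G)"
\<comment> \<open>For an infinite set \<open>card\<close> is 0 and the bound is trivial.\<close>
proof (cases "finite (Sur (sylow_part p (cokernel L)) G)")
  case True
  let ?S = "cokernel L" and ?n = "card (carrier G)"
  interpret S: comm_group ?S by (rule comm_group_cokernel)
  interpret G: comm_group G by (rule G)
  define P where "P = {x \<in> carrier ?S. \<exists>j. x [^]\<^bsub>?S\<^esub> (p ^ j) = \<one>\<^bsub>?S\<^esub>}"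
  have Sp: "sylow_part p ?S = ?S\<lparr>carrier := P\<rparr>"
    using carrier_sylow_part[OF p S.is_group] by (simp add: P_def sylow_part_def)
  define X where "X = Sur (sylow_part p ?S) G"
  have finX: "finite X" using True by (simp add: X_def)
  have X: "f \<in> extensional P" "f \<in> hom (?S\<lparr>carrier := P\<rparr>) G" if "f \<in> X" for f
    using that by (auto simp: X_def Sur_def epi_def Sp)
  have "\<exists>j. \<exists>x\<in>P. f x \<noteq> g x \<and> x [^]\<^bsub>?S\<^esub> (p ^ j) = \<one>\<^bsub>?S\<^esub>" if "f \<in> X" "g \<in> X" "f \<noteq> g" for f g
  proof -
    have "\<exists>x\<in>P. f x \<noteq> g x"
      using extensionalityI[OF X(1)[OF that(1)] X(1)[OF that(2)]] that(3) by blast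
    then show ?thesis by (auto simp: P_def)
  qed
  then obtain J where J: "\<And>f g. f \<in> X \<Longrightarrow> g \<in> X \<Longrightarrow> f \<noteq> g \<Longrightarrow>
      \<exists>x\<in>P. f x \<noteq> g x \<and> x [^]\<^bsub>?S\<^esub> (p ^ J f g) = \<one>\<^bsub>?S\<^esub>" by metis
  \<comment> \<open>Any common upper bound of the finitely many exponents \<open>J f g\<close> could
    be taken.\<close>
  define N where "N = (\<Sum>(f, g)\<in>X \<times> X. J f g)"
  have JN: "J f g \<le> N" if "f \<in> X" "g \<in> X" for f g
    unfolding N_def using member_le_sum[of "(f, g)" "X \<times> X" "\<lambda>(f, g). J f g"] that finX by auto
  define H where "H = {x \<in> carrier ?S. x [^]\<^bsub>?S\<^esub> (p ^ N) = \<one>\<^bsub>?S\<^esub>}"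
  define A where "A = ?S\<lparr>carrier := H\<rparr>"
  have pN: "p ^ N > 0" using p prime_gt_0_nat by simp
  have A: "comm_group A" "finite (carrier A)"
    unfolding A_def H_def using S.comm_group_subgroup[OF S.torsion_subgroup] card_torsion_cokernel(1)[OF L pN] by simp_all
  have HP: "H \<subseteq> P" by (auto simp: H_def P_def)
  have inj: "inj_on (\<lambda>f. restrict f H) X"
  proof (rule inj_onI, rule ccontr)
    fix f g assume fg: "f \<in> X" "g \<in> X" "restrict f H = restrict g H" "f \<noteq> g"
    then obtain x where x: "x \<in> P" "f x \<noteq> g x" "x [^]\<^bsub>?S\<^esub> (p ^ J f g) = \<one>\<^bsub>?S\<^esub>" using J by blast
    have xS: "x \<in> carrier ?S" using x by (simp add: P_def)
    have "p ^ N = p ^ J f g * p ^ (N - J f g)" using JN[OF fg(1,2)] by (simp flip: power_add)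
    then have "x [^]\<^bsub>?S\<^esub> (p ^ N) = \<one>\<^bsub>?S\<^esub>"
      using S.nat_pow_pow[OF xS, of "p ^ J f g" "p ^ (N - J f g)"] x by simp
    then have "x \<in> H" using xS by (simp add: H_def)
    then show False using fun_cong[OF fg(3), of x] x by simp
  qed
  have into: "(\<lambda>f. restrict f H) ` X \<subseteq> hom A G \<inter> extensional (carrier A)"
  proof (intro subsetI, elim imageE)
    interpret A: comm_group A by (rule A)
    fix h f assume f: "f \<in> X" and h: "h = restrict f H"
    have "x \<otimes>\<^bsub>?S\<^esub> y \<in> H" if "x \<in> H" "y \<in> H" for x y
      using A.m_closed[of x y] that by (simp add: A_def)
    then show "h \<in> hom A G \<inter> extensional (carrier A)"
      using X(2)[OF f] HP by (auto simp: A_def hom_def h Pi_iff subset_iff)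
  qed
  have "card X \<le> card (hom A G \<inter> extensional (carrier A))"
    by (rule card_inj_on_le[OF inj into card_hom_le(1)[OF A G]])
  also have "\<dots> \<le> card {a \<in> carrier A. a [^]\<^bsub>A\<^esub> ?n = \<one>\<^bsub>A\<^esub>} ^ ?n"
    by (rule card_hom_le(2)[OF A G])
  also have "\<dots> \<le> card (coker_homs (integer_mod_group ?n) L) ^ ?n"
  proof (rule power_mono)
    have n: "?n > 0" using G by (auto simp: card_gt_0_iff)
    have "{a \<in> carrier A. a [^]\<^bsub>A\<^esub> ?n = \<one>\<^bsub>A\<^esub>} \<subseteq> {x \<in> carrier ?S. x [^]\<^bsub>?S\<^esub> ?n = \<one>\<^bsub>?S\<^esub>}"
      by (auto simp: A_def H_def S.nat_pow_consistent[symmetric])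
    then show "card {a \<in> carrier A. a [^]\<^bsub>A\<^esub> ?n = \<one>\<^bsub>A\<^esub>} \<le> card (coker_homs (integer_mod_group ?n) L)"
      using card_mono[OF card_torsion_cokernel(1)[OF L n]] card_torsion_cokernel(2)[OF L n] by (meson order.trans)
  qed simp
  finally show ?thesis by (simp add: X_def)
qed simp

text \<open>Descent: a nonzero integer kernel vector whose entries are all divisible by p can be
  divided by p, which makes the sum of absolute values smaller. So a vector minimising this sum has
  an entry prime to p.\<close>

lemma primitive_kernel_vector:
  assumes L: "sym_mat L m" and det: "det L = 0" and p: "prime p"
  obtains w i where "i < m" "\<not> int p dvd w i" "\<And>j. j < m \<Longrightarrow> (\<Sum>i<m. L $$ (i, j) * w i) = 0"
proof -
  define K where "K w \<longleftrightarrow> (\<exists>i<m. w i \<noteq> 0) \<and> (\<forall>j<m. (\<Sum>i<m. L $$ (i, j) * w i) = 0)" for w :: "nat \<Rightarrow> int"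
  define wt where "wt w = nat (\<Sum>i<m. \<bar>w i\<bar>)" for w :: "nat \<Rightarrow> int"
  have Lc: "L \<in> carrier_mat m m" using L by (simp add: sym_mat_def)
  obtain v where v: "v \<in> carrier_vec m" "v \<noteq> 0\<^sub>v m" "L *\<^sub>v v = 0\<^sub>v m"
    using det det_0_iff_vec_prod_zero[OF Lc] by auto
  have "K (\<lambda>i. v $ i)"
    unfolding K_def
  proof (intro conjI allI impI)
    show "\<exists>i<m. v $ i \<noteq> 0" using v by (auto simp: vec_eq_iff)
    show "(\<Sum>i<m. L $$ (i, j) * v $ i) = 0" if "j < m" for j
      using sym_mat_mult_vec[OF L v(1) that] v(3) that by simp
  qed
  then obtain w where w: "K w" "\<And>w'. wt w' < wt w \<Longrightarrow> \<not> K w'"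
    using ex_has_least_nat[of K _ wt] by (metis not_le)
  have "\<exists>i<m. \<not> int p dvd w i"
  proof (rule ccontr)
    assume "\<not> (\<exists>i<m. \<not> int p dvd w i)"
    then have d: "w i = int p * (w i div int p)" if "i < m" for i using that by auto
    define w' where "w' i = w i div int p" for i
    have p1: "int p > 1" using p prime_gt_1_nat by simp
    have K': "K w'"
      unfolding K_def
    proof (intro conjI allI impI)
      obtain i where "i < m" "w i \<noteq> 0" using w(1) by (auto simp: K_def)
      then show "\<exists>i<m. w' i \<noteq> 0" using d[of i] by (auto simp: w'_def intro!: exI[of _ i])
      fix j assume j: "j < m"
      have "0 = (\<Sum>i<m. L $$ (i, j) * w i)" using w(1) j by (simp add: K_def)
      also have "\<dots> = (\<Sum>i<m. L $$ (i, j) * (int p * w' i))"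
        using d by (intro sum.cong) (auto simp: w'_def)
      also have "\<dots> = int p * (\<Sum>i<m. L $$ (i, j) * w' i)" by (simp add: sum_distrib_left mult_ac)
      finally show "(\<Sum>i<m. L $$ (i, j) * w' i) = 0" using p1 by simp
    qed
    have le: "\<bar>w' i\<bar> \<le> \<bar>w i\<bar>" if "i < m" for i
    proof -
      have "\<bar>w i\<bar> = int p * \<bar>w' i\<bar>" using d[OF that] p1 by (metis abs_mult abs_of_nat w'_def)
      then show ?thesis using p1 mult_right_mono[of 1 "int p" "\<bar>w' i\<bar>"] by simp
    qed
    obtain i0 where i0: "i0 < m" "w' i0 \<noteq> 0" using K' by (auto simp: K_def)
    have "\<bar>w i0\<bar> = int p * \<bar>w' i0\<bar>" using d[OF i0(1)] p1 by (metis abs_mult abs_of_nat w'_def)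
    then have lt: "\<bar>w' i0\<bar> < \<bar>w i0\<bar>" using p1 i0 mult_strict_right_mono[of 1 "int p" "\<bar>w' i0\<bar>"] by simp
    have "(\<Sum>i<m. \<bar>w' i\<bar>) < (\<Sum>i<m. \<bar>w i\<bar>)"
      by (rule sum_strict_mono_ex1) (use le lt i0 in auto)
    moreover have "0 \<le> (\<Sum>i<m. \<bar>w' i\<bar>)" by (intro sum_nonneg) auto
    ultimately have "wt w' < wt w" unfolding wt_def by linarith
    then show False using w(2) K' by blast
  qed
  then show ?thesis using that w(1) by (auto simp: K_def)
qed

lemma generate_integer_mod_group:
  assumes n: "n > 0" and A: "A \<subseteq> carrier (integer_mod_group n)" and a: "a \<in> A" "coprime a (int n)"
  shows "generate (integer_mod_group n) A = carrier (integer_mod_group n)"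
proof -
  interpret Z: comm_group "integer_mod_group n" by simp
  have car: "carrier (integer_mod_group n) = {0..<int n}" using n by (simp add: carrier_integer_mod_group)
  have sub: "subgroup (generate (integer_mod_group n) A) (integer_mod_group n)"
    by (rule Z.generate_is_subgroup[OF A])
  obtain s where s: "[a * s = 1] (mod int n)" using cong_solve_coprime_int[OF a(2)] by auto
  have "x \<in> generate (integer_mod_group n) A" if x: "x \<in> carrier (integer_mod_group n)" for x
  proof -
    have "a [^]\<^bsub>integer_mod_group n\<^esub> (x * s) = (x * s * a) mod int n" by (rule int_pow_integer_mod_group)
    also have "\<dots> = x mod int n"
      using cong_scalar_left[OF s, of x] by (simp add: cong_def mult_ac)
    also have "\<dots> = x" using x by (simp add: car)
    finally show ?thesis
      using Z.subgroup_int_pow_closed[OF sub generate.incl[OF a(1)], of "x * s"] by simp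
  qed
  then show ?thesis using subgroup.subset[OF sub] by blast
qed

text \<open>The surjections are the multiples of a primitive kernel vector by the units \<open>1 + p t\<close>.\<close>

lemma coker_surs_singular:
  assumes L: "sym_mat L m" and det: "det L = 0" and p: "prime p"
  shows "p ^ k \<le> card (coker_surs (integer_mod_group (p ^ Suc k)) L)"
proof -
  have dims: "dim_row L = m" "dim_col L = m" using L by (auto simp: sym_mat_def)
  let ?q = "p ^ Suc k"
  have q: "?q > 0" using p prime_gt_0_nat by simp
  obtain w i0 where w: "i0 < m" "\<not> int p dvd w i0" "\<And>j. j < m \<Longrightarrow> (\<Sum>i<m. L $$ (i, j) * w i) = 0"
    using primitive_kernel_vector[OF L det p] by blast
  have pi: "prime (int p)" using p by simp
  define f where "f t = (\<lambda>i\<in>{..<m}. ((1 + int p * int t) * w i) mod int ?q)" for t :: nat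
  have cop: "coprime (w i0) (int ?q)"
    using prime_imp_coprime[OF pi w(2)] by (simp add: coprime_commute)
  \<comment> \<open>The entry \<open>w i0\<close> is a unit modulo p^(k + 1) and can be cancelled;
    cancelling p then lowers the modulus to p^k, below which s and t lie.\<close>
  have inj: "inj_on f {..<p ^ k}"
  proof (rule inj_onI)
    fix s t assume st: "s \<in> {..<p ^ k}" "t \<in> {..<p ^ k}" and e: "f s = f t"
    have "[w i0 * (1 + int p * int s) = w i0 * (1 + int p * int t)] (mod int ?q)"
      using fun_cong[OF e, of i0] w(1) by (simp add: f_def cong_def mult.commute)
    then have "[1 + int p * int s = 1 + int p * int t] (mod int ?q)"
      using cong_mult_lcancel[OF cop] by blast
    then have "[int p * int s = int p * int t] (mod int p * int (p ^ k))" by (simp add: cong_add_lcancel)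
    then have "[int s = int t] (mod int (p ^ k))"
      using p prime_gt_0_nat[OF p] by (simp add: cong_def mult_mod_right[symmetric])
    then have "[s = t] (mod p ^ k)" by (simp only: cong_int_iff)
    then show "s = t" using st cong_less_modulus_unique_nat by simp
  qed
  have into: "f ` {..<p ^ k} \<subseteq> coker_surs (integer_mod_group ?q) L"
  proof (intro subsetI, elim imageE)
    fix g t assume g: "g = f t"
    have "int ?q dvd (\<Sum>i<m. L $$ (i, j) * g i)" if j: "j < m" for j
    proof -
      have "(\<Sum>i<m. L $$ (i, j) * g i) mod int ?q = (\<Sum>i<m. L $$ (i, j) * ((1 + int p * int t) * w i)) mod int ?q"
        unfolding g f_def by (rule cong_sum[unfolded cong_def]) (auto simp: mod_mult_right_eq)
      also have "(\<Sum>i<m. L $$ (i, j) * ((1 + int p * int t) * w i)) = (1 + int p * int t) * (\<Sum>i<m. L $$ (i, j) * w i)"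
        by (simp only: sum_distrib_left mult_ac)
      also have "\<dots> = 0" using w(3)[OF j] by simp
      finally show ?thesis by (simp add: dvd_eq_mod_eq_0)
    qed
    moreover have gE: "g \<in> {..<m} \<rightarrow>\<^sub>E {0..<int ?q}" using q by (auto simp: g f_def)
    ultimately have "g \<in> coker_homs (integer_mod_group ?q) L"
      unfolding coker_homs_integer_mod_group[OF q] dims by blast
    moreover have "generate (integer_mod_group ?q) (g ` {..<dim_row L}) = carrier (integer_mod_group ?q)"
    proof (rule generate_integer_mod_group[OF q])
      show "g ` {..<dim_row L} \<subseteq> carrier (integer_mod_group ?q)"
        using gE q by (auto simp: carrier_integer_mod_group dims)
      show "g i0 \<in> g ` {..<dim_row L}" using w(1) by (auto simp: dims)
      have "coprime (1 + int p * int t) (int p)"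
        by (rule coprimeI) (metis dvd_add_left_iff dvd_mult2)
      then have "coprime ((1 + int p * int t) * w i0) (int ?q)"
        using cop by simp
      moreover have "g i0 = ((1 + int p * int t) * w i0) mod int ?q" using w(1) by (simp add: g f_def)
      moreover have "int ?q \<noteq> 0" using q by (simp only: of_nat_eq_0_iff)
      ultimately show "coprime (g i0) (int ?q)" using coprime_mod_left_iff by metis
    qed
    ultimately show "g \<in> coker_surs (integer_mod_group ?q) L" by (simp add: coker_surs_def)
  qed
  have fin: "finite (coker_surs (integer_mod_group ?q) L)"
    by (rule finite_subset[of _ "{..<dim_row L} \<rightarrow>\<^sub>E {0..<int ?q}"])
       (auto simp: coker_surs_def coker_homs_integer_mod_group[OF q] simp del: power_Suc intro!: finite_PiE)
  show ?thesis using card_inj_on_le[OF inj into fin] by simp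
qed

text \<open>On powers of the generator every value is a power of \<open>b g g\<close>, which is 1.
  So the expected number of surjections to a cyclic group has a limit at most 1.\<close>

lemma (in comm_group) card_alt_bichars_cyclic:
  assumes g: "g \<in> carrier G" and cyc: "\<And>x. x \<in> carrier G \<Longrightarrow> \<exists>i::nat. x = g [^] i"
  shows "card (alt_bichars G) \<le> 1"
proof -
  have "alt_bichars G \<subseteq> {\<lambda>x\<in>carrier G. trivial_character G}"
  proof
    fix b assume b: "b \<in> alt_bichars G"
    have pow: "b (g [^] (i::nat)) z = b g z ^ i" if z: "z \<in> carrier G" for i z
    proof (induction i)
      case 0
      then show ?case using alt_bichars_one[OF b] z by (simp add: trivial_character_def)
    next
      case (Suc i)
      then show ?case using alt_bicharsD(2)[OF b, of "g [^] i" g z] g z by simp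
    qed
    have one: "b x z = 1" if x: "x \<in> carrier G" and z: "z \<in> carrier G" for x z
    proof -
      obtain i j :: nat where ij: "x = g [^] i" "z = g [^] j" using cyc x z by metis
      have "b x z = b g z ^ i" using pow[OF z] ij by simp
      also have "b g z = b g g ^ j" using character_pow[OF alt_bicharsD(1)[OF b g] g, of j] ij by simp
      finally show ?thesis using alt_bicharsD(3)[OF b g] by simp
    qed
    have "b = (\<lambda>x\<in>carrier G. trivial_character G)"
    proof (rule PiE_ext[of _ "carrier G" "\<lambda>_. characters G"])
      show "b \<in> carrier G \<rightarrow>\<^sub>E characters G" using b by (simp add: alt_bichars_def)
      show "(\<lambda>x\<in>carrier G. trivial_character G) \<in> carrier G \<rightarrow>\<^sub>E characters G" by auto
      fix x assume x: "x \<in> carrier G"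
      have "b x = trivial_character G"
        by (rule characters_eqI[OF alt_bicharsD(1)[OF b x] trivial_character]) (simp add: one[OF x] trivial_character_def)
      then show "b x = (\<lambda>x\<in>carrier G. trivial_character G) x" using x by simp
    qed
    then show "b \<in> {\<lambda>x\<in>carrier G. trivial_character G}" by simp
  qed
  then show ?thesis using card_mono[of "{\<lambda>x\<in>carrier G. trivial_character G}" "alt_bichars G"] by simp
qed

lemma card_alt_bichars_integer_mod_group:
  assumes "n > 1"
  shows "card (alt_bichars (integer_mod_group n)) \<le> 1"
proof (rule comm_group.card_alt_bichars_cyclic[of _ 1])
  fix x assume "x \<in> carrier (integer_mod_group n)"
  then have "x = 1 [^]\<^bsub>integer_mod_group n\<^esub> nat x" using assms by (simp add: carrier_integer_mod_group)
  then show "\<exists>i::nat. x = 1 [^]\<^bsub>integer_mod_group n\<^esub> i" by blast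
qed (use assms in auto)

section \<open>Powers of a group and higher moments\<close>

lemma comm_group_product_group:
  assumes "comm_group G"
  shows "comm_group (product_group I (\<lambda>_. G))"
proof -
  interpret comm_group G by fact
  show ?thesis
  proof (rule group.group_comm_groupI)
    show "group (product_group I (\<lambda>_. G))" by simp
  qed (auto intro!: restrict_ext simp: m_comm PiE_iff)
qed

text \<open>An r-tuple of homomorphisms to G is a homomorphism to G^r, so the higher moments of the
  number of homomorphisms are bounded by first moments for another group.\<close>

lemma card_coker_homs_power_le:
  assumes G: "comm_group G" "finite (carrier G)"
  shows "card (coker_homs G L) ^ r \<le> card (coker_homs (product_group {..<r} (\<lambda>_. G)) L)"
proof -
  interpret G: comm_group G by (rule G)
  let ?P = "product_group {..<r} (\<lambda>_. G)" and ?m = "dim_row L"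
  interpret P: comm_group ?P by (rule comm_group_product_group[OF G(1)])
  have proj: "group_hom ?P G (\<lambda>x. x s)" if "s < r" for s
    using that by (auto simp: group_hom_def group_hom_axioms_def hom_def PiE_iff)
  have fp: "finprod ?P g A s = (\<Otimes>\<^bsub>G\<^esub>i\<in>A. g i s)" if "s < r" "finite A" "g \<in> A \<rightarrow> carrier ?P" for g A s
    using that(2,3)
  proof (induction A rule: finite_induct)
    case empty
    then show ?case using \<open>s < r\<close> by simp
  next
    case (insert a A)
    have gs: "g i s \<in> carrier G" if "i \<in> insert a A" for i
      using insert.prems that \<open>s < r\<close> by (auto simp: Pi_iff PiE_iff)
    have "finprod ?P g (insert a A) = g a \<otimes>\<^bsub>?P\<^esub> finprod ?P g A"
      using insert by (intro P.finprod_insert) auto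
    then have "finprod ?P g (insert a A) s = g a s \<otimes>\<^bsub>G\<^esub> finprod ?P g A s" using \<open>s < r\<close> by simp
    also have "\<dots> = g a s \<otimes>\<^bsub>G\<^esub> (\<Otimes>\<^bsub>G\<^esub>i\<in>A. g i s)" using insert by auto
    also have "\<dots> = (\<Otimes>\<^bsub>G\<^esub>i\<in>insert a A. g i s)" using insert gs by (intro G.finprod_insert[symmetric]) auto
    finally show ?case .
  qed
  define \<Phi> where "\<Phi> F = (\<lambda>i\<in>{..<?m}. \<lambda>s\<in>{..<r}. F s i)" for F :: "nat \<Rightarrow> nat \<Rightarrow> 'a"
  have FG: "F s i \<in> carrier G" if "F \<in> {..<r} \<rightarrow>\<^sub>E coker_homs G L" "s < r" "i < ?m" for F s i
  proof -
    have "F s \<in> coker_homs G L" using that by auto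
    then show ?thesis using that(3) by (auto simp: coker_homs_def)
  qed
  have into: "\<Phi> ` ({..<r} \<rightarrow>\<^sub>E coker_homs G L) \<subseteq> coker_homs ?P L"
  proof (intro subsetI, elim imageE)
    fix f F assume F: "F \<in> {..<r} \<rightarrow>\<^sub>E coker_homs G L" and f: "f = \<Phi> F"
    have fE: "f \<in> {..<?m} \<rightarrow>\<^sub>E carrier ?P" using FG[OF F] by (auto simp: f \<Phi>_def)
    have "(\<Otimes>\<^bsub>?P\<^esub>i\<in>{..<?m}. f i [^]\<^bsub>?P\<^esub> (L $$ (i, j))) = \<one>\<^bsub>?P\<^esub>" if j: "j < dim_col L" for j
    proof (rule PiE_ext[of _ "{..<r}" "\<lambda>_. carrier G"])
      have fc: "(\<lambda>i. f i [^]\<^bsub>?P\<^esub> (L $$ (i, j))) \<in> {..<?m} \<rightarrow> carrier ?P"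
        using fE by (intro Pi_I P.int_pow_closed) auto
      show "(\<Otimes>\<^bsub>?P\<^esub>i\<in>{..<?m}. f i [^]\<^bsub>?P\<^esub> (L $$ (i, j))) \<in> {..<r} \<rightarrow>\<^sub>E carrier G"
        using P.finprod_closed[OF fc] by simp
      show "\<one>\<^bsub>?P\<^esub> \<in> {..<r} \<rightarrow>\<^sub>E carrier G" by simp
      fix s assume s: "s \<in> {..<r}"
      have "(\<Otimes>\<^bsub>?P\<^esub>i\<in>{..<?m}. f i [^]\<^bsub>?P\<^esub> (L $$ (i, j))) s = (\<Otimes>\<^bsub>G\<^esub>i\<in>{..<?m}. (f i [^]\<^bsub>?P\<^esub> (L $$ (i, j))) s)"
        using s by (intro fp fc) auto
      also have "\<dots> = (\<Otimes>\<^bsub>G\<^esub>i\<in>{..<?m}. F s i [^]\<^bsub>G\<^esub> (L $$ (i, j)))"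
      proof (rule G.finprod_cong')
        show "(\<lambda>i. F s i [^]\<^bsub>G\<^esub> (L $$ (i, j))) \<in> {..<?m} \<rightarrow> carrier G" using FG[OF F] s by auto
        fix i assume i: "i \<in> {..<?m}"
        have "(f i [^]\<^bsub>?P\<^esub> (L $$ (i, j))) s = f i s [^]\<^bsub>G\<^esub> (L $$ (i, j))"
          using group_hom.hom_int_pow[OF proj PiE_mem[OF fE i], of s "L $$ (i, j)"] s by simp
        then show "(f i [^]\<^bsub>?P\<^esub> (L $$ (i, j))) s = F s i [^]\<^bsub>G\<^esub> (L $$ (i, j))"
          using s i by (simp add: f \<Phi>_def)
      qed simp
      also have "\<dots> = \<one>\<^bsub>G\<^esub>" using F s j by (auto simp: coker_homs_def PiE_iff)
      finally show "(\<Otimes>\<^bsub>?P\<^esub>i\<in>{..<?m}. f i [^]\<^bsub>?P\<^esub> (L $$ (i, j))) s = \<one>\<^bsub>?P\<^esub> s" using s by simp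
    qed
    then show "f \<in> coker_homs ?P L" using fE by (simp add: coker_homs_def)
  qed
  have inj: "inj_on \<Phi> ({..<r} \<rightarrow>\<^sub>E coker_homs G L)"
  proof (rule inj_onI)
    fix F F' assume F: "F \<in> {..<r} \<rightarrow>\<^sub>E coker_homs G L" and F': "F' \<in> {..<r} \<rightarrow>\<^sub>E coker_homs G L"
      and e: "\<Phi> F = \<Phi> F'"
    show "F = F'"
    proof (rule PiE_ext[OF F F'])
      fix s assume s: "s \<in> {..<r}"
      have E: "F s \<in> {..<?m} \<rightarrow>\<^sub>E carrier G" "F' s \<in> {..<?m} \<rightarrow>\<^sub>E carrier G"
        using PiE_mem[OF F s] PiE_mem[OF F' s] by (simp_all add: coker_homs_def)
      show "F s = F' s"
      proof (rule PiE_ext[OF E])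
        fix i assume "i \<in> {..<?m}"
        then show "F s i = F' s i" using fun_cong[OF fun_cong[OF e, of i], of s] s by (simp add: \<Phi>_def)
      qed
    qed
  qed
  have fin: "finite (coker_homs ?P L)"
    by (rule finite_subset[of _ "{..<?m} \<rightarrow>\<^sub>E carrier ?P"])
       (auto simp: coker_homs_def G intro!: finite_PiE)
  show ?thesis using card_inj_on_le[OF inj into fin] by (simp add: card_PiE)
qed

lemma sym_mat_reduced_laplacian: "sym_mat (reduced_laplacian (Suc m) E) m"
  by (auto simp: sym_mat_def reduced_laplacian_entry insert_commute intro!: carrier_matI)

section \<open>The moments of the Sylow part\<close>

lemma set_pmf_erdos_renyi: "set_pmf (erdos_renyi n q) \<subseteq> Pow (possible_edges n)"
  by (auto simp: erdos_renyi_def)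

lemma integrable_erdos_renyi: "integrable (measure_pmf (erdos_renyi n q)) (f :: _ \<Rightarrow> real)"
  by (rule integrable_measure_pmf_finite, rule finite_subset[OF set_pmf_erdos_renyi])
     (simp add: finite_possible_edges)

lemma expectation_erdos_renyi_mono:
  fixes f g :: "nat set set \<Rightarrow> real"
  assumes "\<And>E. E \<subseteq> possible_edges n \<Longrightarrow> f E \<le> g E"
  shows "measure_pmf.expectation (erdos_renyi n q) f \<le> measure_pmf.expectation (erdos_renyi n q) g"
  by (rule integral_mono_AE[OF integrable_erdos_renyi integrable_erdos_renyi])
     (use assms set_pmf_erdos_renyi in \<open>force intro!: AE_pmfI\<close>)

abbreviation singular_prob :: "nat \<Rightarrow> real \<Rightarrow> real" where
  "singular_prob n q \<equiv> measure_pmf.expectation (erdos_renyi n q)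
     (\<lambda>E. if det (reduced_laplacian n E) = 0 then 1 else 0)"

text \<open>Markov's inequality: a singular matrix has at least 2^k surjections to the cyclic group
  of order 2^(k + 1), while their expected number is eventually below 2. This bounds the probability
  by 2 / 2^k, with k at free choice. The prime 2 is unrelated to the prime of the theorem.\<close>

lemma singular_prob_tendsto:
  assumes q: "dense_enough c q"
  shows "(\<lambda>n. singular_prob n (q n)) \<longlonglongrightarrow> 0"
proof (rule tendstoI)
  fix e :: real assume e: "e > 0"
  obtain k :: nat where k: "2 / e < 2 ^ k" using real_arch_pow[of 2 "2 / e"] by auto
  let ?Z = "integer_mod_group (2 ^ Suc k)"
  have fin: "finite (carrier ?Z)" by (simp add: carrier_integer_mod_group)
  have two: "prime (2::nat)" by (rule two_is_prime_nat)
  have "(\<lambda>n. expected_surs ?Z n (q n)) \<longlonglongrightarrow> card (alt_bichars ?Z)"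
    by (rule comm_group.expected_surs_tendsto[OF _ fin q]) simp
  moreover have "real (card (alt_bichars ?Z)) < 2"
  proof -
    have "(1::nat) < 2 ^ Suc k" by (rule one_less_power) auto
    then show ?thesis using card_alt_bichars_integer_mod_group[of "2 ^ Suc k"] by linarith
  qed
  ultimately have "\<forall>\<^sub>F n in sequentially. expected_surs ?Z n (q n) < 2" by (rule order_tendstoD)
  then show "\<forall>\<^sub>F n in sequentially. dist (singular_prob n (q n)) 0 < e"
    using eventually_ge_at_top[of 1]
  proof eventually_elim
    case (elim n)
    obtain m where n: "n = Suc m" using elim(2) by (cases n) auto
    have "2 ^ k * singular_prob n (q n) =
        measure_pmf.expectation (erdos_renyi n (q n)) (\<lambda>E. 2 ^ k * (if det (reduced_laplacian n E) = 0 then 1 else 0))"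
      by simp
    also have "\<dots> \<le> expected_surs ?Z n (q n)"
    proof (rule expectation_erdos_renyi_mono)
      fix E
      have "2 ^ k \<le> card (coker_surs ?Z (reduced_laplacian n E))" if "det (reduced_laplacian n E) = 0"
        using coker_surs_singular[OF sym_mat_reduced_laplacian _ two, of m E k] that n by simp
      then have "real (2 ^ k) \<le> real (card (coker_surs ?Z (reduced_laplacian n E)))" if "det (reduced_laplacian n E) = 0"
        using that of_nat_mono by blast
      then show "2 ^ k * (if det (reduced_laplacian n E) = 0 then 1 else 0) \<le> real (card (coker_surs ?Z (reduced_laplacian n E)))"
        by simp
    qed
    also have "\<dots> < 2" by (rule elim)
    finally have "singular_prob n (q n) < 2 / 2 ^ k" by (simp add: field_simps)
    also have "\<dots> < e" using k e by (simp add: field_simps)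
    finally have "singular_prob n (q n) < e" .
    moreover have "singular_prob n (q n) \<ge> 0" by (intro integral_nonneg_AE AE_pmfI) auto
    ultimately show ?case by simp
  qed
qed

lemma expected_homs_power_bounded:
  assumes G: "comm_group G" "finite (carrier G)" and q: "dense_enough c q"
  shows "\<exists>B. \<forall>\<^sub>F n in sequentially. measure_pmf.expectation (erdos_renyi n (q n))
     (\<lambda>E. real (card (coker_homs G (reduced_laplacian n E))) ^ r) \<le> B"
proof -
  let ?P = "product_group {..<r} (\<lambda>_. G)"
  have fin: "finite (carrier ?P)" using G by (auto intro!: finite_PiE)
  obtain B where "\<forall>\<^sub>F n in sequentially. expected_homs ?P n (q n) \<le> B"
    using comm_group.expected_homs_bounded[OF comm_group_product_group[OF G(1)] fin q] by blast
  then have "\<forall>\<^sub>F n in sequentially. measure_pmf.expectation (erdos_renyi n (q n))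
     (\<lambda>E. real (card (coker_homs G (reduced_laplacian n E))) ^ r) \<le> B"
  proof eventually_elim
    case (elim n)
    have "measure_pmf.expectation (erdos_renyi n (q n))
      (\<lambda>E. real (card (coker_homs G (reduced_laplacian n E))) ^ r) \<le> expected_homs ?P n (q n)"
    proof (rule expectation_erdos_renyi_mono)
      fix E
      show "real (card (coker_homs G (reduced_laplacian n E))) ^ r \<le> real (card (coker_homs ?P (reduced_laplacian n E)))"
        using card_coker_homs_power_le[OF G, of "reduced_laplacian n E" r]
        by (metis of_nat_le_iff of_nat_power)
    qed
    then show ?case using elim by linarith
  qed
  then show ?thesis by blast
qed

text \<open>The variance \<beta> (1 - \<beta>) is only at least \<alpha> (1 - \<alpha>), a little
  below \<alpha>. Since \<alpha> tends to 0, the loss is covered by lowering c to (1 + c) / 2, which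
  still exceeds 1.\<close>

lemma dense_enoughI:
  assumes c: "c > 1" and \<alpha>: "\<And>n. \<alpha> n = c * ln (real n) / real n"
    and \<beta>: "\<And>n. n \<ge> 1 \<Longrightarrow> \<alpha> n \<le> 1 / 2 \<Longrightarrow> \<beta> n \<in> {\<alpha> n..1 - \<alpha> n}"
  shows "dense_enough ((1 + c) / 2) \<beta>"
proof -
  have lim: "\<alpha> \<longlonglongrightarrow> 0"
  proof -
    have "(\<lambda>n. c * ln (real n) / real n) \<longlonglongrightarrow> 0" by real_asymp
    then show ?thesis by (simp add: \<alpha>[abs_def])
  qed
  \<comment> \<open>This is 1 - (1 + c) / (2 c), the relative room between the two
    constants.\<close>
  have "(c - 1) / (2 * c) > 0" using c by simp
  from order_tendstoD(2)[OF lim this] have e1: "\<forall>\<^sub>F n in sequentially. \<alpha> n < (c - 1) / (2 * c)" .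
  have e2: "\<forall>\<^sub>F n in sequentially. \<alpha> n < 1 / 2" by (rule order_tendstoD(2)[OF lim]) simp
  have "\<forall>\<^sub>F n in sequentially. 0 \<le> \<beta> n \<and> \<beta> n \<le> 1 \<and> (1 + c) / 2 * ln (real n) / real n \<le> \<beta> n * (1 - \<beta> n)"
    using e1 e2 eventually_ge_at_top[of 1]
  proof eventually_elim
    case (elim n)
    have \<alpha>0: "\<alpha> n \<ge> 0" using elim c by (simp add: \<alpha>)
    have b: "\<alpha> n \<le> \<beta> n" "\<beta> n \<le> 1 - \<alpha> n" using \<beta>[of n] elim by auto
    have "\<beta> n * (1 - \<beta> n) - \<alpha> n * (1 - \<alpha> n) = (\<beta> n - \<alpha> n) * (1 - \<alpha> n - \<beta> n)" by (simp add: algebra_simps)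
    moreover have "\<dots> \<ge> 0" using b by simp
    ultimately have "\<alpha> n * (1 - \<alpha> n) \<le> \<beta> n * (1 - \<beta> n)" by linarith
    moreover have "(1 + c) / 2 * ln (real n) / real n = \<alpha> n * ((1 + c) / (2 * c))"
      using c elim by (simp add: \<alpha> field_simps)
    moreover have "(1 + c) / (2 * c) \<le> 1 - \<alpha> n"
    proof -
      have "(1 + c) / (2 * c) = 1 - (c - 1) / (2 * c)" using c by (simp add: field_simps)
      then show ?thesis using elim by linarith
    qed
    then have "\<alpha> n * ((1 + c) / (2 * c)) \<le> \<alpha> n * (1 - \<alpha> n)" by (rule mult_left_mono[OF _ \<alpha>0])
    ultimately show ?case using b \<alpha>0 by auto
  qed
  then show ?thesis using c by (simp add: dense_enough_def)
qed

section \<open>Comparison of the Sylow part with the full cokernel\<close>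

lemma card_coker_surs_le_homs:
  assumes "finite (carrier G)"
  shows "card (coker_surs G L) \<le> card (coker_homs G L)"
proof (rule card_mono)
  show "finite (coker_homs G L)"
    by (rule finite_subset[of _ "{..<dim_row L} \<rightarrow>\<^sub>E carrier G"])
       (auto simp: coker_homs_def assms intro!: finite_PiE)
qed (auto simp: coker_surs_def)

text \<open>For a nonsingular matrix the determinant is a positive exponent of the cokernel and the
  two counts agree. For a singular one the free part of the cokernel can make them differ, so each
  count is bounded by itself.\<close>

lemma Sur_sylow_deviation:
  assumes p: "prime p" and G: "comm_group G" "finite (carrier G)" "card (carrier G) = p ^ k" and n: "n \<ge> 1"
  defines "N \<equiv> card (carrier G)"
  shows "\<bar>real (card (Sur (sylow_part p (sandpile_group n E)) G)) - real (card (coker_surs G (reduced_laplacian n E)))\<bar> \<le>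
    (if det (reduced_laplacian n E) = 0 then
       real (card (coker_homs (integer_mod_group N) (reduced_laplacian n E))) ^ N
         + real (card (coker_homs G (reduced_laplacian n E))) else 0)"
proof -
  obtain m where m: "n = Suc m" using n by (cases n) auto
  let ?L = "reduced_laplacian n E"
  have L: "sym_mat ?L m" using sym_mat_reduced_laplacian m by simp
  then have Lc: "?L \<in> carrier_mat m m" by (simp add: sym_mat_def)
  show ?thesis
  proof (cases "det ?L = 0")
    case True
    have "real (card (Sur (sylow_part p (sandpile_group n E)) G)) \<le> real (card (coker_homs (integer_mod_group N) ?L)) ^ N"
      using card_Sur_sylow_part_le[OF p L G(1,2)] unfolding sandpile_group_def N_def
      by (metis of_nat_le_iff of_nat_power)
    moreover have "real (card (coker_surs G ?L)) \<le> real (card (coker_homs G ?L))"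
      using card_coker_surs_le_homs[OF G(2)] by simp
    moreover have "0 \<le> real (card (Sur (sylow_part p (sandpile_group n E)) G))"
      "0 \<le> real (card (coker_surs G ?L))" by simp_all
    ultimately show ?thesis unfolding if_P[OF True] abs_le_iff by linarith
  next
    case False
    have "card (Sur (sylow_part p (sandpile_group n E)) G) = card (Sur (cokernel ?L) G)"
      unfolding sandpile_group_def
      by (rule card_Sur_sylow_part[OF p comm_group_cokernel G(1,3), of "nat \<bar>det ?L\<bar>"])
         (use False cokernel_exponent[OF Lc] in auto)
    also have "\<dots> = card (coker_surs G ?L)" by (rule comm_group.card_Sur_cokernel[OF G(1)])
    finally show ?thesis using False by simp
  qed
qed

text \<open>Truncation: the deviation is at most some z, and z \<le> z^2 / T + T. The mean of z^2 /
  T is small for large T because the second moments are bounded; for this fixed T the other term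
  only counts on singular matrices, whose probability tends to 0.\<close>

lemma Sur_sylow_deviation_tendsto:
  assumes p: "prime p" and G: "comm_group G" "finite (carrier G)" "card (carrier G) = p ^ k"
    and q: "dense_enough c q"
  shows "(\<lambda>n. measure_pmf.expectation (erdos_renyi n (q n))
            (\<lambda>E. real (card (Sur (sylow_part p (sandpile_group n E)) G)))
          - expected_surs G n (q n)) \<longlonglongrightarrow> 0"
proof (rule tendstoI)
  fix e :: real assume e: "e > 0"
  let ?N = "card (carrier G)"
  let ?Z = "integer_mod_group ?N"
  let ?L = "reduced_laplacian"
  have N: "?N > 0" using G(3) prime_gt_0_nat[OF p] by simp
  define Y where "Y n E = real (card (coker_homs ?Z (?L n E)))" for n E
  define H where "H n E = real (card (coker_homs G (?L n E)))" for n E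
  define X where "X n E = real (card (Sur (sylow_part p (sandpile_group n E)) G))" for n E
  define X' where "X' n E = real (card (coker_surs G (?L n E)))" for n E
  have finZ: "finite (carrier ?Z)" using N by (simp add: carrier_integer_mod_group)
  obtain B1 where B1: "\<forall>\<^sub>F n in sequentially. measure_pmf.expectation (erdos_renyi n (q n)) (\<lambda>E. Y n E ^ (2 * ?N)) \<le> B1"
    using expected_homs_power_bounded[OF abelian_integer_mod_group finZ q, of "2 * ?N"] unfolding Y_def by blast
  obtain B2 where B2: "\<forall>\<^sub>F n in sequentially. measure_pmf.expectation (erdos_renyi n (q n)) (\<lambda>E. H n E ^ 2) \<le> B2"
    using expected_homs_power_bounded[OF G(1,2) q, of 2] unfolding H_def by blast
  \<comment> \<open>Large enough for the moment term to be at most e / 2. The signs of B1 and B2 are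
    unknown, hence the absolute values, and the added 1 makes T positive.\<close>
  define T where "T = (2 * \<bar>B1\<bar> + 2 * \<bar>B2\<bar> + 1) * 2 / e"
  have T: "T > 0" using e by (simp add: T_def add_nonneg_pos)
  have TB: "(2 * B1 + 2 * B2) / T \<le> e / 2"
  proof -
    have "(2 * B1 + 2 * B2) \<le> e / 2 * T" using e by (simp add: T_def)
    then show ?thesis using T by (simp add: divide_le_eq)
  qed
  have "(\<lambda>n. T * singular_prob n (q n)) \<longlonglongrightarrow> T * 0"
    by (intro tendsto_mult tendsto_const singular_prob_tendsto[OF q])
  then have "\<forall>\<^sub>F n in sequentially. T * singular_prob n (q n) < e / 2"
    by (rule order_tendstoD) (use e in simp)
  then show "\<forall>\<^sub>F n in sequentially. dist (measure_pmf.expectation (erdos_renyi n (q n))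
            (\<lambda>E. real (card (Sur (sylow_part p (sandpile_group n E)) G))) - expected_surs G n (q n)) 0 < e"
    using B1 B2 eventually_ge_at_top[of 1]
  proof eventually_elim
    case (elim n)
    let ?E = "\<lambda>f :: _ \<Rightarrow> real. measure_pmf.expectation (erdos_renyi n (q n)) f"
    note int = integrable_erdos_renyi[of n "q n"]
    have pt: "\<bar>X n E - X' n E\<bar> \<le> (2 * Y n E ^ (2 * ?N) + 2 * H n E ^ 2) / T
        + T * (if det (?L n E) = 0 then 1 else 0)" for E
    proof (cases "det (?L n E) = 0")
      case True
      define z where "z = Y n E ^ ?N + H n E"
      have z0: "z \<ge> 0" by (simp add: z_def Y_def H_def)
      have "\<bar>X n E - X' n E\<bar> \<le> z"
        using Sur_sylow_deviation[OF p G elim(4), of E] True by (simp add: X_def X'_def z_def Y_def H_def)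
      also have "z \<le> z\<^sup>2 / T + T"
      proof (cases "z \<le> T")
        case True
        then show ?thesis using T by (simp add: add_increasing)
      next
        case False
        then have "z * T \<le> z * z" using z0 by (intro mult_left_mono) auto
        then have "z \<le> z\<^sup>2 / T" using T by (simp add: le_divide_eq power2_eq_square)
        then show ?thesis using T by simp
      qed
      also have "z\<^sup>2 / T \<le> (2 * Y n E ^ (2 * ?N) + 2 * H n E ^ 2) / T"
      proof (rule divide_right_mono)
        have "z\<^sup>2 + (Y n E ^ ?N - H n E)\<^sup>2 = 2 * (Y n E ^ ?N)\<^sup>2 + 2 * (H n E)\<^sup>2"
          by (simp add: z_def power2_eq_square algebra_simps)
        moreover have "(Y n E ^ ?N)\<^sup>2 = Y n E ^ (2 * ?N)" by (simp add: power_mult[symmetric] mult.commute)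
        ultimately show "z\<^sup>2 \<le> 2 * Y n E ^ (2 * ?N) + 2 * H n E ^ 2"
          using zero_le_power2[of "Y n E ^ ?N - H n E"] by linarith
      qed (use T in simp)
      finally show ?thesis using True by simp
    next
      case False
      then have "\<bar>X n E - X' n E\<bar> \<le> 0"
        using Sur_sylow_deviation[OF p G elim(4), of E] by (simp add: X_def X'_def)
      also have "0 \<le> (2 * Y n E ^ (2 * ?N) + 2 * H n E ^ 2) / T" using T by (simp add: Y_def H_def)
      finally show ?thesis using False by simp
    qed
    have "\<bar>?E (X n) - ?E (X' n)\<bar> = \<bar>?E (\<lambda>E. X n E - X' n E)\<bar>"
      by (simp add: Bochner_Integration.integral_diff[OF int int])
    also have "\<dots> \<le> ?E (\<lambda>E. \<bar>X n E - X' n E\<bar>)" by (rule integral_abs_bound)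
    also have "\<dots> \<le> ?E (\<lambda>E. (2 * Y n E ^ (2 * ?N) + 2 * H n E ^ 2) / T + T * (if det (?L n E) = 0 then 1 else 0))"
      by (rule expectation_erdos_renyi_mono) (rule pt)
    also have "\<dots> = (2 * ?E (\<lambda>E. Y n E ^ (2 * ?N)) + 2 * ?E (\<lambda>E. H n E ^ 2)) / T + T * singular_prob n (q n)"
      by (simp add: Bochner_Integration.integral_add[OF int int] add_divide_distrib)
    also have "\<dots> \<le> (2 * B1 + 2 * B2) / T + T * singular_prob n (q n)"
      using elim(2,3) T by (intro add_right_mono divide_right_mono) auto
    also have "\<dots> < e / 2 + e / 2" using TB elim(1) by linarith
    finally show ?case by (simp add: X_def[abs_def] X'_def[abs_def] dist_real_def)
  qed
qed

theorem theorem1p10: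
  fixes p :: nat and c :: real and \<alpha> \<beta> :: "nat \<Rightarrow> real"
    and G :: "('a, 'b) monoid_scheme"
  assumes "prime p" and "c > 1"
    and "\<And>n. \<alpha> n = c * ln (real n) / real n"
    and "\<And>n. n \<ge> 1 \<Longrightarrow> \<alpha> n \<le> 1 / 2 \<Longrightarrow> \<beta> n \<in> {\<alpha> n..1 - \<alpha> n}"
    and "comm_group G" and "finite (carrier G)" and "\<exists>k. card (carrier G) = p ^ k"
  shows "(\<lambda>n. measure_pmf.expectation (erdos_renyi n (\<beta> n))
            (\<lambda>E. real (card (Sur (sylow_part p (sandpile_group n E)) G))))
          \<longlonglongrightarrow> real (card (carrier (exterior_square G)))"
proof -
  obtain k where k: "card (carrier G) = p ^ k" using assms(7) by blast
  have q: "dense_enough ((1 + c) / 2) \<beta>" by (rule dense_enoughI[OF assms(2-4)])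
  have "card (carrier (exterior_square G)) = card (alt_bichars G)"
    using exterior.card_exterior_square[of G] assms(5,6) by (simp add: exterior_def)
  moreover have "(\<lambda>n. expected_surs G n (\<beta> n)) \<longlonglongrightarrow> card (alt_bichars G)"
    by (rule comm_group.expected_surs_tendsto[OF assms(5,6) q])
  ultimately show ?thesis
    using Lim_transform[OF _ Sur_sylow_deviation_tendsto[OF assms(1,5,6) k q]] by simp
qed

end
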